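(* Let $T>0$ and let $\gamma,\gamma_0\in L^\infty(0,\pi)$ with $\inf_{(0,\pi)}\gamma>0$. Suppose that $q=0$. There exist $p\in W^{1,\infty}(0,\pi)$ and a control domain $\omega$ (a non-empty open subset of $(0,\pi)$) such that $\operatorname{supp}p\cap\omega\neq\emptyset$ and the system $$ \begin{cases} \partial_t y+\begin{pmatrix}\mathfrak L&0\\0&\mathfrak L\end{pmatrix}y=\begin{pmatrix}0&0\\-p(x)&0\end{pmatrix}\partial_x y+\mathbb 1_\omega\begin{pmatrix}v\\0\end{pmatrix} & \text{in }(0,\pi)\times(0,T),\\ y(0,\cdot)=y(\pi,\cdot)=0,\\ y(\cdot,0)=y^0 \end{cases} $$ is not approximately controllable at time $T$.
   Context: $\mathfrak L=-\partial_x(\gamma(x)\partial_x\,\cdot)+\gamma_0(x)\,\cdot$ is the scalar operator on $L^2(0,\pi)$ with domain $\mathcal D(\mathfrak L)=\{u\in H^1_0(0,\pi):\mathfrak Lu\in L^2(0,\pi)\}$. In the system, $y\in C^0([0,T],L^2(0,\pi)^2)$ is the unknown, $y^0\in L^2(0,\pi)^2$ the initial data, and $v\in L^2((0,T)\times(0,\pi))$ the control. Approximate controllability at time $T$: for all $\varepsilon>0$ and all $y^0,y^1\in L^2(0,\pi)^2$ there exists a control $v\in L^2((0,T)\times(0,\pi))$ such that the corresponding solution satisfies $\|y(T)-y^1\|_{L^2(0,\pi)^2}\le\varepsilon$. *)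

theory Defs
  imports "HOL-Analysis.Analysis"
begin

text \<open>
  Elements of Lebesgue and Sobolev spaces are represented by functions \<open>real \<Rightarrow> real\<close>; every notion
  below depends only on the class of the function modulo null sets of its domain.
\<close>

abbreviation itv :: "real set" where
  "itv \<equiv> {0<..<pi}"

abbreviation itv_measure :: "real measure" where
  "itv_measure \<equiv> lebesgue_on itv"

abbreviation cyl_measure :: "real \<Rightarrow> (real \<times> real) measure" where
  "cyl_measure T \<equiv> lebesgue_on {0<..<T} \<Otimes>\<^sub>M itv_measure"

definition L2 :: "'a measure \<Rightarrow> ('a \<Rightarrow> real) set" where
  "L2 M = {f \<in> borel_measurable M. integrable M (\<lambda>x. (f x)\<^sup>2)}"

definition L2_norm :: "'a measure \<Rightarrow> ('a \<Rightarrow> real) \<Rightarrow> real" where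
  "L2_norm M f = sqrt (LINT x|M. (f x)\<^sup>2)"

definition L_infty :: "'a measure \<Rightarrow> ('a \<Rightarrow> real) set" where
  "L_infty M = {f \<in> borel_measurable M. \<exists>C. AE x in M. \<bar>f x\<bar> \<le> C}"

definition L1_loc :: "(real \<Rightarrow> real) set" where
  "L1_loc = {f. \<forall>a b. 0 < a \<longrightarrow> b < pi \<longrightarrow> set_integrable lebesgue {a..b} f}"


definition test_functions :: "(real \<Rightarrow> real) set" where
  "test_functions =
     {\<phi>. (\<forall>k x. ((deriv ^^ k) \<phi>) field_differentiable (at x)) \<and> closure {x. \<phi> x \<noteq> 0} \<subseteq> itv}"

definition has_weak_deriv :: "(real \<Rightarrow> real) \<Rightarrow> (real \<Rightarrow> real) \<Rightarrow> bool" where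
  "has_weak_deriv u g \<longleftrightarrow> u \<in> L1_loc \<and> g \<in> L1_loc \<and>
     (\<forall>\<phi>\<in>test_functions.
        (LINT x|itv_measure. u x * deriv \<phi> x) = - (LINT x|itv_measure. g x * \<phi> x))"

text \<open>
  A weak derivative is unique almost everywhere, so the choice only picks a representative. The
  value is meaningful only where a weak derivative exists.
\<close>

definition weak_deriv :: "(real \<Rightarrow> real) \<Rightarrow> real \<Rightarrow> real" where
  "weak_deriv u = (SOME g. has_weak_deriv u g)"

definition weakly_differentiable :: "(real \<Rightarrow> real) \<Rightarrow> bool" where
  "weakly_differentiable u \<longleftrightarrow> (\<exists>g. has_weak_deriv u g)"

definition W1_infty :: "(real \<Rightarrow> real) set" where
  "W1_infty = {u \<in> L_infty itv_measure.
     weakly_differentiable u \<and> weak_deriv u \<in> L_infty itv_measure}"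

definition H1 :: "(real \<Rightarrow> real) set" where
  "H1 = {u \<in> L2 itv_measure. weakly_differentiable u \<and> weak_deriv u \<in> L2 itv_measure}"

definition H1_norm :: "(real \<Rightarrow> real) \<Rightarrow> real" where
  "H1_norm u = sqrt ((L2_norm itv_measure u)\<^sup>2 + (L2_norm itv_measure (weak_deriv u))\<^sup>2)"

definition H10 :: "(real \<Rightarrow> real) set" where
  "H10 = {u \<in> H1. \<exists>\<phi>. (\<forall>n. \<phi> n \<in> test_functions) \<and>
     (\<lambda>n::nat. H1_norm (\<lambda>x. \<phi> n x - u x)) \<longlonglongrightarrow> 0}"

text \<open>
  The support of a class of functions: the complement of the largest relatively open subset of
  \<open>itv\<close> on which the function vanishes almost everywhere. (The closure of the set of points where
  a representative is nonzero would depend on the representative.)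
\<close>

definition ess_support :: "(real \<Rightarrow> real) \<Rightarrow> real set" where
  "ess_support p =
     {x \<in> itv. \<forall>U. open U \<longrightarrow> x \<in> U \<longrightarrow> \<not> (AE z in itv_measure. z \<in> U \<longrightarrow> p z = 0)}"


definition Lop :: "(real \<Rightarrow> real) \<Rightarrow> (real \<Rightarrow> real) \<Rightarrow> (real \<Rightarrow> real) \<Rightarrow> real \<Rightarrow> real" where
  "Lop \<gamma> \<gamma>0 u = (\<lambda>x. - weak_deriv (\<lambda>z. \<gamma> z * weak_deriv u z) x + \<gamma>0 x * u x)"

text \<open>
  For \<open>u\<close> in \<open>H10\<close> and bounded \<open>\<gamma>0\<close>, the distribution \<open>Lop \<gamma> \<gamma>0 u\<close> can only be an \<open>L2\<close> function if
  the distributional derivative of \<open>\<gamma> u'\<close> is a function; hence the second condition.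
\<close>

definition Lop_domain :: "(real \<Rightarrow> real) \<Rightarrow> (real \<Rightarrow> real) \<Rightarrow> (real \<Rightarrow> real) set" where
  "Lop_domain \<gamma> \<gamma>0 = {u \<in> H10.
     weakly_differentiable (\<lambda>z. \<gamma> z * weak_deriv u z) \<and> Lop \<gamma> \<gamma>0 u \<in> L2 itv_measure}"


text \<open>
  A curve \<open>y\<close>, with \<open>y t x\<close> its value at time \<open>t\<close> and position \<open>x\<close>, continuous from \<open>[0,T]\<close> to
  \<open>L2 itv_measure\<close>. Joint measurability is no restriction: every continuous curve of classes has
  jointly measurable representatives.
\<close>

definition L2_continuous_curve :: "real \<Rightarrow> (real \<Rightarrow> real \<Rightarrow> real) \<Rightarrow> bool" where
  "L2_continuous_curve T y \<longleftrightarrow>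
     (\<lambda>(t, x). y t x) \<in> borel_measurable (cyl_measure T) \<and>
     (\<forall>t\<in>{0..T}. y t \<in> L2 itv_measure) \<and>
     (\<forall>t\<in>{0..T}. ((\<lambda>s. L2_norm itv_measure (\<lambda>x. y s x - y t x)) \<longlongrightarrow> 0) (at t within {0..T}))"

definition time_integral :: "(real \<Rightarrow> real \<Rightarrow> real) \<Rightarrow> real \<Rightarrow> real \<Rightarrow> real" where
  "time_integral y t = (\<lambda>x. LINT s|lebesgue_on {0<..<t}. y s x)"

text \<open>
  Solutions are mild solutions in the sense of semigroup theory: the equation is integrated in
  time from \<open>0\<close> to \<open>t\<close>, and the integrated state is required to lie in the domain of the spatial
  operator \<open>(u1, u2) \<mapsto> (Lop u1, Lop u2 + p u1')\<close>. That domain is \<open>D \<times> D\<close> with \<open>D = Lop_domain \<gamma> \<gamma>0\<close>,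
  because \<open>p u1'\<close> is square integrable for \<open>u1\<close> in \<open>H10\<close>. The boundary condition is contained in \<open>D\<close>.
  For a generator of a strongly continuous semigroup this notion is equivalent to the variation
  of constants formula.
\<close>

definition is_solution ::
  "real \<Rightarrow> (real \<Rightarrow> real) \<Rightarrow> (real \<Rightarrow> real) \<Rightarrow> (real \<Rightarrow> real) \<Rightarrow> real set \<Rightarrow> (real \<Rightarrow> real \<Rightarrow> real) \<Rightarrow>
   (real \<Rightarrow> real) \<Rightarrow> (real \<Rightarrow> real) \<Rightarrow> (real \<Rightarrow> real \<Rightarrow> real) \<Rightarrow> (real \<Rightarrow> real \<Rightarrow> real) \<Rightarrow> bool" where
  "is_solution T \<gamma> \<gamma>0 p \<omega> v y01 y02 y1 y2 \<longleftrightarrow>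
     L2_continuous_curve T y1 \<and> L2_continuous_curve T y2 \<and>
     (AE x in itv_measure. y1 0 x = y01 x \<and> y2 0 x = y02 x) \<and>
     (\<forall>t\<in>{0..T}.
        time_integral y1 t \<in> Lop_domain \<gamma> \<gamma>0 \<and>
        time_integral y2 t \<in> Lop_domain \<gamma> \<gamma>0 \<and>
        (AE x in itv_measure.
           y1 t x - y01 x + Lop \<gamma> \<gamma>0 (time_integral y1 t) x = indicator \<omega> x * time_integral v t x) \<and>
        (AE x in itv_measure.
           y2 t x - y02 x + Lop \<gamma> \<gamma>0 (time_integral y2 t) x = - p x * weak_deriv (time_integral y1 t) x))"

definition approx_controllable ::
  "real \<Rightarrow> (real \<Rightarrow> real) \<Rightarrow> (real \<Rightarrow> real) \<Rightarrow> (real \<Rightarrow> real) \<Rightarrow> real set \<Rightarrow> bool" where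
  "approx_controllable T \<gamma> \<gamma>0 p \<omega> \<longleftrightarrow>
     (\<forall>\<epsilon>>0. \<forall>y01\<in>L2 itv_measure. \<forall>y02\<in>L2 itv_measure.
        \<forall>z1\<in>L2 itv_measure. \<forall>z2\<in>L2 itv_measure.
        \<exists>v y1 y2. (\<lambda>(t, x). v t x) \<in> L2 (cyl_measure T) \<and>
          is_solution T \<gamma> \<gamma>0 p \<omega> v y01 y02 y1 y2 \<and>
          sqrt ((L2_norm itv_measure (\<lambda>x. y1 T x - z1 x))\<^sup>2 +
                (L2_norm itv_measure (\<lambda>x. y2 T x - z2 x))\<^sup>2) \<le> \<epsilon>)"

end

theory Submission
  imports Defs "HOL-Computational_Algebra.Polynomial"
begin

text \<open>
  By duality it suffices to find \<open>p\<close> and a pair \<open>(g, \<Phi>)\<close> with \<open>L \<Phi> = l \<Phi>\<close>, \<open>L g = l g + (p \<Phi>)'\<close> and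
  \<open>g = 0\<close> on \<open>\<omega>\<close>: then \<open>t \<mapsto> \<integral>y2(t) \<Phi> + \<integral>y1(t) g\<close> solves \<open>a' = - l a\<close> whatever the control is, so it stays
  zero if it starts at zero. Let \<open>\<Phi>\<close> be the first Dirichlet eigenfunction, obtained by shooting, and
  \<open>W = \<gamma> \<Phi>'\<close> its flux. For Lipschitz \<open>\<zeta>\<close> put \<open>\<eta> = \<integral>\<zeta>/\<gamma>\<close> and \<open>M = \<integral>W \<zeta>/\<gamma>\<close> (integrals from \<open>0\<close>). With
  \<open>g = \<Phi> \<eta>\<close> the second equation becomes \<open>p \<Phi> = - \<Phi> \<zeta> - M\<close>. Since \<open>W\<close> is not constant, \<open>\<zeta>\<close> can be
  chosen with \<open>\<eta>\<close> and \<open>M\<close> compactly supported in \<open>(0, \<pi>)\<close> and, on some interval \<open>\<omega>\<close>, \<open>\<zeta> = \<eta> = 0\<close> while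
  \<open>M\<close> is a nonzero constant. Then \<open>p = - \<zeta> - M / \<Phi>\<close> is Lipschitz and does not vanish on \<open>\<omega>\<close>.
\<close>

section \<open>Smooth bump functions\<close>

text \<open>The coefficients are only bounded and measurable, so \<open>\<Phi>\<close>, its flux and
  the multiplier are merely Lipschitz. Every such function is therefore carried together with a
  named bounded integrand of which it is a primitive, and the operator is met only through fluxes.
  The formula for \<open>p\<close> arises as follows. With \<gamma> \<eta>' = \<zeta> the flux of g
  = \<Phi> \<eta> is W \<eta> + \<Phi> \<zeta>, and its derivative is (\<gamma>0 - l) \<Phi> \<eta>
  + (\<Phi> \<zeta>)' + W \<zeta> / \<gamma>. The first term accounts for l g, hence L g = l g -
  (\<Phi> \<zeta> + M)', and p \<Phi> = - \<Phi> \<zeta> - M with the constant of integration taken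
  as zero. Two demands compete: \<open>g\<close> must vanish on \<omega>, so \<eta> has to return to
  zero there, while \<open>M\<close> must not, and yet \<open>M\<close> must be zero near both ends,
  where division by \<Phi> would be singular. The values of \<open>p\<close> outside \<omega> thus
  cancel the effect of those inside.\<close>

definition flat_exp :: "real poly \<Rightarrow> real \<Rightarrow> real" where
  "flat_exp P x = (if 0 < x then poly P (1 / x) * exp (- (1 / x)) else 0)"

text \<open>The free power of \<open>y\<close> makes the induction on the coefficients go through:
  splitting off the constant term leaves \<open>y\<close> times a shorter polynomial, and that
  \<open>y\<close> is absorbed into the power.\<close>

lemma power_poly_exp_tendsto_0:
  fixes P :: "real poly"
  shows "((\<lambda>y. y ^ k * poly P y * exp (- y)) \<longlongrightarrow> 0) at_top"
proof (induction P arbitrary: k)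
  case 0
  then show ?case by simp
next
  case (pCons a P)
  have 1: "((\<lambda>y. a * (y ^ k / exp y)) \<longlongrightarrow> a * 0) at_top"
    by (intro tendsto_mult tendsto_const tendsto_power_div_exp_0)
  have "((\<lambda>y. a * (y ^ k / exp y) + y ^ Suc k * poly P y * exp (- y)) \<longlongrightarrow> a * 0 + 0) at_top"
    by (rule tendsto_add[OF 1 pCons.IH])
  moreover have "(\<lambda>y. a * (y ^ k / exp y) + y ^ Suc k * poly P y * exp (- y)) =
      (\<lambda>y. y ^ k * poly (pCons a P) y * exp (- y))"
    by (auto simp: fun_eq_iff algebra_simps exp_minus divide_inverse)
  ultimately show ?case by simp
qed

lemma flat_exp_tendsto_0: "(flat_exp P \<longlongrightarrow> 0) (at 0)"
proof -
  have "((\<lambda>y. poly P y * exp (- y)) \<longlongrightarrow> 0) at_top"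
    using power_poly_exp_tendsto_0[of 0 P] by simp
  then have "((\<lambda>x. poly P (1 / x) * exp (- (1 / x))) \<longlongrightarrow> 0) (at_right 0)"
    by (rule filterlim_compose) (simp add: filterlim_inverse_at_top_right divide_inverse)
  then have r: "(flat_exp P \<longlongrightarrow> 0) (at_right 0)"
    by (rule Lim_transform_eventually)
      (auto simp: flat_exp_def eventually_at_filter)
  have l: "(flat_exp P \<longlongrightarrow> 0) (at_left 0)"
    by (rule Lim_transform_eventually[OF tendsto_const])
      (auto simp: flat_exp_def eventually_at_filter)
  from l r show ?thesis by (rule filterlim_split_at)
qed

text \<open>With y = 1/x one has dy/dx = - y^2 and d/dy (P e^(-y)) = (P' - P) e^(-y), which gives
  the polynomial (P - P') y^2. The family is thus closed under differentiation.\<close>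

lemma flat_exp_has_field_derivative:
  "(flat_exp P has_field_derivative flat_exp ((P - pderiv P) * [:0, 0, 1:]) x) (at x)"
proof -
  consider "0 < x" | "x < 0" | "x = 0" by linarith
  then show ?thesis
  proof cases
    case 1
    have "((\<lambda>x. poly P (1 / x) * exp (- (1 / x))) has_field_derivative
        flat_exp ((P - pderiv P) * [:0, 0, 1:]) x) (at x)"
      using 1 unfolding flat_exp_def
      by (auto intro!: derivative_eq_intros simp: field_simps power2_eq_square)
    then show ?thesis
    proof (rule has_field_derivative_transform_within[where d = x])
      fix y assume "dist y x < x"
      then have "0 < y" by (auto simp: dist_real_def)
      then show "poly P (1 / y) * exp (- (1 / y)) = flat_exp P y" by (simp add: flat_exp_def)
    qed (use 1 in auto)
  next
    case 2
    have "((\<lambda>_. 0::real) has_field_derivative 0) (at x)" by simp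
    then have "(flat_exp P has_field_derivative 0) (at x)"
    proof (rule has_field_derivative_transform_within[where d = "- x"])
      fix y assume "dist y x < - x"
      then have "y < 0" by (auto simp: dist_real_def)
      then show "0 = flat_exp P y" by (simp add: flat_exp_def)
    qed (use 2 in auto)
    with 2 show ?thesis by (simp add: flat_exp_def)
  next
    case 3
    \<comment> \<open>The difference quotient at the origin multiplies by 1/h, that is, the
      polynomial by its variable; it is again a flat exponential, so the limit at 0 is already
      known.\<close>
    have "(flat_exp ([:0, 1:] * P) \<longlongrightarrow> 0) (at 0)" by (rule flat_exp_tendsto_0)
    moreover have "flat_exp ([:0, 1:] * P) = (\<lambda>h. (flat_exp P (0 + h) - flat_exp P 0) / h)"
      by (auto simp: flat_exp_def fun_eq_iff)
    ultimately have "(flat_exp P has_field_derivative 0) (at 0)"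
      unfolding DERIV_def by simp
    with 3 show ?thesis by (simp add: flat_exp_def)
  qed
qed

text \<open>The span of products of two flat exponentials is closed under differentiation, which gives
  the smoothness of each member at once.\<close>

inductive_set bumps :: "real \<Rightarrow> real \<Rightarrow> real \<Rightarrow> (real \<Rightarrow> real) set" for n a b where
  prod: "(\<lambda>x. flat_exp P (n * (x - a)) * flat_exp Q (n * (b - x))) \<in> bumps n a b"
| add: "f \<in> bumps n a b \<Longrightarrow> g \<in> bumps n a b \<Longrightarrow> (\<lambda>x. f x + g x) \<in> bumps n a b"

lemma flat_exp_smult: "flat_exp (smult c P) x = c * flat_exp P x"
  by (simp add: flat_exp_def)

lemma bumps_deriv:
  assumes "f \<in> bumps n a b"
  shows "\<exists>g\<in>bumps n a b. \<forall>x. (f has_field_derivative g x) (at x)"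
  using assms
proof induction
  case (prod P Q)
  define P' where "P' = smult n ((P - pderiv P) * [:0, 0, 1:])"
  define Q' where "Q' = smult (- n) ((Q - pderiv Q) * [:0, 0, 1:])"
  have P: "((\<lambda>x. flat_exp P (n * (x - a))) has_field_derivative flat_exp P' (n * (x - a))) (at x)" for x
  proof -
    have "((\<lambda>x. n * (x - a)) has_field_derivative n) (at x)"
      by (auto intro!: derivative_eq_intros)
    from DERIV_chain2[OF flat_exp_has_field_derivative this, of P] show ?thesis
      unfolding P'_def flat_exp_smult by (simp only: mult.commute)
  qed
  have Q: "((\<lambda>x. flat_exp Q (n * (b - x))) has_field_derivative flat_exp Q' (n * (b - x))) (at x)" for x
  proof -
    have "((\<lambda>x. n * (b - x)) has_field_derivative - n) (at x)"
      by (auto intro!: derivative_eq_intros)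
    from DERIV_chain2[OF flat_exp_has_field_derivative this, of Q] show ?thesis
      unfolding Q'_def flat_exp_smult by (simp only: mult.commute)
  qed
  have "(\<lambda>x. flat_exp P' (n * (x - a)) * flat_exp Q (n * (b - x)) +
      flat_exp P (n * (x - a)) * flat_exp Q' (n * (b - x))) \<in> bumps n a b"
    by (intro bumps.intros)
  then show ?case
    by (rule bexI[rotated]) (auto intro!: derivative_eq_intros P Q)
next
  case (add f g)
  then obtain f' g' where "f' \<in> bumps n a b" "g' \<in> bumps n a b"
    "\<forall>x. (f has_field_derivative f' x) (at x)" "\<forall>x. (g has_field_derivative g' x) (at x)"
    by blast
  then show ?case
    by (intro bexI[of _ "\<lambda>x. f' x + g' x"] bumps.add allI derivative_intros) auto
qed

lemma bumps_higher_deriv: "f \<in> bumps n a b \<Longrightarrow> (deriv ^^ k) f \<in> bumps n a b"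
proof (induction k)
  case (Suc k)
  then obtain g where g: "g \<in> bumps n a b" "\<forall>x. ((deriv ^^ k) f has_field_derivative g x) (at x)"
    using bumps_deriv by blast
  then have "deriv ((deriv ^^ k) f) = g" by (auto simp: fun_eq_iff intro: DERIV_imp_deriv)
  with g show ?case by simp
qed simp

text \<open>Inside (a, b) the value is exp(- 1/(n(x - a)) - 1/(n(b - x))). The parameter
  \<open>n\<close> steepens the flanks, so that the bumps tend to the indicator of the interval
  while staying below 1.\<close>

definition bump :: "real \<Rightarrow> real \<Rightarrow> real \<Rightarrow> real \<Rightarrow> real" where
  "bump n a b x = flat_exp 1 (n * (x - a)) * flat_exp 1 (n * (b - x))"

lemma bump_eq_0: "0 < n \<Longrightarrow> x \<notin> {a<..<b} \<Longrightarrow> bump n a b x = 0"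
  by (auto simp: bump_def flat_exp_def zero_less_mult_iff)

lemma bump_pos: "0 < n \<Longrightarrow> x \<in> {a<..<b} \<Longrightarrow> 0 < bump n a b x"
  by (auto simp: bump_def flat_exp_def zero_less_mult_iff)

lemma bump_nonneg: "0 \<le> bump n a b x"
  by (auto simp: bump_def flat_exp_def)

lemma bump_le_1: "bump n a b x \<le> 1"
  unfolding bump_def flat_exp_def by (auto intro!: mult_le_one)

lemma bump_test_function:
  assumes "0 < n" "0 < a" "b < pi"
  shows "bump n a b \<in> test_functions"
proof -
  have b: "bump n a b \<in> bumps n a b"
    using bumps.prod[of 1 n a 1 b] unfolding bump_def[abs_def] .
  have "((deriv ^^ k) (bump n a b)) field_differentiable (at x)" for k x
    using bumps_deriv[OF bumps_higher_deriv[OF b]] field_differentiable_def by blast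
  moreover have "closure {x. bump n a b x \<noteq> 0} \<subseteq> {a..b}"
  proof (rule closure_minimal)
    show "{x. bump n a b x \<noteq> 0} \<subseteq> {a..b}"
    proof
      fix x assume "x \<in> {x. bump n a b x \<noteq> 0}"
      then have "x \<in> {a<..<b}" using bump_eq_0[OF assms(1), of x a b] by auto
      then show "x \<in> {a..b}" by simp
    qed
  qed simp
  then have "closure {x. bump n a b x \<noteq> 0} \<subseteq> itv" using assms by auto
  ultimately show ?thesis by (auto simp: test_functions_def)
qed

lemma bump_tendsto_indicator:
  "(\<lambda>n. bump (real (Suc n)) a b x) \<longlonglongrightarrow> indicator {a<..<b} x"
proof (cases "x \<in> {a<..<b}")
  case True
  have *: "(\<lambda>n. exp (- (1 / (real (Suc n) * c)))) \<longlonglongrightarrow> exp (- 0)" if "0 < c" for c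
  proof -
    have "(\<lambda>n. (1 / c) * inverse (real (Suc n))) \<longlonglongrightarrow> (1 / c) * 0"
      by (intro tendsto_mult tendsto_const LIMSEQ_inverse_real_of_nat)
    then have "(\<lambda>n. 1 / (real (Suc n) * c)) \<longlonglongrightarrow> 0" by (simp add: field_simps)
    then show ?thesis by (intro tendsto_intros)
  qed
  have "(\<lambda>n. exp (- (1 / (real (Suc n) * (x - a)))) * exp (- (1 / (real (Suc n) * (b - x)))))
      \<longlonglongrightarrow> exp (- 0) * exp (- 0)"
    by (intro tendsto_mult *) (use True in auto)
  moreover have "bump (real (Suc n)) a b x =
      exp (- (1 / (real (Suc n) * (x - a)))) * exp (- (1 / (real (Suc n) * (b - x))))" for n
    using True by (auto simp: bump_def flat_exp_def zero_less_mult_iff)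
  ultimately show ?thesis using True by simp
next
  case False
  then have "bump (real (Suc n)) a b x = 0" for n by (intro bump_eq_0) auto
  moreover have "indicator {a<..<b} x = (0::real)" using False by simp
  ultimately show ?thesis by (simp only: tendsto_const)
qed

section \<open>Test functions: supports, derivatives and primitives\<close>

lemma test_function_diff: "\<phi> \<in> test_functions \<Longrightarrow> \<phi> field_differentiable (at x)"
  by (auto simp: test_functions_def dest!: spec[of _ "0::nat"])

lemma test_function_DERIV: "\<phi> \<in> test_functions \<Longrightarrow> (\<phi> has_field_derivative deriv \<phi> x) (at x)"
  using test_function_diff DERIV_deriv_iff_field_differentiable by blast

lemma test_function_continuous: "\<phi> \<in> test_functions \<Longrightarrow> continuous_on S \<phi>"
  by (meson test_function_diff continuous_at_imp_continuous_on field_differentiable_imp_continuous_at)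

lemma eq_0_if_notin_closure: "x \<notin> closure {x. f x \<noteq> 0} \<Longrightarrow> f x = 0"
  using closure_subset[of "{x. f x \<noteq> 0}"] by blast

lemma test_function_eq_0: "\<phi> \<in> test_functions \<Longrightarrow> x \<notin> itv \<Longrightarrow> \<phi> x = 0"
  by (rule eq_0_if_notin_closure) (auto simp: test_functions_def)

lemma test_function_support:
  assumes "\<phi> \<in> test_functions"
  obtains a b where "0 < a" "a < b" "b < pi" "\<And>x. x \<notin> {a..b} \<Longrightarrow> \<phi> x = 0"
proof -
  let ?S = "closure {x. \<phi> x \<noteq> 0}"
  have sub: "?S \<subseteq> itv" using assms by (auto simp: test_functions_def)
  then have c: "compact ?S"
  proof -
    have "?S \<subseteq> {0..pi}" by (rule subset_trans[OF sub]) auto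
    then have "bounded ?S" by (rule bounded_subset[OF bounded_closed_interval])
    then show ?thesis by (simp only: compact_eq_bounded_closed closed_closure simp_thms)
  qed
  show ?thesis
  proof (cases "?S = {}")
    case True
    \<comment> \<open>The zero function has empty support, so any fixed subinterval serves.\<close>
    then show ?thesis using that[of "1" "2"] pi_gt3 by auto
  next
    case False
    obtain l where l: "l \<in> ?S" "\<And>x. x \<in> ?S \<Longrightarrow> l \<le> x" using compact_attains_inf[OF c False] by auto
    obtain r where r: "r \<in> ?S" "\<And>x. x \<in> ?S \<Longrightarrow> x \<le> r" using compact_attains_sup[OF c False] by auto
    have lr: "0 < l" "r < pi" "l \<le> r" using sub l r by auto
    \<comment> \<open>Moving halfway from the extreme points of the support to the ends of the
      interval gives strict inequalities even if the support were a single point.\<close>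
    show ?thesis
    proof (rule that[of "l / 2" "(r + pi) / 2"])
      fix x assume "x \<notin> {l / 2..(r + pi) / 2}"
      then have "x \<notin> ?S" using l(2)[of x] r(2)[of x] lr by auto
      then show "\<phi> x = 0" by (rule eq_0_if_notin_closure)
    qed (use lr in auto)
  qed
qed

lemma deriv_test_function: "\<phi> \<in> test_functions \<Longrightarrow> deriv \<phi> \<in> test_functions"
proof -
  assume a: "\<phi> \<in> test_functions"
  have "((deriv ^^ k) (deriv \<phi>)) field_differentiable (at x)" for k x
    using a unfolding test_functions_def by (auto dest!: spec[of _ "Suc k"] simp: funpow_swap1)
  moreover have "{x. deriv \<phi> x \<noteq> 0} \<subseteq> closure {x. \<phi> x \<noteq> 0}"
  proof (rule subsetI, rule ccontr)
    fix x assume x: "x \<in> {x. deriv \<phi> x \<noteq> 0}" "x \<notin> closure {x. \<phi> x \<noteq> 0}"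
    have "((\<lambda>_. 0::real) has_field_derivative 0) (at x)" by simp
    moreover have "open (- closure {x. \<phi> x \<noteq> 0})" by (rule open_Compl[OF closed_closure])
    moreover have "x \<in> - closure {x. \<phi> x \<noteq> 0}" using x(2) by simp
    ultimately have "(\<phi> has_field_derivative 0) (at x)"
      by (rule has_field_derivative_transform_within_open) (metis ComplD eq_0_if_notin_closure)
    with x(1) show False using DERIV_imp_deriv by blast
  qed
  then have "closure {x. deriv \<phi> x \<noteq> 0} \<subseteq> closure {x. \<phi> x \<noteq> 0}"
    by (simp add: closure_minimal)
  ultimately show ?thesis using a unfolding test_functions_def by auto
qed

lemma higher_deriv_diff_scale:
  assumes "\<phi> \<in> test_functions" "\<psi> \<in> test_functions"
  shows "(deriv ^^ k) (\<lambda>x. \<phi> x - c * \<psi> x) = (\<lambda>x. (deriv ^^ k) \<phi> x - c * (deriv ^^ k) \<psi> x)"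
proof (induction k)
  case (Suc k)
  have "((deriv ^^ k) \<phi> has_field_derivative (deriv ((deriv ^^ k) \<phi>) x)) (at x)"
    "((deriv ^^ k) \<psi> has_field_derivative (deriv ((deriv ^^ k) \<psi>) x)) (at x)" for x
    using assms by (auto simp: test_functions_def DERIV_deriv_iff_field_differentiable)
  then have "((\<lambda>x. (deriv ^^ k) \<phi> x - c * (deriv ^^ k) \<psi> x) has_field_derivative
      (deriv ((deriv ^^ k) \<phi>) x - c * deriv ((deriv ^^ k) \<psi>) x)) (at x)" for x
    by (intro DERIV_diff DERIV_cmult)
  then show ?case unfolding funpow.simps o_def Suc
    by (auto simp: fun_eq_iff intro!: DERIV_imp_deriv)
qed simp

text \<open>Used to subtract a multiple of a fixed bump from a test function so that the mean
  becomes zero.\<close>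

lemma test_functions_diff_scale:
  assumes "\<phi> \<in> test_functions" "\<psi> \<in> test_functions"
  shows "(\<lambda>x. \<phi> x - c * \<psi> x) \<in> test_functions"
proof -
  have "(deriv ^^ k) (\<lambda>x. \<phi> x - c * \<psi> x) field_differentiable (at x)" for k x
    unfolding higher_deriv_diff_scale[OF assms]
    using assms by (intro derivative_intros) (auto simp: test_functions_def)
  moreover have "closure {x. \<phi> x - c * \<psi> x \<noteq> 0} \<subseteq> closure ({x. \<phi> x \<noteq> 0} \<union> {x. \<psi> x \<noteq> 0})"
    by (rule closure_mono) auto
  then have "closure {x. \<phi> x - c * \<psi> x \<noteq> 0} \<subseteq> itv"
    using assms by (auto simp: test_functions_def)
  ultimately show ?thesis by (auto simp: test_functions_def)
qed

text \<open>The primitive vanishes to the left of the support by construction and to the right of it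
  because the total integral is zero. Hence test functions of mean zero are derivatives of test
  functions.\<close>

lemma test_functions_primitive:
  assumes psi: "\<psi> \<in> test_functions" and int: "integral {0..pi} \<psi> = 0"
  shows "(\<lambda>x. integral {0..x} \<psi>) \<in> test_functions" (is "?F \<in> _")
    and "deriv (\<lambda>x. integral {0..x} \<psi>) = \<psi>"
proof -
  obtain a b where ab: "0 < a" "a < b" "b < pi" "\<And>x. x \<notin> {a..b} \<Longrightarrow> \<psi> x = 0"
    using test_function_support[OF psi] by blast
  have i: "\<psi> integrable_on {u..v}" for u v
    by (intro integrable_continuous_real test_function_continuous psi)
  have low: "?F x = 0" if "x \<le> a" for x
    by (rule integral_unique, rule has_integral_spike_finite[where f = "\<lambda>_. 0" and S = "{a}"])
      (use that ab in auto)
  have high: "?F x = 0" if "b \<le> x" for x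
  proof (cases "x \<le> pi")
    case True
    have "integral {0..x} \<psi> + integral {x..pi} \<psi> = integral {0..pi} \<psi>"
      by (rule Henstock_Kurzweil_Integration.integral_combine) (use that ab True i in auto)
    moreover have "integral {x..pi} \<psi> = 0"
      by (rule integral_unique, rule has_integral_spike_finite[where f = "\<lambda>_. 0" and S = "{b}"])
        (use that ab in auto)
    ultimately show ?thesis using int by simp
  next
    case False
    have "integral {0..pi} \<psi> + integral {pi..x} \<psi> = integral {0..x} \<psi>"
      by (rule Henstock_Kurzweil_Integration.integral_combine) (use that ab False i in auto)
    moreover have "integral {pi..x} \<psi> = 0"
      by (rule integral_unique, rule has_integral_spike_finite[where f = "\<lambda>_. 0" and S = "{b}"])
        (use that ab False in auto)
    ultimately show ?thesis using int by simp
  qed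
  \<comment> \<open>Points x <= 0 are treated apart: there the integral runs over an empty or
    trivial interval and {0..x + 1} is not a neighbourhood of \<open>x\<close>, but the primitive is
    zero up to \<open>a\<close>.\<close>
  have D: "(?F has_field_derivative \<psi> x) (at x)" for x
  proof (cases "x \<le> 0")
    case True
    have "((\<lambda>_. 0::real) has_field_derivative 0) (at x)" by simp
    then have "(?F has_field_derivative 0) (at x)"
      by (rule has_field_derivative_transform_within_open[where S = "{..<a}"])
        (use True ab low in auto)
    then show ?thesis using ab True by simp
  next
    case False
    have "(?F has_real_derivative \<psi> x) (at x within {0..x + 1})"
      by (rule integral_has_real_derivative) (use False psi test_function_continuous in auto)
    then show ?thesis using False by (simp add: at_within_Icc_at)
  qed
  show d: "deriv ?F = \<psi>" using D by (auto simp: fun_eq_iff intro: DERIV_imp_deriv)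
  have "(deriv ^^ k) ?F field_differentiable (at x)" for k x
  proof (cases k)
    case 0
    then show ?thesis using D field_differentiable_def by auto
  next
    case (Suc m)
    then have "(deriv ^^ k) ?F = (deriv ^^ m) \<psi>" using d by (simp add: funpow_swap1)
    then show ?thesis using psi by (simp add: test_functions_def)
  qed
  moreover have "closure {x. ?F x \<noteq> 0} \<subseteq> {a..b}"
  proof (rule closure_minimal)
    show "{x. ?F x \<noteq> 0} \<subseteq> {a..b}"
    proof
      fix x assume "x \<in> {x. ?F x \<noteq> 0}"
      then show "x \<in> {a..b}" using low[of x] high[of x] by (cases "x \<le> a"; cases "b \<le> x") auto
    qed
  qed simp
  then have "closure {x. ?F x \<noteq> 0} \<subseteq> itv" using ab by auto
  ultimately show "?F \<in> test_functions" by (auto simp: test_functions_def)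
qed

section \<open>The fundamental lemma of the calculus of variations\<close>

lemma finite_measure_Ioo: "finite_measure (lebesgue_on {a<..<b::real})"
  by (rule finite_measure_lebesgue_on) (simp add: bounded_set_imp_lmeasurable)

interpretation itv: finite_measure itv_measure
  by (rule finite_measure_Ioo)

text \<open>Dynkin argument: open intervals are stable under intersection and generate the Borel
  sets, and the integral of \<open>f\<close> over a set is countably additive. A function whose
  integrals over all measurable sets vanish is zero almost everywhere.\<close>

lemma AE_eq_0_if_Ioo_integrals_0:
  fixes f :: "real \<Rightarrow> real"
  assumes f: "integrable lebesgue f"
    and z: "\<And>a b. a < b \<Longrightarrow> (LINT x:{a<..<b}|lebesgue. f x) = 0"
  shows "AE x in lebesgue. f x = 0"
proof (rule density_unique_real[OF f integrable_zero])
  have si: "set_integrable lebesgue A f" if "A \<in> sets lebesgue" for A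
    using integrable_mult_indicator[OF that f] by (simp add: set_integrable_def)
  \<comment> \<open>The complement step of the Dynkin induction needs the integral over the whole
    line, obtained by exhausting it with bounded intervals.\<close>
  have U: "(LINT x|lebesgue. f x) = 0"
  proof -
    have "(\<lambda>n. LINT x:{- real n<..<real n}|lebesgue. f x) \<longlonglongrightarrow> (LINT x|lebesgue. f x)"
      unfolding set_lebesgue_integral_def
    proof (rule integral_dominated_convergence[where w = "\<lambda>x. norm (f x)"])
      show "AE x in lebesgue. (\<lambda>n. indicator {- real n<..<real n} x *\<^sub>R f x) \<longlonglongrightarrow> f x"
      proof (rule AE_I2)
        fix x :: real
        obtain N :: nat where N: "\<bar>x\<bar> < real N" using reals_Archimedean2 by blast
        have "\<forall>\<^sub>F n in sequentially. f x = indicator {- real n<..<real n} x *\<^sub>R f x"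
          using eventually_ge_at_top[of N] proof eventually_elim
          case (elim n)
          then have "real N \<le> real n" by simp
          with N have "x \<in> {- real n<..<real n}" by auto
          then show ?case by simp
        qed
        then show "(\<lambda>n. indicator {- real n<..<real n} x *\<^sub>R f x) \<longlonglongrightarrow> f x"
          by (rule Lim_transform_eventually[OF tendsto_const])
      qed
      show "(\<lambda>x. indicator {- real n<..<real n} x *\<^sub>R f x) \<in> borel_measurable lebesgue" for n
        using si[of "{- real n<..<real n}"] by (auto simp: set_integrable_def dest: borel_measurable_integrable)
    qed (use f in \<open>auto split: split_indicator\<close>)
    moreover have "(LINT x:{- real n<..<real n}|lebesgue. f x) = 0" for n
    proof (cases n)
      case 0
      then show ?thesis by (simp add: set_lebesgue_integral_def)
    next
      case (Suc m)
      then show ?thesis by (intro z) auto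
    qed
    ultimately show ?thesis by (simp add: LIMSEQ_const_iff)
  qed
  have leb: "A \<in> sets lebesgue" if "A \<in> sigma_sets UNIV (range (\<lambda>(a, b). box a b :: real set))" for A
  proof -
    have "A \<in> sets borel" using that by (simp add: borel_eq_box)
    then show ?thesis by simp
  qed
  have B: "(LINT x:A|lebesgue. f x) = 0" if "A \<in> sets borel" for A
  proof -
    have "Int_stable (range (\<lambda>(a, b). box a b :: real set))"
    proof (rule Int_stableI)
      fix a b :: "real set"
      assume "a \<in> range (\<lambda>(a, b). box a b)" "b \<in> range (\<lambda>(a, b). box a b)"
      then obtain x y u v where "a = {x<..<y}" "b = {u<..<v}" by auto
      then have "a \<inter> b = box (max x u) (min y v)" by auto
      then show "a \<inter> b \<in> range (\<lambda>(a, b). box a b)" by auto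
    qed
    moreover have "range (\<lambda>(a, b). box a b :: real set) \<subseteq> Pow UNIV" by simp
    moreover have "A \<in> sigma_sets UNIV (range (\<lambda>(a, b). box a b :: real set))"
      using that by (simp add: borel_eq_box)
    ultimately show ?thesis
    proof (induction rule: sigma_sets_induct_disjoint)
      case (basic A)
      then obtain a b where A: "A = {a<..<b}" by auto
      show ?case
      proof (cases "a < b")
        case True
        then show ?thesis using A z by simp
      next
        case False
        then show ?thesis using A by (simp add: set_lebesgue_integral_def)
      qed
    next
      case (compl A)
      then have A: "A \<in> sets lebesgue" using leb by blast
      have "(LINT x:A \<union> (UNIV - A)|lebesgue. f x) =
          (LINT x:A|lebesgue. f x) + (LINT x:UNIV - A|lebesgue. f x)"
        by (rule set_integral_Un) (use A in \<open>auto intro!: si\<close>)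
      then show ?case using U compl by (simp add: set_lebesgue_integral_def)
    next
      case (union A)
      then have A: "A i \<in> sets lebesgue" for i using leb by blast
      have "(LINT x:(\<Union>i. A i)|lebesgue. f x) = (\<Sum>i. (LINT x:(A i)|lebesgue. f x))"
        by (rule lebesgue_integral_countable_add)
          (use A union(1) in \<open>auto intro!: si simp: disjoint_family_on_def\<close>)
      then show ?case using union by simp
    qed (auto simp: set_lebesgue_integral_def)
  qed
  \<comment> \<open>A Lebesgue set is a Borel set up to a subset of a null set, which does not
    change the integral.\<close>
  fix A :: "real set" assume A: "A \<in> sets lebesgue"
  then obtain S N N' where S: "A = S \<union> N" "N \<subseteq> N'" "N' \<in> null_sets lborel" "S \<in> sets lborel"
    by (rule sets_completionE)
  have "(LINT x:A|lebesgue. f x) = (LINT x:S|lebesgue. f x)"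
  proof (rule set_integral_cong_set)
    have "AE x in lebesgue. x \<notin> N'"
      using S(3) by (intro AE_not_in null_sets_completionI)
    then show "AE x in lebesgue. x \<in> S \<longleftrightarrow> x \<in> A" using S by auto
  qed (use A S si[of A] si[of S] in
      \<open>auto simp: set_integrable_def set_borel_measurable_def intro: borel_measurable_integrable\<close>)
  then show "(LINT x:A|lebesgue. f x) = (LINT x:A|lebesgue. 0)"
    using B[of S] S by (simp add: set_lebesgue_integral_def)
qed

lemma integral_itv_eq: "(LINT x|itv_measure. f x) = (LINT x:itv|lebesgue. f x)" for f :: "real \<Rightarrow> real"
  by (simp add: integral_restrict_space set_lebesgue_integral_def)

lemma integrable_itv_iff: "integrable itv_measure f \<longleftrightarrow> set_integrable lebesgue itv f" for f :: "real \<Rightarrow> real"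
  by (simp add: integrable_restrict_space set_integrable_def)

lemma L1_loc_integrable: "integrable itv_measure f \<Longrightarrow> f \<in> L1_loc"
  unfolding L1_loc_def integrable_itv_iff by (auto intro: set_integrable_subset)

text \<open>Bumps converge boundedly to indicators of open intervals, so the integrals of
  \<open>g\<close> over such intervals vanish. As \<open>g\<close> is only locally integrable, this
  is done on each compact [\<alpha>, \<beta>], where |g| is an integrable majorant.\<close>

lemma AE_eq_0_if_orthogonal_test_functions:
  assumes g: "g \<in> L1_loc"
    and z: "\<And>\<phi>. \<phi> \<in> test_functions \<Longrightarrow> (LINT x|itv_measure. g x * \<phi> x) = 0"
  shows "AE x in itv_measure. g x = 0"
proof -
  have loc: "AE x in lebesgue. indicator {\<alpha>..\<beta>} x * g x = 0" if ab: "0 < \<alpha>" "\<beta> < pi" for \<alpha> \<beta>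
  proof (rule AE_eq_0_if_Ioo_integrals_0)
    show int: "integrable lebesgue (\<lambda>x. indicator {\<alpha>..\<beta>} x * g x)"
      using g ab by (auto simp: L1_loc_def set_integrable_def)
    fix a b :: real assume "a < b"
    \<comment> \<open>The part of (a, b) inside [\<alpha>, \<beta>]. If it is empty, the bump is
      identically zero and the argument still holds.\<close>
    define a' b' where "a' = max a \<alpha>" and "b' = min b \<beta>"
    have ab': "0 < a'" "b' < pi" using ab by (auto simp: a'_def b'_def)
    have "(\<lambda>n. LINT x|lebesgue. (indicator {\<alpha>..\<beta>} x * g x) * bump (real (Suc n)) a' b' x) \<longlonglongrightarrow>
        (LINT x|lebesgue. (indicator {\<alpha>..\<beta>} x * g x) * indicator {a'<..<b'} x)"
    proof (rule integral_dominated_convergence[where w = "\<lambda>x. norm (indicator {\<alpha>..\<beta>} x * g x)"])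
      show "AE x in lebesgue. (\<lambda>n. (indicator {\<alpha>..\<beta>} x * g x) * bump (real (Suc n)) a' b' x)
          \<longlonglongrightarrow> (indicator {\<alpha>..\<beta>} x * g x) * indicator {a'<..<b'} x"
        by (intro AE_I2 tendsto_mult tendsto_const bump_tendsto_indicator)
      have m: "bump n a' b' \<in> borel_measurable borel" if "0 < n" for n
        using bump_test_function[OF that ab'] test_function_continuous
        by (auto intro: borel_measurable_continuous_onI)
      show "(\<lambda>x. (indicator {\<alpha>..\<beta>} x * g x) * bump (real (Suc n)) a' b' x) \<in> borel_measurable lebesgue" for n
        by (intro borel_measurable_times borel_measurable_integrable[OF int] measurable_completion) (simp add: m)
      show "AE x in lebesgue. norm ((indicator {\<alpha>..\<beta>} x * g x) * bump (real (Suc n)) a' b' x)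
          \<le> norm (indicator {\<alpha>..\<beta>} x * g x)" for n
        using bump_le_1[of "real (Suc n)" a' b'] bump_nonneg[of "real (Suc n)" a' b']
        by (intro AE_I2) (auto simp: abs_mult intro!: mult_left_le)
      show "integrable lebesgue (\<lambda>x. norm (indicator {\<alpha>..\<beta>} x * g x))" by (rule integrable_norm[OF int])
    qed (intro borel_measurable_times borel_measurable_integrable[OF int] borel_measurable_indicator, simp)
    moreover have "(LINT x|lebesgue. (indicator {\<alpha>..\<beta>} x * g x) * bump (real (Suc n)) a' b' x) = 0" for n
    proof -
      have "(LINT x|lebesgue. (indicator {\<alpha>..\<beta>} x * g x) * bump (real (Suc n)) a' b' x) =
          (LINT x|itv_measure. g x * bump (real (Suc n)) a' b' x)"
        unfolding integral_itv_eq set_lebesgue_integral_def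
      proof (rule Bochner_Integration.integral_cong)
        fix x
        show "indicator {\<alpha>..\<beta>} x * g x * bump (real (Suc n)) a' b' x =
          indicat_real itv x *\<^sub>R (g x * bump (real (Suc n)) a' b' x)"
        proof (cases "x \<in> {a'<..<b'}")
          case True
          then have "x \<in> {\<alpha>..\<beta>}" "x \<in> itv" using ab by (auto simp: a'_def b'_def)
          then show ?thesis by simp
        qed (simp add: bump_eq_0)
      qed simp
      also have "\<dots> = 0" by (intro z bump_test_function ab') auto
      finally show ?thesis .
    qed
    ultimately have "(LINT x|lebesgue. (indicator {\<alpha>..\<beta>} x * g x) * indicator {a'<..<b'} x) = 0"
      by (simp add: LIMSEQ_const_iff)
    also have "(LINT x|lebesgue. (indicator {\<alpha>..\<beta>} x * g x) * indicator {a'<..<b'} x) =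
        (LINT x:{a<..<b}|lebesgue. indicator {\<alpha>..\<beta>} x * g x)"
      unfolding set_lebesgue_integral_def
    proof (rule integral_cong_AE)
      have "AE x in lebesgue. x \<notin> {\<alpha>, \<beta>}"
        by (rule AE_not_in, rule null_sets_completionI) (simp add: finite_imp_null_set_lborel)
      then show "AE x in lebesgue. (indicator {\<alpha>..\<beta>} x * g x) * indicator {a'<..<b'} x =
          indicator {a<..<b} x *\<^sub>R (indicator {\<alpha>..\<beta>} x * g x)"
        by eventually_elim (auto simp: a'_def b'_def split: split_indicator)
    qed (auto intro!: borel_measurable_times borel_measurable_integrable[OF int] borel_measurable_scaleR
          borel_measurable_indicator)
    finally show "(LINT x:{a<..<b}|lebesgue. indicator {\<alpha>..\<beta>} x * g x) = 0" .
  qed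
  \<comment> \<open>Countably many compact intervals exhaust (0, pi), so the exceptional null sets
    can be united.\<close>
  have "AE x in lebesgue. \<forall>n::nat. indicator {1 / real (Suc n)..pi - 1 / real (Suc n)} x * g x = 0"
    unfolding AE_all_countable by (intro allI loc) auto
  then have "AE x in lebesgue. x \<in> itv \<longrightarrow> g x = 0"
  proof eventually_elim
    case (elim x)
    show ?case
    proof
      assume "x \<in> itv"
      then obtain n where "1 / real (Suc n) < min x (pi - x)"
        using nat_approx_posE[of "min x (pi - x)"] by auto
      then have "x \<in> {1 / real (Suc n)..pi - 1 / real (Suc n)}" by auto
      then show "g x = 0" using elim[rule_format, of n] by simp
    qed
  qed
  then show ?thesis by (simp add: AE_restrict_space_iff)
qed

lemma L1_loc_diff: "f \<in> L1_loc \<Longrightarrow> g \<in> L1_loc \<Longrightarrow> (\<lambda>x. f x - g x) \<in> L1_loc"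
  by (auto simp: L1_loc_def)

lemma L1_loc_times_test_integrable:
  assumes g: "g \<in> L1_loc" and phi: "\<phi> \<in> test_functions"
  shows "integrable itv_measure (\<lambda>x. g x * \<phi> x)"
proof -
  obtain a b where ab: "0 < a" "a < b" "b < pi" "\<And>x. x \<notin> {a..b} \<Longrightarrow> \<phi> x = 0"
    using test_function_support[OF phi] by blast
  have c: "continuous_on UNIV \<phi>" by (rule test_function_continuous[OF phi])
  have "bounded (\<phi> ` {a..b})"
    by (intro compact_imp_bounded compact_continuous_image test_function_continuous phi) auto
  then obtain B where B: "\<And>x. x \<in> {a..b} \<Longrightarrow> \<bar>\<phi> x\<bar> \<le> B"
    unfolding bounded_iff real_norm_def by blast
  then have "0 \<le> B" using ab by (meson abs_ge_zero atLeastAtMost_iff less_imp_le order_refl order_trans)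
  with B ab have B': "\<bar>\<phi> x\<bar> \<le> B" for x by (cases "x \<in> {a..b}") auto
  have g': "integrable lebesgue (\<lambda>x. indicator {a..b} x * g x)"
    using g ab by (auto simp: L1_loc_def set_integrable_def)
  have "integrable lebesgue (\<lambda>x. (indicator {a..b} x * g x) * \<phi> x)"
  proof (rule Bochner_Integration.integrable_bound)
    show "integrable lebesgue (\<lambda>x. (indicator {a..b} x * g x) * B)" using g' by simp
    show "(\<lambda>x. (indicator {a..b} x * g x) * \<phi> x) \<in> borel_measurable lebesgue"
      by (intro borel_measurable_times borel_measurable_integrable[OF g'] measurable_completion)
        (simp add: borel_measurable_continuous_onI c)
    show "AE x in lebesgue. norm ((indicator {a..b} x * g x) * \<phi> x) \<le> norm ((indicator {a..b} x * g x) * B)"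
      using B' \<open>0 \<le> B\<close> by (intro AE_I2) (auto simp: abs_mult intro!: mult_left_mono)
  qed
  moreover have "(\<lambda>x. (indicator {a..b} x * g x) * \<phi> x) = (\<lambda>x. indicator itv x *\<^sub>R (g x * \<phi> x))"
  proof
    fix x
    show "(indicator {a..b} x * g x) * \<phi> x = indicator itv x *\<^sub>R (g x * \<phi> x)"
      using ab by (cases "x \<in> {a..b}") auto
  qed
  ultimately show ?thesis by (simp add: integrable_itv_iff set_integrable_def)
qed

lemma has_weak_deriv_unique:
  assumes "has_weak_deriv u g" "has_weak_deriv u h"
  shows "AE x in itv_measure. g x = h x"
proof -
  have gh: "g \<in> L1_loc" "h \<in> L1_loc" using assms by (auto simp: has_weak_deriv_def)
  have "AE x in itv_measure. g x - h x = 0"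
  proof (rule AE_eq_0_if_orthogonal_test_functions)
    fix \<phi> assume phi: "\<phi> \<in> test_functions"
    have "(LINT x|itv_measure. (g x - h x) * \<phi> x) =
        (LINT x|itv_measure. g x * \<phi> x) - (LINT x|itv_measure. h x * \<phi> x)"
      using gh by (simp add: left_diff_distrib L1_loc_times_test_integrable[OF _ phi])
    also have "\<dots> = 0" using assms phi unfolding has_weak_deriv_def by fastforce
    finally show "(LINT x|itv_measure. (g x - h x) * \<phi> x) = 0" .
  qed (intro L1_loc_diff gh)
  then show ?thesis by auto
qed

lemma weak_deriv_eq: "has_weak_deriv u g \<Longrightarrow> AE x in itv_measure. weak_deriv u x = g x"
  using has_weak_deriv_unique[of u "weak_deriv u" g] someI[of "has_weak_deriv u" g]
  unfolding weak_deriv_def by blast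

lemma has_weak_deriv_weak_deriv: "weakly_differentiable u \<Longrightarrow> has_weak_deriv u (weak_deriv u)"
  unfolding weakly_differentiable_def weak_deriv_def by (erule someI_ex)

section \<open>Primitives of integrable functions and integration by parts\<close>

definition prim :: "(real \<Rightarrow> real) \<Rightarrow> real \<Rightarrow> real" where
  "prim g x = (LINT s|itv_measure. indicator {..x} s * g s)"

lemma integrable_indicator_times:
  assumes "integrable itv_measure g" "A \<in> sets borel"
  shows "integrable itv_measure (\<lambda>s. indicator A s * g s :: real)"
proof -
  have "A \<inter> itv \<in> sets itv_measure"
    using assms(2) by (auto simp: sets_restrict_space_iff intro!: sets.Int)
  from integrable_mult_indicator[OF this assms(1)] show ?thesis
    by (rule Bochner_Integration.integrable_cong[THEN iffD1, rotated 2]) (auto split: split_indicator)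
qed

lemma prim_eq_integral:
  assumes g: "integrable itv_measure g" and x: "0 \<le> x" "x \<le> pi"
  shows "(g has_integral prim g x) {0..x}"
proof -
  have "((\<lambda>s. indicator {..x} s * g s) has_integral prim g x) itv"
    unfolding prim_def by (rule has_integral_integral_lebesgue_on[OF integrable_indicator_times[OF g]]) auto
  then have "((\<lambda>s. if s \<in> itv then indicator {..x} s * g s else 0) has_integral prim g x) UNIV"
    by (simp only: has_integral_restrict_UNIV)
  then have "((\<lambda>s. if s \<in> {0..x} then g s else 0) has_integral prim g x) UNIV"
    by (rule has_integral_spike_finite[where S = "{0, pi}", rotated 2]) (use x in auto)
  then show ?thesis by (simp only: has_integral_restrict_UNIV)
qed

lemma prim_pi: "prim g pi = (LINT s|itv_measure. g s)"
  unfolding prim_def by (rule Bochner_Integration.integral_cong) auto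

lemma pair_sigma_finite_itv: "pair_sigma_finite itv_measure itv_measure"
  by (simp add: pair_sigma_finite_def itv.sigma_finite_measure_axioms)

lemma measurable_le_pred_itv: "Measurable.pred (itv_measure \<Otimes>\<^sub>M itv_measure) (\<lambda>(x, s). s \<le> x)"
proof -
  have [measurable]: "(\<lambda>x. x) \<in> itv_measure \<rightarrow>\<^sub>M borel"
    using id_borel_measurable_lebesgue_on[of itv] by (simp add: id_def)
  show ?thesis by measurable
qed

lemma prim_measurable [measurable]:
  assumes [measurable]: "g \<in> borel_measurable itv_measure"
  shows "prim g \<in> borel_measurable itv_measure"
proof -
  note measurable_le_pred_itv[measurable]
  have "(\<lambda>x. LINT s|itv_measure. (if s \<le> x then g s else 0)) \<in> borel_measurable itv_measure"
    by (rule itv.borel_measurable_lebesgue_integral) measurable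
  moreover have "(\<lambda>x. LINT s|itv_measure. (if s \<le> x then g s else 0)) = prim g"
    unfolding prim_def[abs_def]
    by (intro ext Bochner_Integration.integral_cong) (auto split: split_indicator)
  ultimately show ?thesis by simp
qed

lemma prim_bound: "integrable itv_measure g \<Longrightarrow> \<bar>prim g x\<bar> \<le> (LINT s|itv_measure. \<bar>g s\<bar>)"
  unfolding prim_def
  by (rule order_trans[OF integral_abs_bound], rule integral_mono)
    (auto intro!: integrable_indicator_times integrable_abs split: split_indicator)

lemma prim_times_integrable:
  assumes g: "integrable itv_measure g" and h: "integrable itv_measure h"
  shows "integrable itv_measure (\<lambda>x. prim g x * h x)"
proof (rule Bochner_Integration.integrable_bound)
  show "integrable itv_measure (\<lambda>x. (LINT s|itv_measure. \<bar>g s\<bar>) * h x)" using h by simp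
  have "0 \<le> (LINT s|itv_measure. \<bar>g s\<bar>)" by simp
  then show "AE x in itv_measure. norm (prim g x * h x) \<le> norm ((LINT s|itv_measure. \<bar>g s\<bar>) * h x)"
    using prim_bound[OF g] by (intro AE_I2) (auto simp: abs_mult intro!: mult_right_mono)
qed (use g h in \<open>auto intro!: borel_measurable_times prim_measurable borel_measurable_integrable\<close>)

text \<open>Integration by parts without differentiability: integrate g(s) h(x) over the triangle s
  <= x in both orders. The boundary term shows up as the product of the total integrals.\<close>

lemma integral_prim_parts:
  assumes g: "integrable itv_measure g" and h: "integrable itv_measure h"
  shows "(LINT x|itv_measure. prim g x * h x) + (LINT x|itv_measure. prim h x * g x) =
    (LINT x|itv_measure. g x) * (LINT x|itv_measure. h x)"
proof -
  interpret pair_sigma_finite itv_measure itv_measure by (rule pair_sigma_finite_itv)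
  note measurable_le_pred_itv[measurable]
  note [measurable] = borel_measurable_integrable[OF g] borel_measurable_integrable[OF h]
  define F where "F = (\<lambda>x s. (if s \<le> x then g s * h x else 0))"
  have F: "integrable (itv_measure \<Otimes>\<^sub>M itv_measure) (case_prod F)"
  proof (rule Fubini_integrable)
    show "case_prod F \<in> borel_measurable (itv_measure \<Otimes>\<^sub>M itv_measure)"
      unfolding F_def by measurable
    have "(LINT s|itv_measure. norm (case_prod F (x, s))) = prim (\<lambda>s. \<bar>g s\<bar>) x * \<bar>h x\<bar>" for x
    proof -
      have "(LINT s|itv_measure. norm (case_prod F (x, s))) =
          (LINT s|itv_measure. indicator {..x} s * \<bar>g s\<bar> * \<bar>h x\<bar>)"
        by (rule Bochner_Integration.integral_cong) (auto simp: F_def abs_mult split: split_indicator)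
      then show ?thesis by (simp add: prim_def)
    qed
    then show "integrable itv_measure (\<lambda>x. LINT s|itv_measure. norm (case_prod F (x, s)))"
      using prim_times_integrable[of "\<lambda>s. \<bar>g s\<bar>" "\<lambda>s. \<bar>h s\<bar>"] g h by simp
    have "integrable itv_measure (\<lambda>s. indicator {..x} s * g s * h x)" for x
      using integrable_indicator_times[OF g, of "{..x}"] by simp
    moreover have "(\<lambda>s. indicator {..x} s * g s * h x) = (\<lambda>s. case_prod F (x, s))" for x
      by (auto simp: F_def split: split_indicator)
    ultimately show "AE x in itv_measure. integrable itv_measure (\<lambda>s. case_prod F (x, s))" by simp
  qed
  have 1: "(LINT s|itv_measure. F x s) = prim g x * h x" for x
  proof -
    have "(LINT s|itv_measure. F x s) = (LINT s|itv_measure. indicator {..x} s * g s * h x)"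
      by (rule Bochner_Integration.integral_cong) (auto simp: F_def split: split_indicator)
    then show ?thesis by (simp add: prim_def)
  qed
  have 2: "(LINT x|itv_measure. F x s) = ((LINT x|itv_measure. h x) - prim h s) * g s" for s
  proof -
    \<comment> \<open>The triangle asks for x >= s, whereas removing {..s} leaves x > s; the two
      differ by a single point.\<close>
    have "(LINT x|itv_measure. F x s) = (LINT x|itv_measure. (h x - indicator {..s} x * h x) * g s)"
    proof (rule integral_cong_AE)
      have "AE x in lebesgue. x \<notin> {s}"
        by (rule AE_not_in, rule null_sets_completionI) (simp add: finite_imp_null_set_lborel)
      then show "AE x in itv_measure. F x s = (h x - indicator {..s} x * h x) * g s"
        by (simp add: AE_restrict_space_iff, elim eventually_mono)
          (auto simp: F_def split: split_indicator)
      have [measurable]: "(\<lambda>x. x) \<in> itv_measure \<rightarrow>\<^sub>M borel"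
        using id_borel_measurable_lebesgue_on[of itv] by (simp add: id_def)
      show "(\<lambda>x. F x s) \<in> borel_measurable itv_measure" unfolding F_def by measurable
      show "(\<lambda>x. (h x - indicator {..s} x * h x) * g s) \<in> borel_measurable itv_measure"
        using borel_measurable_integrable[OF integrable_indicator_times[OF h, of "{..s}"]]
        by simp
    qed
    then show ?thesis
      using h integrable_indicator_times[OF h, of "{..s}"] by (simp add: prim_def)
  qed
  have "(LINT s|itv_measure. (LINT x|itv_measure. F x s)) = (LINT x|itv_measure. (LINT s|itv_measure. F x s))"
    by (rule Fubini_integral[OF F])
  then have "(LINT s|itv_measure. ((LINT x|itv_measure. h x) - prim h s) * g s) =
      (LINT x|itv_measure. prim g x * h x)"
    by (simp only: 1 2)
  moreover have "(LINT s|itv_measure. ((LINT x|itv_measure. h x) - prim h s) * g s) =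
      (LINT x|itv_measure. h x) * (LINT s|itv_measure. g s) - (LINT s|itv_measure. prim h s * g s)"
    using g prim_times_integrable[OF h g] by (simp add: left_diff_distrib)
  ultimately show ?thesis by (simp add: mult.commute)
qed

section \<open>Weak derivatives and the operator\<close>

lemma not_AE_notin_Ioo:
  assumes "0 \<le> a" "a < b" "b \<le> pi"
  shows "\<not> (AE x in itv_measure. x \<notin> {a<..<b})"
proof
  assume "AE x in itv_measure. x \<notin> {a<..<b}"
  then have "AE x in lebesgue. x \<notin> {a<..<b}"
    using assms by (auto simp: AE_restrict_space_iff elim!: eventually_mono)
  then have "emeasure lebesgue {a<..<b} = 0"
    by (subst (asm) AE_iff_null_sets[symmetric]) (auto simp: null_sets_def)
  then show False using assms by simp
qed

text \<open>Local integrability gives measurability on compact subintervals only; \<open>g\<close>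
  is the pointwise limit of its truncations to an exhausting sequence of them.\<close>

lemma L1_loc_measurable:
  assumes "g \<in> L1_loc"
  shows "g \<in> borel_measurable itv_measure"
proof (rule borel_measurable_LIMSEQ_real)
  define A where "A n = {1 / real (Suc n)..pi - 1 / real (Suc n)}" for n
  show "(\<lambda>x. indicator (A n) x * g x) \<in> borel_measurable itv_measure" for n
  proof -
    have "set_integrable lebesgue (A n) g" using assms by (auto simp: L1_loc_def A_def)
    then have "(\<lambda>x. indicator (A n) x * g x) \<in> borel_measurable lebesgue"
      by (auto simp: set_integrable_def dest: borel_measurable_integrable)
    then show ?thesis by (rule measurable_restrict_space1)
  qed
  fix x assume "x \<in> space itv_measure"
  then have x: "0 < x" "x < pi" by auto
  then obtain N where N: "1 / real (Suc N) < min x (pi - x)"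
    using nat_approx_posE[of "min x (pi - x)"] by auto
  have "\<forall>\<^sub>F n in sequentially. g x = indicator (A n) x * g x"
    using eventually_ge_at_top[of N]
  proof eventually_elim
    case (elim n)
    then have "1 / real (Suc n) \<le> 1 / real (Suc N)" by (intro divide_left_mono) auto
    with N x have "x \<in> A n" by (auto simp: A_def)
    then show ?case by simp
  qed
  then show "(\<lambda>n. indicator (A n) x * g x) \<longlonglongrightarrow> g x"
    by (rule Lim_transform_eventually[OF tendsto_const])
qed

lemma has_weak_deriv_measurable:
  "has_weak_deriv u g \<Longrightarrow> u \<in> borel_measurable itv_measure"
  "has_weak_deriv u g \<Longrightarrow> g \<in> borel_measurable itv_measure"
  by (auto simp: has_weak_deriv_def L1_loc_measurable)

lemma test_function_integrable:
  assumes "\<phi> \<in> test_functions"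
  shows "integrable itv_measure \<phi>"
  using L1_loc_times_test_integrable[OF L1_loc_integrable[OF itv.integrable_const] assms, of 1] by simp

lemma test_function_has_integral:
  assumes phi: "\<phi> \<in> test_functions" and "0 \<le> x"
  shows "(deriv \<phi> has_integral \<phi> x) {0..x}"
proof -
  have "(deriv \<phi> has_integral \<phi> x - \<phi> 0) {0..x}"
    by (rule fundamental_theorem_of_calculus)
      (use assms test_function_DERIV[OF phi] in
        \<open>auto simp: has_real_derivative_iff_has_vector_derivative[symmetric] intro: DERIV_subset\<close>)
  then show ?thesis using test_function_eq_0[OF phi, of 0] by simp
qed

lemma prim_deriv_test_function:
  assumes phi: "\<phi> \<in> test_functions" and x: "0 \<le> x" "x \<le> pi"
  shows "prim (deriv \<phi>) x = \<phi> x"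
  using prim_eq_integral[OF test_function_integrable[OF deriv_test_function[OF phi]] x]
    test_function_has_integral[OF phi x(1)] by (rule has_integral_unique)

lemma integral_deriv_test_function: "\<phi> \<in> test_functions \<Longrightarrow> (LINT x|itv_measure. deriv \<phi> x) = 0"
  using prim_deriv_test_function[of \<phi> pi] test_function_eq_0[of \<phi> pi] by (simp add: prim_pi)

lemma integral_itv_test_function:
  assumes "\<phi> \<in> test_functions"
  shows "integral {0..pi} \<phi> = (LINT x|itv_measure. \<phi> x)"
  using prim_eq_integral[OF test_function_integrable[OF assms], of pi] by (simp add: prim_pi integral_unique)

lemma prim_integrable: "integrable itv_measure g \<Longrightarrow> integrable itv_measure (prim g)"
  using prim_times_integrable[of g "\<lambda>_. 1"] by simp

text \<open>Integration by parts against \<phi>'. Its primitive is \<phi> and its total integral is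
  zero, which removes both the boundary term and the constant \<open>c\<close>.\<close>

lemma has_weak_deriv_prim:
  assumes g: "integrable itv_measure g" and u: "\<And>x. x \<in> itv \<Longrightarrow> u x = c + prim g x"
  shows "has_weak_deriv u g"
  unfolding has_weak_deriv_def
proof (intro conjI ballI)
  have "integrable itv_measure (\<lambda>x. c + prim g x)" using prim_integrable[OF g] by simp
  then have "integrable itv_measure u"
    by (rule Bochner_Integration.integrable_cong[THEN iffD1, rotated 2]) (use u in auto)
  then show "u \<in> L1_loc" "g \<in> L1_loc" using g by (auto intro: L1_loc_integrable)
  fix \<phi> assume phi: "\<phi> \<in> test_functions"
  have d: "integrable itv_measure (deriv \<phi>)" by (intro test_function_integrable deriv_test_function phi)
  have "(LINT x|itv_measure. u x * deriv \<phi> x) = (LINT x|itv_measure. c * deriv \<phi> x + prim g x * deriv \<phi> x)"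
    by (rule Bochner_Integration.integral_cong) (use u in \<open>auto simp: algebra_simps\<close>)
  also have "\<dots> = (LINT x|itv_measure. prim g x * deriv \<phi> x)"
    using d prim_times_integrable[OF g d] integral_deriv_test_function[OF phi] by simp
  also have "\<dots> = - (LINT x|itv_measure. prim (deriv \<phi>) x * g x)"
    using integral_prim_parts[OF g d] integral_deriv_test_function[OF phi] by simp
  also have "(LINT x|itv_measure. prim (deriv \<phi>) x * g x) = (LINT x|itv_measure. g x * \<phi> x)"
    by (rule Bochner_Integration.integral_cong) (auto simp: prim_deriv_test_function[OF phi])
  finally show "(LINT x|itv_measure. u x * deriv \<phi> x) = - (LINT x|itv_measure. g x * \<phi> x)" .
qed

lemma has_weak_deriv_test_function:
  assumes "\<phi> \<in> test_functions"
  shows "has_weak_deriv \<phi> (deriv \<phi>)"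
  by (rule has_weak_deriv_prim[where c = 0])
    (auto simp: assms prim_deriv_test_function intro!: test_function_integrable[OF deriv_test_function[OF assms]])

lemma has_weak_deriv_diff:
  assumes "has_weak_deriv u g" "has_weak_deriv v h"
  shows "has_weak_deriv (\<lambda>x. u x - v x) (\<lambda>x. g x - h x)"
proof -
  have L: "u \<in> L1_loc" "g \<in> L1_loc" "v \<in> L1_loc" "h \<in> L1_loc"
    using assms by (auto simp: has_weak_deriv_def)
  show ?thesis
    unfolding has_weak_deriv_def
  proof (intro conjI ballI)
    fix \<phi> assume phi: "\<phi> \<in> test_functions"
    note i = L1_loc_times_test_integrable[OF _ phi] L1_loc_times_test_integrable[OF _ deriv_test_function[OF phi]]
    have "(LINT x|itv_measure. u x * deriv \<phi> x) = - (LINT x|itv_measure. g x * \<phi> x)"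
      "(LINT x|itv_measure. v x * deriv \<phi> x) = - (LINT x|itv_measure. h x * \<phi> x)"
      using assms phi by (auto simp: has_weak_deriv_def)
    then show "(LINT x|itv_measure. (u x - v x) * deriv \<phi> x) = - (LINT x|itv_measure. (g x - h x) * \<phi> x)"
      using i L by (simp add: left_diff_distrib)
  qed (use L L1_loc_diff in auto)
qed

text \<open>The difference of \<open>K\<close> and the primitive of \<open>H\<close> has weak
  derivative zero, so it is orthogonal to all derivatives of test functions, that is, to all test
  functions of mean zero. Hence it is constant.\<close>

lemma du_Bois_Reymond:
  assumes K: "integrable itv_measure K" and H: "integrable itv_measure H" and w: "has_weak_deriv K H"
  shows "\<exists>c. AE x in itv_measure. K x = c + prim H x"
proof -
  define D where "D = (\<lambda>x. K x - prim H x)"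
  have D: "integrable itv_measure D" using K prim_integrable[OF H] by (simp add: D_def)
  have "has_weak_deriv (\<lambda>x. K x - prim H x) (\<lambda>x. H x - H x)"
    by (rule has_weak_deriv_diff[OF w has_weak_deriv_prim[OF H, of _ 0]]) simp
  then have Dd: "(LINT x|itv_measure. D x * deriv \<phi> x) = 0" if "\<phi> \<in> test_functions" for \<phi>
    using that by (simp add: has_weak_deriv_def D_def)
  note DL = L1_loc_integrable[OF D]
  \<comment> \<open>A fixed test function of nonzero mean, with which every other test function is
    corrected to mean zero.\<close>
  define b where "b = bump 1 1 2"
  have b: "b \<in> test_functions" unfolding b_def using pi_gt3 by (intro bump_test_function) auto
  define I where "I = (LINT x|itv_measure. b x)"
  have "I \<noteq> 0"
  proof
    assume "I = 0"
    then have "AE x in itv_measure. b x = 0"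
      unfolding I_def using test_function_integrable[OF b]
      by (subst (asm) integral_nonneg_eq_0_iff_AE) (auto simp: b_def bump_nonneg)
    then have "AE x in itv_measure. x \<notin> {1<..<2}"
      by (elim eventually_mono) (use bump_pos[of 1 _ 1 2] in \<open>force simp: b_def\<close>)
    then show False using not_AE_notin_Ioo[of 1 2] pi_gt3 by auto
  qed
  \<comment> \<open>The only possible value of the constant, as testing D = d against
    \<open>b\<close> shows.\<close>
  define d where "d = (LINT x|itv_measure. D x * b x) / I"
  have "AE x in itv_measure. D x - d = 0"
  proof (rule AE_eq_0_if_orthogonal_test_functions)
    show "(\<lambda>x. D x - d) \<in> L1_loc"
      by (rule L1_loc_integrable) (use D in auto)
    fix \<psi> assume psi: "\<psi> \<in> test_functions"
    define c where "c = (LINT x|itv_measure. \<psi> x) / I"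
    define \<theta> where "\<theta> = (\<lambda>x. \<psi> x - c * b x)"
    have chi: "\<theta> \<in> test_functions" unfolding \<theta>_def by (rule test_functions_diff_scale[OF psi b])
    have "(LINT x|itv_measure. \<theta> x) = 0"
      using \<open>I \<noteq> 0\<close> test_function_integrable[OF psi] test_function_integrable[OF b]
      by (simp add: \<theta>_def c_def I_def)
    then have "integral {0..pi} \<theta> = 0" by (simp add: integral_itv_test_function[OF chi])
    from test_functions_primitive[OF chi this] Dd have "(LINT x|itv_measure. D x * \<theta> x) = 0" by metis
    then have "(LINT x|itv_measure. D x * \<psi> x) = c * (LINT x|itv_measure. D x * b x)"
      using L1_loc_times_test_integrable[OF DL psi] L1_loc_times_test_integrable[OF DL b]
      by (simp add: \<theta>_def right_diff_distrib mult.left_commute)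
    also have "\<dots> = d * (LINT x|itv_measure. \<psi> x)" by (simp add: c_def d_def)
    finally show "(LINT x|itv_measure. (D x - d) * \<psi> x) = 0"
      using L1_loc_times_test_integrable[OF DL psi] test_function_integrable[OF psi]
      by (simp add: left_diff_distrib)
  qed
  then have "AE x in itv_measure. K x = d + prim H x"
    by eventually_elim (simp add: D_def)
  then show ?thesis by blast
qed

section \<open>Square integrable and essentially bounded functions\<close>

lemma L2_times_integrable:
  assumes "f \<in> L2 M" "g \<in> L2 M"
  shows "integrable M (\<lambda>x. f x * g x)"
proof (rule Bochner_Integration.integrable_bound)
  show "integrable M (\<lambda>x. (f x)\<^sup>2 + (g x)\<^sup>2)" using assms by (auto simp: L2_def)
  have "\<bar>a * b\<bar> \<le> a\<^sup>2 + b\<^sup>2" for a b :: real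
  proof -
    have "2 * (\<bar>a\<bar> * \<bar>b\<bar>) \<le> a\<^sup>2 + b\<^sup>2"
      using sum_squares_bound[of "\<bar>a\<bar>" "\<bar>b\<bar>"] by (simp add: mult.assoc)
    moreover have "0 \<le> \<bar>a\<bar> * \<bar>b\<bar>" by simp
    ultimately show ?thesis unfolding abs_mult by linarith
  qed
  then show "AE x in M. norm (f x * g x) \<le> norm ((f x)\<^sup>2 + (g x)\<^sup>2)"
    by (intro AE_I2) (simp add: order_trans[OF _ abs_ge_self])
qed (use assms in \<open>auto simp: L2_def\<close>)

lemma L2_add: "f \<in> L2 M \<Longrightarrow> g \<in> L2 M \<Longrightarrow> (\<lambda>x. f x + g x) \<in> L2 M"
  using L2_times_integrable[of f M g] by (auto simp: L2_def power2_sum mult.assoc)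

lemma L2_scale: "f \<in> L2 M \<Longrightarrow> (\<lambda>x. c * f x) \<in> L2 M"
  by (auto simp: L2_def power_mult_distrib)

lemma L2_diff: "f \<in> L2 M \<Longrightarrow> g \<in> L2 M \<Longrightarrow> (\<lambda>x. f x - g x) \<in> L2 M"
  using L2_add[OF _ L2_scale[of g M "-1"], of f] by simp

lemma L_infty_times_L2:
  assumes "f \<in> L_infty M" "g \<in> L2 M"
  shows "(\<lambda>x. f x * g x) \<in> L2 M"
proof -
  obtain C where C: "AE x in M. \<bar>f x\<bar> \<le> C" using assms by (auto simp: L_infty_def)
  have "integrable M (\<lambda>x. (f x * g x)\<^sup>2)"
  proof (rule Bochner_Integration.integrable_bound)
    show "integrable M (\<lambda>x. C\<^sup>2 * (g x)\<^sup>2)" using assms by (auto simp: L2_def)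
    show "AE x in M. norm ((f x * g x)\<^sup>2) \<le> norm (C\<^sup>2 * (g x)\<^sup>2)"
      using C
    proof eventually_elim
      case (elim x)
      then have "(f x)\<^sup>2 \<le> C\<^sup>2" by (metis abs_ge_zero power2_abs power_mono)
      then show ?case by (auto simp: power_mult_distrib intro!: mult_right_mono)
    qed
  qed (use assms in \<open>auto simp: L2_def L_infty_def\<close>)
  then show ?thesis using assms by (auto simp: L2_def L_infty_def)
qed

lemma one_L2_itv: "(\<lambda>_. 1) \<in> L2 itv_measure"
  by (simp add: L2_def)

lemma L2_itv_integrable: "f \<in> L2 itv_measure \<Longrightarrow> integrable itv_measure f"
  using L2_times_integrable[OF _ one_L2_itv, of f] by simp

lemma L_infty_L2_itv: "f \<in> L_infty itv_measure \<Longrightarrow> f \<in> L2 itv_measure"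
  using L_infty_times_L2[OF _ one_L2_itv, of f] by simp

text \<open>The quadratic form s^2 a + 2 s t b + t^2 c, the integral of (s f + t g)^2, is
  nonnegative; its discriminant gives b^2 <= a c.\<close>

lemma Cauchy_Schwarz_L2:
  assumes "f \<in> L2 M" "g \<in> L2 M"
  shows "\<bar>LINT x|M. f x * g x\<bar> \<le> L2_norm M f * L2_norm M g"
proof -
  define a b c where "a = (LINT x|M. (f x)\<^sup>2)" and "b = (LINT x|M. f x * g x)" and "c = (LINT x|M. (g x)\<^sup>2)"
  have ac: "0 \<le> a" "0 \<le> c" by (simp_all add: a_def c_def)
  have q: "0 \<le> s\<^sup>2 * a + 2 * s * t * b + t\<^sup>2 * c" for s t
  proof -
    have "0 \<le> (LINT x|M. (s * f x + t * g x)\<^sup>2)" by simp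
    also have "(\<lambda>x. (s * f x + t * g x)\<^sup>2) = (\<lambda>x. s\<^sup>2 * (f x)\<^sup>2 + 2 * s * t * (f x * g x) + t\<^sup>2 * (g x)\<^sup>2)"
      by (auto simp: power2_eq_square algebra_simps)
    also have "(LINT x|M. s\<^sup>2 * (f x)\<^sup>2 + 2 * s * t * (f x * g x) + t\<^sup>2 * (g x)\<^sup>2) = s\<^sup>2 * a + 2 * s * t * b + t\<^sup>2 * c"
      using assms L2_times_integrable[OF assms] by (simp add: L2_def a_def b_def c_def)
    finally show ?thesis .
  qed
  have "b\<^sup>2 \<le> a * c"
  proof (cases "a = 0")
    case True
    have "b = 0"
    proof (rule ccontr)
      assume "b \<noteq> 0"
      \<comment> \<open>For a = 0 the form with t = 1 is affine in \<open>s\<close>; this choice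
        would give it the value -1.\<close>
      define s where "s = - (c + 1) / (2 * b)"
      have "2 * s * b = - (c + 1)" using \<open>b \<noteq> 0\<close> by (simp add: s_def)
      then show False using q[of s 1] True by simp
    qed
    then show ?thesis using True by simp
  next
    case False
    \<comment> \<open>The vector (b, - a) minimizes the form up to scaling and avoids a
      division.\<close>
    have "0 \<le> a * (a * c - b\<^sup>2)" using q[of b "- a"] by (simp add: power2_eq_square algebra_simps)
    then show ?thesis using False ac by (simp add: zero_le_mult_iff)
  qed
  from real_sqrt_le_mono[OF this] have "\<bar>b\<bar> \<le> sqrt (a * c)" by (simp only: real_sqrt_abs)
  then show ?thesis by (simp add: L2_norm_def a_def b_def c_def real_sqrt_mult)
qed

lemma integral_times_tendsto:
  assumes f: "\<And>n. f n \<in> L2 M" and u: "u \<in> L2 M" and g: "g \<in> L2 M"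
    and l: "(\<lambda>n. L2_norm M (\<lambda>x. f n x - u x)) \<longlonglongrightarrow> 0"
  shows "(\<lambda>n. LINT x|M. f n x * g x) \<longlonglongrightarrow> (LINT x|M. u x * g x)"
proof -
  have "(\<lambda>n. (LINT x|M. f n x * g x) - (LINT x|M. u x * g x)) \<longlonglongrightarrow> 0"
  proof (rule Lim_null_comparison)
    show "(\<lambda>n. L2_norm M (\<lambda>x. f n x - u x) * L2_norm M g) \<longlonglongrightarrow> 0"
      using tendsto_mult_left_zero[OF l] .
    have "(LINT x|M. f n x * g x) - (LINT x|M. u x * g x) = (LINT x|M. (f n x - u x) * g x)" for n
      using L2_times_integrable[OF f g] L2_times_integrable[OF u g] by (simp add: left_diff_distrib)
    then show "\<forall>\<^sub>F n in sequentially. norm ((LINT x|M. f n x * g x) - (LINT x|M. u x * g x))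
        \<le> L2_norm M (\<lambda>x. f n x - u x) * L2_norm M g"
      using Cauchy_Schwarz_L2[OF L2_diff[OF f u] g] by simp
  qed
  then show ?thesis by (simp only: LIM_zero_iff)
qed

lemma test_function_L2:
  assumes phi: "\<phi> \<in> test_functions"
  shows "\<phi> \<in> L2 itv_measure"
proof -
  have "\<phi> \<in> L1_loc" by (rule L1_loc_integrable[OF test_function_integrable[OF phi]])
  from L1_loc_times_test_integrable[OF this phi] test_function_integrable[OF phi] show ?thesis
    by (simp add: L2_def power2_eq_square)
qed

text \<open>Mean zero makes \<open>prim n\<close> vanish at both ends, so no boundary term arises.
  It will be applied to the coupling term, with \<open>prim n\<close> equal to p \<Phi>.\<close>

lemma H1_parts:
  assumes u: "u \<in> H1" and n: "n \<in> L_infty itv_measure" and n0: "(LINT x|itv_measure. n x) = 0"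
  shows "(LINT x|itv_measure. prim n x * weak_deriv u x) = - (LINT x|itv_measure. u x * n x)"
proof -
  have L: "u \<in> L2 itv_measure" "weak_deriv u \<in> L2 itv_measure" "weakly_differentiable u" "n \<in> L2 itv_measure"
    using u n L_infty_L2_itv by (auto simp: H1_def)
  note i = L2_itv_integrable[OF L(1)] L2_itv_integrable[OF L(2)] L2_itv_integrable[OF L(4)]
  obtain c where c: "AE x in itv_measure. u x = c + prim (weak_deriv u) x"
    using du_Bois_Reymond[OF i(1,2) has_weak_deriv_weak_deriv[OF L(3)]] by blast
  have "(LINT x|itv_measure. u x * n x) = (LINT x|itv_measure. c * n x + prim (weak_deriv u) x * n x)"
  proof (rule integral_cong_AE)
    show "AE x in itv_measure. u x * n x = c * n x + prim (weak_deriv u) x * n x"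
      using c by eventually_elim (simp add: algebra_simps)
  qed (use i in \<open>auto intro!: borel_measurable_times borel_measurable_add borel_measurable_integrable prim_integrable\<close>)
  also have "\<dots> = (LINT x|itv_measure. prim (weak_deriv u) x * n x)"
    using n0 i prim_times_integrable[OF i(2,3)] by simp
  finally show ?thesis using integral_prim_parts[OF i(3,2)] n0 by simp
qed

text \<open>Here \<open>W\<close> may be nonzero at the ends and the boundary condition sits on
  \<open>u\<close>. For test functions in place of \<open>u\<close> the identity is the definition
  of the weak derivative of \<open>W\<close>; it passes to the limit in the H1 norm.\<close>

lemma H10_parts:
  assumes u: "u \<in> H10" and k: "k \<in> L_infty itv_measure"
    and W: "W \<in> L2 itv_measure" "has_weak_deriv W k"
  shows "(LINT x|itv_measure. weak_deriv u x * W x) = - (LINT x|itv_measure. u x * k x)"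
proof -
  have L: "u \<in> L2 itv_measure" "weak_deriv u \<in> L2 itv_measure" "weakly_differentiable u"
    using u by (auto simp: H1_def H10_def)
  note wu = has_weak_deriv_weak_deriv[OF L(3)]
  obtain \<phi> where phi: "\<And>n. \<phi> n \<in> test_functions"
    and lim: "(\<lambda>n. H1_norm (\<lambda>x. \<phi> n x - u x)) \<longlonglongrightarrow> 0"
    using u by (auto simp: H10_def)
  note dphi = deriv_test_function[OF phi]
  have "(\<lambda>n. L2_norm itv_measure (\<lambda>x. \<phi> n x - u x)) \<longlonglongrightarrow> 0"
    by (rule Lim_null_comparison[OF _ lim]) (auto simp: H1_norm_def L2_norm_def)
  then have 1: "(\<lambda>n. LINT x|itv_measure. \<phi> n x * k x) \<longlonglongrightarrow> (LINT x|itv_measure. u x * k x)"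
    by (intro integral_times_tendsto test_function_L2 phi L L_infty_L2_itv k)
  \<comment> \<open>\<open>H1_norm\<close> contains an arbitrarily chosen weak derivative;
    uniqueness almost everywhere lets the difference of the concrete ones take its place.\<close>
  have "L2_norm itv_measure (weak_deriv (\<lambda>x. \<phi> n x - u x)) =
      L2_norm itv_measure (\<lambda>x. deriv (\<phi> n) x - weak_deriv u x)" for n
  proof -
    have w: "has_weak_deriv (\<lambda>x. \<phi> n x - u x) (\<lambda>x. deriv (\<phi> n) x - weak_deriv u x)"
      by (intro has_weak_deriv_diff has_weak_deriv_test_function phi wu)
    then have w': "has_weak_deriv (\<lambda>x. \<phi> n x - u x) (weak_deriv (\<lambda>x. \<phi> n x - u x))"
      by (intro has_weak_deriv_weak_deriv) (auto simp: weakly_differentiable_def)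
    have "(LINT x|itv_measure. (weak_deriv (\<lambda>x. \<phi> n x - u x) x)\<^sup>2) =
        (LINT x|itv_measure. (deriv (\<phi> n) x - weak_deriv u x)\<^sup>2)"
    proof (rule integral_cong_AE)
      show "AE x in itv_measure. (weak_deriv (\<lambda>x. \<phi> n x - u x) x)\<^sup>2 = (deriv (\<phi> n) x - weak_deriv u x)\<^sup>2"
        using weak_deriv_eq[OF w] by eventually_elim simp
    qed (use has_weak_deriv_measurable(2)[OF w] has_weak_deriv_measurable(2)[OF w'] in
        \<open>auto intro!: borel_measurable_power\<close>)
    then show ?thesis by (simp add: L2_norm_def)
  qed
  then have "(\<lambda>n. L2_norm itv_measure (\<lambda>x. deriv (\<phi> n) x - weak_deriv u x)) \<longlonglongrightarrow> 0"
    by (intro Lim_null_comparison[OF _ lim]) (auto simp: H1_norm_def L2_norm_def)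
  then have "(\<lambda>n. LINT x|itv_measure. deriv (\<phi> n) x * W x) \<longlonglongrightarrow> (LINT x|itv_measure. weak_deriv u x * W x)"
    by (intro integral_times_tendsto test_function_L2 dphi L W)
  moreover have "(LINT x|itv_measure. deriv (\<phi> n) x * W x) = - (LINT x|itv_measure. \<phi> n x * k x)" for n
    using W(2) phi[of n] by (simp add: has_weak_deriv_def mult.commute)
  ultimately have "(\<lambda>n. - (LINT x|itv_measure. \<phi> n x * k x)) \<longlonglongrightarrow> (LINT x|itv_measure. weak_deriv u x * W x)"
    by simp
  with tendsto_minus[OF 1] show ?thesis using LIMSEQ_unique by blast
qed

text \<open>Green's identity for bounded coefficients. Here f = prim g is a Dirichlet function, as
  \<open>g\<close> has mean zero, \<open>W\<close> is its flux \<gamma> f' and \<open>k\<close> the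
  derivative of that flux. One integration by parts moves the derivative from the flux of
  \<open>u\<close> to \<open>f\<close>, a second one moves it from \<open>u\<close> to the flux of
  \<open>f\<close>.\<close>

lemma Lop_symmetric:
  assumes \<gamma>: "\<gamma> \<in> L_infty itv_measure" and \<gamma>0: "\<gamma>0 \<in> L_infty itv_measure"
    and u: "u \<in> Lop_domain \<gamma> \<gamma>0"
    and g: "g \<in> L_infty itv_measure" "(LINT x|itv_measure. g x) = 0"
    and f: "\<And>x. x \<in> itv \<Longrightarrow> f x = prim g x"
    and W: "W \<in> L2 itv_measure" "has_weak_deriv W k" "AE x in itv_measure. \<gamma> x * g x = W x"
    and k: "k \<in> L_infty itv_measure"
  shows "(LINT x|itv_measure. Lop \<gamma> \<gamma>0 u x * f x) = (LINT x|itv_measure. u x * (\<gamma>0 x * f x - k x))"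
proof -
  define G where "G = weak_deriv u"
  define K where "K = (\<lambda>z. \<gamma> z * G z)"
  define H where "H = weak_deriv K"
  have u10: "u \<in> H10" and L: "u \<in> L2 itv_measure" "G \<in> L2 itv_measure" "Lop \<gamma> \<gamma>0 u \<in> L2 itv_measure"
    and wK: "has_weak_deriv K H"
    using u by (auto simp: Lop_domain_def H10_def H1_def G_def K_def H_def intro: has_weak_deriv_weak_deriv)
  have Heq: "H = (\<lambda>x. \<gamma>0 x * u x - Lop \<gamma> \<gamma>0 u x)"
    by (simp add: Lop_def H_def K_def G_def)
  have \<gamma>u: "(\<lambda>x. \<gamma>0 x * u x) \<in> L2 itv_measure" by (rule L_infty_times_L2[OF \<gamma>0 L(1)])
  have HL: "H \<in> L2 itv_measure" unfolding Heq by (intro L2_diff L \<gamma>u)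
  have KL: "K \<in> L2 itv_measure" unfolding K_def by (rule L_infty_times_L2[OF \<gamma> L(2)])
  note gL = L_infty_L2_itv[OF g(1)] and kL = L_infty_L2_itv[OF k]
  note i = L2_itv_integrable[OF HL] L2_itv_integrable[OF KL] L2_itv_integrable[OF gL]
  obtain c where c: "AE x in itv_measure. K x = c + prim H x"
    using du_Bois_Reymond[OF i(2,1) wK] by blast
  have fH: "(LINT x|itv_measure. prim g x * H x) = (LINT x|itv_measure. u x * k x)"
  proof -
    have "(LINT x|itv_measure. prim g x * H x) = - (LINT x|itv_measure. prim H x * g x)"
      using integral_prim_parts[OF i(3,1)] g(2) by simp
    \<comment> \<open>Since \<open>g\<close> has mean zero, the constant \<open>c\<close> may be
      inserted; it completes the primitive of \<open>H\<close> to the flux \<open>K\<close>.\<close>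
    also have "(LINT x|itv_measure. prim H x * g x) = (LINT x|itv_measure. c * g x + prim H x * g x)"
      using g(2) i prim_times_integrable[OF i(1,3)] by simp
    also have "\<dots> = (LINT x|itv_measure. G x * W x)"
    proof (rule integral_cong_AE)
      show "AE x in itv_measure. c * g x + prim H x * g x = G x * W x"
        using c W(3)
      proof eventually_elim
        case (elim x)
        \<comment> \<open>The coefficient passes from u' to f': (\<gamma> u') f' = u' (\<gamma>
          f').\<close>
        have "G x * W x = K x * g x" unfolding K_def elim(2)[symmetric] by (simp only: ac_simps)
        then show ?case unfolding elim(1) by (simp only: distrib_right)
      qed
    qed (use i L2_times_integrable[OF L(2) W(1)] in \<open>auto intro!: borel_measurable_times borel_measurable_add
        borel_measurable_integrable prim_integrable\<close>)
    also have "\<dots> = - (LINT x|itv_measure. u x * k x)"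
      unfolding G_def by (rule H10_parts[OF u10 k W(1,2)])
    finally show ?thesis by simp
  qed
  have pgL: "prim g \<in> L_infty itv_measure"
    using prim_bound[OF i(3)] prim_measurable[OF borel_measurable_integrable[OF i(3)]]
    by (auto simp: L_infty_def)
  have "(LINT x|itv_measure. Lop \<gamma> \<gamma>0 u x * f x) =
      (LINT x|itv_measure. (\<gamma>0 x * u x) * prim g x - prim g x * H x)"
    by (rule Bochner_Integration.integral_cong) (auto simp: f Heq algebra_simps)
  also have "\<dots> = (LINT x|itv_measure. (\<gamma>0 x * u x) * prim g x) - (LINT x|itv_measure. u x * k x)"
    using L2_times_integrable[OF \<gamma>u L_infty_L2_itv[OF pgL]] L2_times_integrable[OF L_infty_L2_itv[OF pgL] HL]
    by (simp add: fH)
  also have "\<dots> = (LINT x|itv_measure. (\<gamma>0 x * u x) * prim g x - u x * k x)"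
    using L2_times_integrable[OF \<gamma>u L_infty_L2_itv[OF pgL]] L2_times_integrable[OF L(1) kL] by simp
  also have "\<dots> = (LINT x|itv_measure. u x * (\<gamma>0 x * f x - k x))"
    by (rule Bochner_Integration.integral_cong) (auto simp: f algebra_simps)
  finally show ?thesis .
qed

section \<open>Primitives of bounded functions\<close>

text \<open>A Lipschitz function \<open>f\<close> with a fixed representative \<open>g\<close> of
  its derivative, bounded at every point of the interval. Stating this through increments keeps
  explicit formulas for derivatives and avoids pointwise differentiation.\<close>

definition lip_prim :: "real \<Rightarrow> real \<Rightarrow> (real \<Rightarrow> real) \<Rightarrow> (real \<Rightarrow> real) \<Rightarrow> bool" where
  "lip_prim a b f g \<longleftrightarrow> g \<in> borel_measurable (lebesgue_on {a..b}) \<and>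
     (\<exists>B. \<forall>x\<in>{a..b}. \<bar>g x\<bar> \<le> B) \<and>
     (\<forall>x\<in>{a..b}. \<forall>y\<in>{x..b}. (g has_integral f y - f x) {x..y})"

lemma bounded_measurable_integrable:
  fixes g :: "real \<Rightarrow> real"
  assumes "g \<in> borel_measurable (lebesgue_on {a..b})" "\<And>x. x \<in> {a..b} \<Longrightarrow> \<bar>g x\<bar> \<le> B"
    and "a \<le> x" "y \<le> b"
  shows "g integrable_on {x..y}"
proof (rule measurable_bounded_by_integrable_imp_integrable)
  show "g \<in> borel_measurable (lebesgue_on {x..y})"
    by (rule measurable_restrict_mono[OF assms(1)]) (use assms(3,4) in auto)
  show "(\<lambda>_. B) integrable_on {x..y}" by (intro integrable_continuous_real continuous_intros)
  show "norm (g s) \<le> B" if "s \<in> {x..y}" for s using assms(2)[of s] assms(3,4) that by auto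
qed auto

text \<open>This bound and its two companions take the place of the mean value theorem in the
  arguments on sign and growth of solutions.\<close>

lemma lip_prim_lower:
  assumes "lip_prim a b f g" "a \<le> x" "x \<le> y" "y \<le> b" "\<And>s. s \<in> {x..y} \<Longrightarrow> c \<le> g s"
  shows "c * (y - x) \<le> f y - f x"
proof (rule has_integral_le)
  show "((\<lambda>_. c) has_integral c * (y - x)) {x..y}"
    using has_integral_const_real[of c x y] assms by (simp add: mult.commute)
  show "(g has_integral f y - f x) {x..y}" using assms by (auto simp: lip_prim_def)
qed (use assms in auto)

lemma lip_prim_upper:
  assumes "lip_prim a b f g" "a \<le> x" "x \<le> y" "y \<le> b" "\<And>s. s \<in> {x..y} \<Longrightarrow> g s \<le> c"
  shows "f y - f x \<le> c * (y - x)"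
proof (rule has_integral_le)
  show "((\<lambda>_. c) has_integral c * (y - x)) {x..y}"
    using has_integral_const_real[of c x y] assms by (simp add: mult.commute)
  show "(g has_integral f y - f x) {x..y}" using assms by (auto simp: lip_prim_def)
qed (use assms in auto)

lemma lip_prim_abs_le:
  assumes "lip_prim a b f g" "a \<le> x" "x \<le> y" "y \<le> b" "\<And>s. s \<in> {x..y} \<Longrightarrow> \<bar>g s\<bar> \<le> c"
  shows "\<bar>f y - f x\<bar> \<le> c * (y - x)"
proof -
  have "- c \<le> g s" "g s \<le> c" if "s \<in> {x..y}" for s using assms(5)[OF that] by auto
  then show ?thesis
    using lip_prim_lower[OF assms(1-4), of "- c"] lip_prim_upper[OF assms(1-4), of c]
    by (simp add: abs_le_iff)
qed

lemma lip_prim_bound: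
  assumes "lip_prim a b f g"
  obtains B where "0 \<le> B" "\<And>x. x \<in> {a..b} \<Longrightarrow> \<bar>g x\<bar> \<le> B"
    "\<And>x y. x \<in> {a..b} \<Longrightarrow> y \<in> {a..b} \<Longrightarrow> \<bar>f y - f x\<bar> \<le> B * \<bar>y - x\<bar>"
proof -
  obtain B0 where B0: "\<And>x. x \<in> {a..b} \<Longrightarrow> \<bar>g x\<bar> \<le> B0" using assms unfolding lip_prim_def by blast
  define B where "B = max B0 0"
  have B: "0 \<le> B" "\<bar>g x\<bar> \<le> B" if "x \<in> {a..b}" for x using B0[OF that] by (auto simp: B_def)
  have l: "\<bar>f y - f x\<bar> \<le> B * \<bar>y - x\<bar>" if "x \<le> y" "x \<in> {a..b}" "y \<in> {a..b}" for x y
    using lip_prim_abs_le[OF assms, of x y B] that B by auto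
  show ?thesis
  proof (rule that)
    show "0 \<le> B" by (simp add: B_def)
    show "\<bar>f y - f x\<bar> \<le> B * \<bar>y - x\<bar>" if "x \<in> {a..b}" "y \<in> {a..b}" for x y
      using l[of x y] l[of y x] that by (cases "x \<le> y") (auto simp: abs_minus_commute)
  qed (use B in auto)
qed

lemma lip_prim_continuous:
  assumes "lip_prim a b f g"
  shows "continuous_on {a..b} f"
proof -
  obtain B where B: "0 \<le> B" "\<And>x y. x \<in> {a..b} \<Longrightarrow> y \<in> {a..b} \<Longrightarrow> \<bar>f y - f x\<bar> \<le> B * \<bar>y - x\<bar>"
    using lip_prim_bound[OF assms] by metis
  have "B-lipschitz_on {a..b} f"
    by (rule lipschitz_onI) (use B in \<open>auto simp: dist_real_def\<close>)
  then show ?thesis by (rule lipschitz_on_continuous_on)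
qed

lemma continuous_measurable_Icc: "continuous_on {a..b} f \<Longrightarrow> f \<in> borel_measurable (lebesgue_on {a..b::real})"
  for f :: "real \<Rightarrow> real"
  by (rule continuous_imp_measurable_on_sets_lebesgue) auto

lemma continuous_bounded_Icc:
  fixes f :: "real \<Rightarrow> real"
  assumes "continuous_on {a..b} f"
  obtains B where "0 \<le> B" "\<And>x. x \<in> {a..b} \<Longrightarrow> \<bar>f x\<bar> \<le> B"
proof -
  have "bounded (f ` {a..b})" by (intro compact_imp_bounded compact_continuous_image assms) auto
  then obtain B where "\<forall>x\<in>{a..b}. \<bar>f x\<bar> \<le> B" unfolding bounded_iff by auto
  then show ?thesis by (intro that[of "max B 0"]) (auto simp: le_max_iff_disj)
qed

lemma lip_primI:
  assumes g: "g \<in> borel_measurable (lebesgue_on {a..b})" "\<And>x. x \<in> {a..b} \<Longrightarrow> \<bar>g x\<bar> \<le> B"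
    and f: "\<And>x. x \<in> {a..b} \<Longrightarrow> f x = c + integral {a..x} g"
  shows "lip_prim a b f g"
  unfolding lip_prim_def
proof (intro conjI ballI)
  note i = bounded_measurable_integrable[OF g]
  fix x y assume xy: "x \<in> {a..b}" "y \<in> {x..b}"
  have "integral {a..x} g + integral {x..y} g = integral {a..y} g"
    by (rule Henstock_Kurzweil_Integration.integral_combine) (use xy i in auto)
  then have "f y - f x = integral {x..y} g" using f[of x] f[of y] xy by auto
  then show "(g has_integral f y - f x) {x..y}" using i[of x y] xy by (auto simp: has_integral_iff)
next
  show "\<exists>B. \<forall>x\<in>{a..b}. \<bar>g x\<bar> \<le> B" using g(2) by blast
qed (rule g(1))

text \<open>A function that increases like the primitive of \<open>h\<close> up to a quadratic error is a primitive
  of \<open>h\<close>, as the difference has derivative zero. This yields the product and quotient rules without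
  Lebesgue's differentiation theorem.\<close>

lemma lip_primI_quadratic:
  assumes h: "h \<in> borel_measurable (lebesgue_on {a..b})" "\<And>x. x \<in> {a..b} \<Longrightarrow> \<bar>h x\<bar> \<le> B"
    and q: "\<And>x y. a \<le> x \<Longrightarrow> x \<le> y \<Longrightarrow> y \<le> b \<Longrightarrow> \<bar>F y - F x - integral {x..y} h\<bar> \<le> C * (y - x)\<^sup>2"
  shows "lip_prim a b F h"
proof (rule lip_primI[OF h])
  define E where "E x = F x - integral {a..x} h" for x
  note i = bounded_measurable_integrable[OF h]
  have q1: "\<bar>E y - E x\<bar> \<le> \<bar>C\<bar> * (y - x)\<^sup>2" if "x \<le> y" "a \<le> x" "y \<le> b" for x y
  proof -
    have "integral {a..x} h + integral {x..y} h = integral {a..y} h"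
      by (rule Henstock_Kurzweil_Integration.integral_combine) (use that i in auto)
    then have "\<bar>E y - E x\<bar> \<le> C * (y - x)\<^sup>2" using q[of x y] that by (auto simp: E_def)
    also have "\<dots> \<le> \<bar>C\<bar> * (y - x)\<^sup>2" by (intro mult_right_mono) auto
    finally show ?thesis .
  qed
  have q2: "\<bar>E y - E x\<bar> \<le> \<bar>C\<bar> * (y - x)\<^sup>2" if "x \<in> {a..b}" "y \<in> {a..b}" for x y
    using q1[of x y] q1[of y x] that by (cases "x \<le> y") (auto simp: abs_minus_commute power2_commute)
  have D: "(E has_real_derivative 0) (at x within {a..b})" if x: "x \<in> {a..b}" for x
    unfolding has_field_derivative_iff
  proof (rule Lim_null_comparison)
    show "\<forall>\<^sub>F y in at x within {a..b}. norm ((E y - E x) / (y - x)) \<le> \<bar>C\<bar> * \<bar>y - x\<bar>"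
      unfolding eventually_at_filter
    proof (intro always_eventually allI impI)
      fix y assume "y \<noteq> x" "y \<in> {a..b}"
      moreover have "(y - x)\<^sup>2 = \<bar>y - x\<bar> * \<bar>y - x\<bar>" by (simp add: power2_eq_square)
      ultimately show "norm ((E y - E x) / (y - x)) \<le> \<bar>C\<bar> * \<bar>y - x\<bar>"
        using q2[OF x, of y] by (simp add: divide_le_eq abs_divide mult.assoc)
    qed
    have "((\<lambda>y. \<bar>C\<bar> * \<bar>y - x\<bar>) \<longlongrightarrow> \<bar>C\<bar> * \<bar>x - x\<bar>) (at x within {a..b})"
      by (intro tendsto_intros)
    then show "((\<lambda>y. \<bar>C\<bar> * \<bar>y - x\<bar>) \<longlongrightarrow> 0) (at x within {a..b})" by simp
  qed
  have "\<exists>c. \<forall>x\<in>{a..b}. E x = c"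
    by (rule has_field_derivative_zero_constant) (use D in auto)
  then obtain c where c: "\<And>x. x \<in> {a..b} \<Longrightarrow> E x = c" by blast
  show "F x = E a + integral {a..x} h" if "x \<in> {a..b}" for x
  proof -
    have "E x = E a" using c[OF that] c[of a] that by simp
    then show ?thesis unfolding E_def[of x] by linarith
  qed
qed

lemma integral_abs_le:
  assumes "g \<in> borel_measurable (lebesgue_on {a..b})" "a \<le> x" "x \<le> y" "y \<le> b"
    and "\<And>s. s \<in> {a..b} \<Longrightarrow> \<bar>g s\<bar> \<le> B" "\<And>s. s \<in> {x..y} \<Longrightarrow> \<bar>g s\<bar> \<le> (c::real)"
  shows "\<bar>integral {x..y} g\<bar> \<le> c * (y - x)"
proof -
  have l: "lip_prim a b (\<lambda>x. 0 + integral {a..x} g) g" by (rule lip_primI[OF assms(1)]) (use assms in auto)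
  have "integral {a..x} g + integral {x..y} g = integral {a..y} g"
    by (rule Henstock_Kurzweil_Integration.integral_combine)
      (use assms bounded_measurable_integrable[OF assms(1,5)] in auto)
  then show ?thesis using lip_prim_abs_le[OF l, of x y c] assms by auto
qed

text \<open>Freezing f1 at \<open>y\<close> and f2 at \<open>x\<close> gives the integrand f1(y) g2
  + f2(x) g1, whose integral over [x, y] is exactly the increment of the product. By Lipschitz
  continuity it differs from the true integrand by O(y - x), hence the integrals by O((y -
  x)^2).\<close>

lemma lip_prim_mult:
  assumes 1: "lip_prim a b f1 g1" and 2: "lip_prim a b f2 g2"
  shows "lip_prim a b (\<lambda>x. f1 x * f2 x) (\<lambda>x. f1 x * g2 x + g1 x * f2 x)"
proof -
  note c1 = lip_prim_continuous[OF 1] and c2 = lip_prim_continuous[OF 2]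
  note m = continuous_measurable_Icc[OF c1] continuous_measurable_Icc[OF c2]
  have mg: "g1 \<in> borel_measurable (lebesgue_on {a..b})" "g2 \<in> borel_measurable (lebesgue_on {a..b})"
    using 1 2 by (auto simp: lip_prim_def)
  obtain B1 where B1: "0 \<le> B1" "\<And>x. x \<in> {a..b} \<Longrightarrow> \<bar>g1 x\<bar> \<le> B1"
    "\<And>x y. x \<in> {a..b} \<Longrightarrow> y \<in> {a..b} \<Longrightarrow> \<bar>f1 y - f1 x\<bar> \<le> B1 * \<bar>y - x\<bar>"
    using lip_prim_bound[OF 1] by metis
  obtain B2 where B2: "0 \<le> B2" "\<And>x. x \<in> {a..b} \<Longrightarrow> \<bar>g2 x\<bar> \<le> B2"
    "\<And>x y. x \<in> {a..b} \<Longrightarrow> y \<in> {a..b} \<Longrightarrow> \<bar>f2 y - f2 x\<bar> \<le> B2 * \<bar>y - x\<bar>"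
    using lip_prim_bound[OF 2] by metis
  obtain M1 where M1: "0 \<le> M1" "\<And>x. x \<in> {a..b} \<Longrightarrow> \<bar>f1 x\<bar> \<le> M1" using continuous_bounded_Icc[OF c1] by metis
  obtain M2 where M2: "0 \<le> M2" "\<And>x. x \<in> {a..b} \<Longrightarrow> \<bar>f2 x\<bar> \<le> M2" using continuous_bounded_Icc[OF c2] by metis
  let ?h = "\<lambda>x. f1 x * g2 x + g1 x * f2 x"
  have hm: "?h \<in> borel_measurable (lebesgue_on {a..b})" using m mg by measurable
  have hb: "\<bar>?h x\<bar> \<le> M1 * B2 + B1 * M2" if "x \<in> {a..b}" for x
    by (rule order_trans[OF abs_triangle_ineq], rule add_mono)
      (use that B1 B2 M1 M2 in \<open>auto simp: abs_mult intro!: mult_mono\<close>)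
  show ?thesis
  proof (rule lip_primI_quadratic[OF hm hb])
    fix x y assume xy: "a \<le> x" "x \<le> y" "y \<le> b"
    let ?e = "\<lambda>s. f1 y * g2 s + f2 x * g1 s"
    have e: "(?e has_integral f1 y * (f2 y - f2 x) + f2 x * (f1 y - f1 x)) {x..y}"
      by (intro has_integral_add has_integral_mult_right) (use 1 2 xy in \<open>auto simp: lip_prim_def\<close>)
    have h: "(?h has_integral integral {x..y} ?h) {x..y}"
      by (rule integrable_integral, rule bounded_measurable_integrable[OF hm hb]) (use xy in auto)
    have d: "((\<lambda>s. ?e s - ?h s) has_integral (f1 y * f2 y - f1 x * f2 x) - integral {x..y} ?h) {x..y}"
      using has_integral_diff[OF e h] by (simp add: algebra_simps)
    have "\<bar>integral {x..y} (\<lambda>s. ?e s - ?h s)\<bar> \<le> (2 * B1 * B2 * (y - x)) * (y - x)"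
    proof (rule integral_abs_le)
      show "(\<lambda>s. ?e s - ?h s) \<in> borel_measurable (lebesgue_on {a..b})" using m mg by measurable
      show "\<bar>?e s - ?h s\<bar> \<le> (M1 * B2 + M2 * B1) + (M1 * B2 + B1 * M2)" if "s \<in> {a..b}" for s
      proof -
        have "\<bar>?e s\<bar> \<le> M1 * B2 + M2 * B1"
          by (rule order_trans[OF abs_triangle_ineq], rule add_mono)
            (use that xy B1 B2 M1 M2 in \<open>auto simp: abs_mult intro!: mult_mono\<close>)
        then show ?thesis using hb[OF that] by linarith
      qed
      show "\<bar>?e s - ?h s\<bar> \<le> 2 * B1 * B2 * (y - x)" if s: "s \<in> {x..y}" for s
      proof -
        have sab: "s \<in> {a..b}" "x \<in> {a..b}" "y \<in> {a..b}" using s xy by auto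
        have "\<bar>f1 y - f1 s\<bar> \<le> B1 * (y - x)" "\<bar>f2 x - f2 s\<bar> \<le> B2 * (y - x)"
          by (rule order_trans[OF B1(3)], insert s sab B1(1), auto intro!: mult_left_mono)
            (rule order_trans[OF B2(3)], insert s sab B2(1), auto intro!: mult_left_mono)
        then have "\<bar>(f1 y - f1 s) * g2 s\<bar> \<le> (B1 * (y - x)) * B2"
          "\<bar>(f2 x - f2 s) * g1 s\<bar> \<le> (B2 * (y - x)) * B1"
          unfolding abs_mult using sab xy B1(1,2) B2(1,2) by (intro mult_mono; simp)+
        moreover have "?e s - ?h s = (f1 y - f1 s) * g2 s + (f2 x - f2 s) * g1 s" by (simp add: algebra_simps)
        ultimately show ?thesis by (simp add: algebra_simps abs_le_iff)
      qed
    qed (use xy in auto)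
    then show "\<bar>f1 y * f2 y - f1 x * f2 x - integral {x..y} ?h\<bar> \<le> (2 * B1 * B2) * (y - x)\<^sup>2"
      using integral_unique[OF d] by (simp add: power2_eq_square mult.assoc)
  qed
qed

lemma lip_prim_add:
  assumes "lip_prim a b f1 g1" "lip_prim a b f2 g2"
  shows "lip_prim a b (\<lambda>x. f1 x + f2 x) (\<lambda>x. g1 x + g2 x)"
  unfolding lip_prim_def
proof (intro conjI ballI)
  obtain B1 B2 where "\<And>x. x \<in> {a..b} \<Longrightarrow> \<bar>g1 x\<bar> \<le> B1" "\<And>x. x \<in> {a..b} \<Longrightarrow> \<bar>g2 x\<bar> \<le> B2"
    using assms unfolding lip_prim_def by blast
  then have "\<forall>x\<in>{a..b}. \<bar>g1 x + g2 x\<bar> \<le> B1 + B2" by (fastforce intro: order_trans[OF abs_triangle_ineq])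
  then show "\<exists>B. \<forall>x\<in>{a..b}. \<bar>g1 x + g2 x\<bar> \<le> B" by blast
  fix x y assume "x \<in> {a..b}" "y \<in> {x..b}"
  then have "(g1 has_integral f1 y - f1 x) {x..y}" "(g2 has_integral f2 y - f2 x) {x..y}"
    using assms by (auto simp: lip_prim_def)
  from has_integral_add[OF this]
  show "((\<lambda>x. g1 x + g2 x) has_integral (f1 y + f2 y) - (f1 x + f2 x)) {x..y}"
    by (simp add: algebra_simps)
qed (use assms in \<open>auto simp: lip_prim_def\<close>)

lemma lip_prim_const: "lip_prim a b (\<lambda>_. c) (\<lambda>_. 0)"
  by (auto simp: lip_prim_def)

lemma lip_prim_cmult: "lip_prim a b f g \<Longrightarrow> lip_prim a b (\<lambda>x. c * f x) (\<lambda>x. c * g x)"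
  using lip_prim_mult[OF lip_prim_const[of a b c], of f g] by simp

lemma lip_prim_minus: "lip_prim a b f g \<Longrightarrow> lip_prim a b (\<lambda>x. - f x) (\<lambda>x. - g x)"
  using lip_prim_cmult[of a b f g "-1"] by simp

lemma lip_prim_C1:
  assumes d: "\<And>x. (f has_field_derivative g x) (at x)" and c: "continuous_on {a..b} g"
  shows "lip_prim a b f g"
  unfolding lip_prim_def
proof (intro conjI ballI)
  show "g \<in> borel_measurable (lebesgue_on {a..b})" by (rule continuous_measurable_Icc[OF c])
  show "\<exists>B. \<forall>x\<in>{a..b}. \<bar>g x\<bar> \<le> B" using continuous_bounded_Icc[OF c] by metis
  fix x y assume "x \<in> {a..b}" "y \<in> {x..b}"
  then show "(g has_integral f y - f x) {x..y}"
    by (intro fundamental_theorem_of_calculus)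
      (use d in \<open>auto simp: has_real_derivative_iff_has_vector_derivative[symmetric] intro: DERIV_subset\<close>)
qed

text \<open>The factor k = - 1/f(x)^2 is frozen. The quadratic error has two parts: replacing the
  integrand by k g, and the remainder of the first-order expansion of 1/f. The lower bound
  \<open>c\<close> controls both.\<close>

lemma lip_prim_inverse:
  assumes 1: "lip_prim a b f g" and c: "0 < c" "\<And>x. x \<in> {a..b} \<Longrightarrow> c \<le> f x"
  shows "lip_prim a b (\<lambda>x. 1 / f x) (\<lambda>x. - g x / (f x)\<^sup>2)"
proof -
  note c1 = lip_prim_continuous[OF 1]
  note m = continuous_measurable_Icc[OF c1]
  have mg: "g \<in> borel_measurable (lebesgue_on {a..b})" using 1 by (auto simp: lip_prim_def)
  obtain B where B: "0 \<le> B" "\<And>x. x \<in> {a..b} \<Longrightarrow> \<bar>g x\<bar> \<le> B"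
    "\<And>x y. x \<in> {a..b} \<Longrightarrow> y \<in> {a..b} \<Longrightarrow> \<bar>f y - f x\<bar> \<le> B * \<bar>y - x\<bar>"
    using lip_prim_bound[OF 1] by metis
  let ?h = "\<lambda>x. - g x / (f x)\<^sup>2"
  have hm: "?h \<in> borel_measurable (lebesgue_on {a..b})" using m mg by measurable
  have fp: "0 < f x" if "x \<in> {a..b}" for x using c that by force
  have f2: "c\<^sup>2 \<le> (f x)\<^sup>2" if "x \<in> {a..b}" for x using c that by (simp add: power_mono)
  have inv2: "1 / (f x)\<^sup>2 \<le> 1 / c\<^sup>2" if "x \<in> {a..b}" for x using f2[OF that] c(1) fp[OF that] by (intro divide_left_mono mult_pos_pos zero_less_power) auto
  have inv1: "1 / f x \<le> 1 / c" if "x \<in> {a..b}" for x using c that fp[OF that] by (intro divide_left_mono) (auto simp: mult_pos_pos)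
  have hb: "\<bar>?h x\<bar> \<le> B * (1 / c\<^sup>2)" if "x \<in> {a..b}" for x
  proof -
    have "\<bar>?h x\<bar> = \<bar>g x\<bar> * (1 / (f x)\<^sup>2)" by (simp add: abs_divide)
    also have "\<dots> \<le> B * (1 / c\<^sup>2)" using B(1,2) that inv2[OF that] by (intro mult_mono) auto
    finally show ?thesis .
  qed
  show ?thesis
  proof (rule lip_primI_quadratic[OF hm hb])
    fix x y assume xy: "a \<le> x" "x \<le> y" "y \<le> b"
    have xyab: "x \<in> {a..b}" "y \<in> {a..b}" using xy by auto
    define k where "k = - (1 / (f x)\<^sup>2)"
    let ?e = "\<lambda>s. k * g s"
    have e: "(?e has_integral k * (f y - f x)) {x..y}"
      by (intro has_integral_mult_right) (use 1 xy in \<open>auto simp: lip_prim_def\<close>)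
    have h: "(?h has_integral integral {x..y} ?h) {x..y}"
      by (rule integrable_integral, rule bounded_measurable_integrable[OF hm hb]) (use xy in auto)
    note d = has_integral_diff[OF e h]
    have kb: "\<bar>k\<bar> \<le> 1 / c\<^sup>2" using inv2[OF xyab(1)] by (simp add: k_def abs_divide)
    have eb: "\<bar>?e s\<bar> \<le> 1 / c\<^sup>2 * B" if "s \<in> {a..b}" for s
      unfolding abs_mult using kb B that by (intro mult_mono) auto
    define C1 where "C1 = B * (B * (2 * (1 / c * (1 / c\<^sup>2))))"
    have "\<bar>integral {x..y} (\<lambda>s. ?e s - ?h s)\<bar> \<le> (C1 * (y - x)) * (y - x)"
    proof (rule integral_abs_le)
      show "(\<lambda>s. ?e s - ?h s) \<in> borel_measurable (lebesgue_on {a..b})" using m mg by measurable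
      show "\<bar>?e s - ?h s\<bar> \<le> 1 / c\<^sup>2 * B + B * (1 / c\<^sup>2)" if "s \<in> {a..b}" for s
        using eb[OF that] hb[OF that] by linarith
      show "\<bar>?e s - ?h s\<bar> \<le> C1 * (y - x)" if s: "s \<in> {x..y}" for s
      proof -
        have sab: "s \<in> {a..b}" using s xy by auto
        have p: "0 < f x" "0 < f s" using fp sab xyab by auto
        have "?e s - ?h s = g s * ((f x - f s) * (1 / f s * (1 / (f x)\<^sup>2) + 1 / f x * (1 / (f s)\<^sup>2)))"
          using p by (simp add: k_def power2_eq_square divide_simps) (simp add: algebra_simps)
        also have "\<bar>\<dots>\<bar> \<le> B * ((B * (y - x)) * (1 / c * (1 / c\<^sup>2) + 1 / c * (1 / c\<^sup>2)))"
          unfolding abs_mult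
        proof (intro mult_mono)
          show "\<bar>g s\<bar> \<le> B" using B sab by auto
          show "\<bar>f x - f s\<bar> \<le> B * (y - x)"
            using B(3)[OF sab xyab(1)] s B(1) by (elim order_trans) (auto intro: mult_left_mono)
          have "0 \<le> 1 / f s * (1 / (f x)\<^sup>2) + 1 / f x * (1 / (f s)\<^sup>2)" using p by auto
          moreover have "1 / f s * (1 / (f x)\<^sup>2) + 1 / f x * (1 / (f s)\<^sup>2) \<le> 1 / c * (1 / c\<^sup>2) + 1 / c * (1 / c\<^sup>2)"
            using inv1 inv2 sab xyab c(1) p by (intro add_mono mult_mono) auto
          ultimately show "\<bar>1 / f s * (1 / (f x)\<^sup>2) + 1 / f x * (1 / (f s)\<^sup>2)\<bar> \<le> 1 / c * (1 / c\<^sup>2) + 1 / c * (1 / c\<^sup>2)"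
            by (simp only: abs_of_nonneg)
        qed (use B xy in auto)
        also have "\<dots> = C1 * (y - x)" by (simp add: C1_def algebra_simps)
        finally show ?thesis .
      qed
    qed (use xy in auto)
    then have A: "\<bar>k * (f y - f x) - integral {x..y} ?h\<bar> \<le> C1 * (y - x)\<^sup>2"
      using integral_unique[OF d] by (simp add: power2_eq_square mult.assoc)
    have p: "0 < f x" "0 < f y" using fp xyab by auto
    \<comment> \<open>The exact remainder of the expansion of t -> 1/t at f(x).\<close>
    have "1 / f y - 1 / f x - k * (f y - f x) = (f y - f x)\<^sup>2 * (1 / f y * (1 / (f x)\<^sup>2))"
      using p by (simp add: k_def power2_eq_square divide_simps) (simp add: algebra_simps)
    also have "\<bar>(f y - f x)\<^sup>2 * (1 / f y * (1 / (f x)\<^sup>2))\<bar> \<le> (B * (y - x))\<^sup>2 * (1 / c * (1 / c\<^sup>2))"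
      unfolding abs_mult
    proof (intro mult_mono)
      show "\<bar>(f y - f x)\<^sup>2\<bar> \<le> (B * (y - x))\<^sup>2"
        using B(3)[OF xyab] xy by (simp add: abs_le_square_iff[symmetric])
    qed (use inv1 inv2 xyab p c(1) in \<open>auto simp: abs_divide\<close>)
    also have "\<dots> = B\<^sup>2 * (1 / c * (1 / c\<^sup>2)) * (y - x)\<^sup>2"
      by (simp only: power_mult_distrib ac_simps)
    finally have "\<bar>1 / f y - 1 / f x - k * (f y - f x)\<bar> \<le> B\<^sup>2 * (1 / c * (1 / c\<^sup>2)) * (y - x)\<^sup>2" .
    with A show "\<bar>1 / f y - 1 / f x - integral {x..y} ?h\<bar> \<le> (B\<^sup>2 * (1 / c * (1 / c\<^sup>2)) + C1) * (y - x)\<^sup>2"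
      by (simp add: distrib_right)
  qed
qed

section \<open>From Lipschitz primitives to weak derivatives\<close>

lemma measurable_itv_of_Icc: "f \<in> borel_measurable (lebesgue_on {0..pi}) \<Longrightarrow> f \<in> borel_measurable itv_measure"
  by (erule measurable_restrict_mono) auto

lemma lip_prim_L_infty:
  assumes "lip_prim 0 pi f g"
  shows "f \<in> L_infty itv_measure" "g \<in> L_infty itv_measure"
proof -
  obtain B where B: "\<And>x. x \<in> {0..pi} \<Longrightarrow> \<bar>g x\<bar> \<le> B" using lip_prim_bound[OF assms] by metis
  have "g \<in> borel_measurable itv_measure"
    using assms by (auto simp: lip_prim_def intro: measurable_itv_of_Icc)
  then show "g \<in> L_infty itv_measure" using B by (auto simp: L_infty_def intro!: exI[of _ B] AE_I2)
  obtain M where M: "\<And>x. x \<in> {0..pi} \<Longrightarrow> \<bar>f x\<bar> \<le> M"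
    using continuous_bounded_Icc[OF lip_prim_continuous[OF assms]] by metis
  have "f \<in> borel_measurable itv_measure"
    by (rule measurable_itv_of_Icc[OF continuous_measurable_Icc[OF lip_prim_continuous[OF assms]]])
  then show "f \<in> L_infty itv_measure" using M by (auto simp: L_infty_def intro!: exI[of _ M] AE_I2)
qed

lemma lip_prim_eq_prim:
  assumes "lip_prim 0 pi f g" "x \<in> {0..pi}"
  shows "f x = f 0 + prim g x"
proof -
  have "integrable itv_measure g"
    by (intro L2_itv_integrable L_infty_L2_itv lip_prim_L_infty[OF assms(1)])
  then have "(g has_integral prim g x) {0..x}" using assms by (intro prim_eq_integral) auto
  moreover have "(g has_integral f x - f 0) {0..x}" using assms by (auto simp: lip_prim_def)
  ultimately have "prim g x = f x - f 0" by (rule has_integral_unique)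
  then show ?thesis by simp
qed

lemma lip_prim_has_weak_deriv:
  assumes "lip_prim 0 pi f g"
  shows "has_weak_deriv f g"
  by (rule has_weak_deriv_prim[where c = "f 0"])
    (use assms lip_prim_eq_prim in \<open>auto intro!: L2_itv_integrable L_infty_L2_itv intro: lip_prim_L_infty\<close>)

lemma lip_prim_integral:
  assumes "lip_prim 0 pi f g"
  shows "(LINT x|itv_measure. g x) = f pi - f 0"
  using lip_prim_eq_prim[OF assms, of pi] by (simp add: prim_pi)

lemma lip_prim_W1_infty:
  assumes "lip_prim 0 pi f g"
  shows "f \<in> W1_infty"
proof -
  note w = lip_prim_has_weak_deriv[OF assms]
  then have wd: "weakly_differentiable f" by (auto simp: weakly_differentiable_def)
  obtain C where "AE x in itv_measure. \<bar>g x\<bar> \<le> C"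
    using lip_prim_L_infty(2)[OF assms] by (auto simp: L_infty_def)
  with weak_deriv_eq[OF w] have "AE x in itv_measure. \<bar>weak_deriv f x\<bar> \<le> C"
    by eventually_elim simp
  then have "weak_deriv f \<in> L_infty itv_measure"
    using has_weak_deriv_measurable(2)[OF has_weak_deriv_weak_deriv[OF wd]] by (auto simp: L_infty_def)
  then show ?thesis using wd lip_prim_L_infty(1)[OF assms] by (simp add: W1_infty_def)
qed

section \<open>An eigenfunction with bounded coefficients\<close>

text \<open>Integrating against the weight e^(\<beta> r) gains a factor 1/\<beta>. Two nested
  integrations gain 1/\<beta>^2, so that a large weight yields a contraction on the whole interval
  at once.\<close>

lemma exp_weighted_integral_bound:
  fixes k :: "real \<Rightarrow> real"
  assumes \<beta>: "0 < \<beta>" and k: "k \<in> borel_measurable (lebesgue_on {0..pi})"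
    and b: "\<And>r. r \<in> {0..pi} \<Longrightarrow> \<bar>k r\<bar> \<le> D * exp (\<beta> * r)" and s: "s \<in> {0..pi}"
  shows "\<bar>integral {0..s} k\<bar> \<le> D / \<beta> * exp (\<beta> * s)"
proof -
  have "0 \<le> D" using b[of 0] by (simp add: order_trans[OF abs_ge_zero])
  have e: "((\<lambda>r. D * exp (\<beta> * r)) has_integral D / \<beta> * exp (\<beta> * s) - D / \<beta> * exp (\<beta> * 0)) {0..s}"
    by (rule fundamental_theorem_of_calculus)
      (use s \<beta> in \<open>auto simp: has_real_derivative_iff_has_vector_derivative[symmetric] intro!: derivative_eq_intros\<close>)
  have "\<bar>k r\<bar> \<le> D * exp (\<beta> * pi)" if "r \<in> {0..pi}" for r
    using b[OF that] \<open>0 \<le> D\<close> \<beta> that by (elim order_trans) (auto intro!: mult_left_mono)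
  from bounded_measurable_integrable[OF k this, of 0 s] s have "k integrable_on {0..s}" by auto
  then have "norm (integral {0..s} k) \<le> integral {0..s} (\<lambda>r. D * exp (\<beta> * r))"
    by (rule integral_norm_bound_integral) (use e b s in auto)
  also have "\<dots> = D / \<beta> * exp (\<beta> * s) - D / \<beta> * exp (\<beta> * 0)" using e by (rule integral_unique)
  also have "\<dots> \<le> D / \<beta> * exp (\<beta> * s)" using \<open>0 \<le> D\<close> \<beta> by simp
  finally show ?thesis by simp
qed

lemma lip_prim_has_integral_from_0:
  assumes "lip_prim 0 pi f g" "f 0 = 0" "x \<in> {0..pi}"
  shows "(g has_integral f x) {0..x}"
proof -
  have "(g has_integral f x - f 0) {0..x}" using assms(1,3) by (simp add: lip_prim_def)
  then show ?thesis using assms(2) by simp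
qed

text \<open>Here \<open>a\<close> stands for 1/\<gamma> and \<open>b\<close> for \<gamma>0, with
  bounds at every point of the closed interval. The eigenvalue equation becomes the system \<Phi>' =
  a W, W' = (b - l) \<Phi>, which involves no derivative of a coefficient.\<close>

locale sturm_liouville =
  fixes a b :: "real \<Rightarrow> real" and a0 a1 B :: real
  assumes a_measurable: "a \<in> borel_measurable (lebesgue_on {0..pi})"
    and b_measurable: "b \<in> borel_measurable (lebesgue_on {0..pi})"
    and a0_pos: "0 < a0"
    and a_ge: "\<And>x. x \<in> {0..pi} \<Longrightarrow> a0 \<le> a x"
    and a_le: "\<And>x. x \<in> {0..pi} \<Longrightarrow> a x \<le> a1"
    and b_bound: "\<And>x. x \<in> {0..pi} \<Longrightarrow> \<bar>b x\<bar> \<le> B"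
begin

lemma a1_pos: "0 < a1"
  using a0_pos a_ge[of 0] a_le[of 0] by simp

lemma B_nonneg: "0 \<le> B"
  using b_bound[of 0] by (simp add: order_trans[OF abs_ge_zero])

lemma a_nonneg: "x \<in> {0..pi} \<Longrightarrow> 0 \<le> a x"
  using a0_pos a_ge[of x] by simp

lemma abs_a_le: "x \<in> {0..pi} \<Longrightarrow> \<bar>a x\<bar> \<le> a1"
  using a0_pos a_ge[of x] a_le[of x] by simp

text \<open>\<open>V\<close> and \<open>J\<close> form one Picard step for the initial values
  \<Phi>(0) = 0, W(0) = 1: from a guess \<open>h\<close> for \<Phi>, \<open>V\<close> is the flux
  minus 1 and \<open>J\<close> the next guess.\<close>

definition V :: "real \<Rightarrow> (real \<Rightarrow> real) \<Rightarrow> real \<Rightarrow> real" where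
  "V l h s = integral {0..s} (\<lambda>r. (b r - l) * h r)"

definition J :: "real \<Rightarrow> (real \<Rightarrow> real) \<Rightarrow> real \<Rightarrow> real" where
  "J l h x = integral {0..x} (\<lambda>s. a s * (1 + V l h s))"

lemma integrand_V_measurable:
  "continuous_on {0..pi} h \<Longrightarrow> (\<lambda>r. (b r - l) * h r) \<in> borel_measurable (lebesgue_on {0..pi})"
  using b_measurable continuous_measurable_Icc[of 0 pi h] by simp

lemma V_lip_prim:
  assumes h: "continuous_on {0..pi} h"
  shows "lip_prim 0 pi (V l h) (\<lambda>r. (b r - l) * h r)"
proof -
  obtain N where N: "0 \<le> N" "\<And>x. x \<in> {0..pi} \<Longrightarrow> \<bar>h x\<bar> \<le> N" using continuous_bounded_Icc[OF h] by metis
  show ?thesis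
  proof (rule lip_primI[where c = 0])
    show "\<bar>(b r - l) * h r\<bar> \<le> (B + \<bar>l\<bar>) * N" if "r \<in> {0..pi}" for r
      unfolding abs_mult using N that b_bound[OF that] B_nonneg by (intro mult_mono) auto
  qed (use integrand_V_measurable[OF h] in \<open>auto simp: V_def\<close>)
qed

lemma integrand_J_measurable:
  assumes h: "continuous_on {0..pi} h"
  shows "(\<lambda>s. a s * (1 + V l h s)) \<in> borel_measurable (lebesgue_on {0..pi})"
  using a_measurable continuous_measurable_Icc[OF lip_prim_continuous[OF V_lip_prim[OF h]]] by simp

lemma J_lip_prim:
  assumes h: "continuous_on {0..pi} h"
  shows "lip_prim 0 pi (J l h) (\<lambda>s. a s * (1 + V l h s))"
proof -
  obtain N where N: "0 \<le> N" "\<And>x. x \<in> {0..pi} \<Longrightarrow> \<bar>V l h x\<bar> \<le> N"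
    using continuous_bounded_Icc[OF lip_prim_continuous[OF V_lip_prim[OF h]]] by metis
  show ?thesis
  proof (rule lip_primI[where c = 0])
    show "\<bar>a s * (1 + V l h s)\<bar> \<le> a1 * (1 + N)" if "s \<in> {0..pi}" for s
      unfolding abs_mult using N(1) N(2)[OF that] abs_a_le[OF that] a1_pos by (intro mult_mono) auto
  qed (use integrand_J_measurable[OF h] in \<open>auto simp: J_def\<close>)
qed

text \<open>Argument and spectral parameter vary together, through the splitting (b - l)(h - k) + (m
  - l) k. The case l = m will give the contraction, the general case the dependence on the
  eigenvalue.\<close>

lemma V_diff:
  assumes h: "continuous_on {0..pi} h" and k: "continuous_on {0..pi} k" and s: "s \<in> {0..pi}"
    and \<beta>: "0 < \<beta>" and A: "\<And>x. x \<in> {0..pi} \<Longrightarrow> \<bar>b x - l\<bar> \<le> A"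
    and D: "\<And>r. r \<in> {0..pi} \<Longrightarrow> \<bar>h r - k r\<bar> \<le> D * exp (\<beta> * r)"
    and N: "\<And>r. r \<in> {0..pi} \<Longrightarrow> \<bar>k r\<bar> \<le> N * exp (\<beta> * r)"
  shows "\<bar>V l h s - V m k s\<bar> \<le> (A * D + \<bar>l - m\<bar> * N) / \<beta> * exp (\<beta> * s)"
proof -
  have i: "((\<lambda>r. (b r - l) * h r) has_integral V l h s) {0..s}" "((\<lambda>r. (b r - m) * k r) has_integral V m k s) {0..s}"
    by (intro lip_prim_has_integral_from_0 V_lip_prim h k s; simp add: V_def)+
  have "V l h s - V m k s = integral {0..s} (\<lambda>r. (b r - l) * h r - (b r - m) * k r)"
    using integral_unique[OF has_integral_diff[OF i]] by simp
  also have "\<bar>\<dots>\<bar> \<le> (A * D + \<bar>l - m\<bar> * N) / \<beta> * exp (\<beta> * s)"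
  proof (rule exp_weighted_integral_bound[OF \<beta> _ _ s])
    show "(\<lambda>r. (b r - l) * h r - (b r - m) * k r) \<in> borel_measurable (lebesgue_on {0..pi})"
      using integrand_V_measurable[OF h] integrand_V_measurable[OF k] by simp
    fix r assume r: "r \<in> {0..pi}"
    have "(b r - l) * h r - (b r - m) * k r = (b r - l) * (h r - k r) + (m - l) * k r"
      by (simp add: algebra_simps)
    also have "\<bar>\<dots>\<bar> \<le> A * (D * exp (\<beta> * r)) + \<bar>l - m\<bar> * (N * exp (\<beta> * r))"
    proof (rule order_trans[OF abs_triangle_ineq], rule add_mono)
      show "\<bar>(b r - l) * (h r - k r)\<bar> \<le> A * (D * exp (\<beta> * r))"
        unfolding abs_mult using A[OF r] D[OF r] by (intro mult_mono) (auto intro: order_trans[OF abs_ge_zero])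
      show "\<bar>(m - l) * k r\<bar> \<le> \<bar>l - m\<bar> * (N * exp (\<beta> * r))"
        unfolding abs_mult using N[OF r] by (intro mult_mono) auto
    qed
    finally show "\<bar>(b r - l) * h r - (b r - m) * k r\<bar> \<le> (A * D + \<bar>l - m\<bar> * N) * exp (\<beta> * r)"
      by (simp add: algebra_simps)
  qed
  finally show ?thesis .
qed

lemma J_diff:
  assumes h: "continuous_on {0..pi} h" and k: "continuous_on {0..pi} k" and x: "x \<in> {0..pi}"
    and \<beta>: "0 < \<beta>" and A: "\<And>x. x \<in> {0..pi} \<Longrightarrow> \<bar>b x - l\<bar> \<le> A"
    and D: "\<And>r. r \<in> {0..pi} \<Longrightarrow> \<bar>h r - k r\<bar> \<le> D * exp (\<beta> * r)"
    and N: "\<And>r. r \<in> {0..pi} \<Longrightarrow> \<bar>k r\<bar> \<le> N * exp (\<beta> * r)"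
  shows "\<bar>J l h x - J m k x\<bar> \<le> a1 * (A * D + \<bar>l - m\<bar> * N) / \<beta>\<^sup>2 * exp (\<beta> * x)"
proof -
  have i: "((\<lambda>s. a s * (1 + V l h s)) has_integral J l h x) {0..x}"
    "((\<lambda>s. a s * (1 + V m k s)) has_integral J m k x) {0..x}"
    by (intro lip_prim_has_integral_from_0 J_lip_prim h k x; simp add: J_def)+
  have "J l h x - J m k x = integral {0..x} (\<lambda>s. a s * (1 + V l h s) - a s * (1 + V m k s))"
    using integral_unique[OF has_integral_diff[OF i]] by simp
  also have "\<bar>\<dots>\<bar> \<le> (a1 * ((A * D + \<bar>l - m\<bar> * N) / \<beta>)) / \<beta> * exp (\<beta> * x)"
  proof (rule exp_weighted_integral_bound[OF \<beta> _ _ x])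
    show "(\<lambda>s. a s * (1 + V l h s) - a s * (1 + V m k s)) \<in> borel_measurable (lebesgue_on {0..pi})"
      using integrand_J_measurable[OF h] integrand_J_measurable[OF k] by simp
    fix s assume s: "s \<in> {0..pi}"
    have "a s * (1 + V l h s) - a s * (1 + V m k s) = a s * (V l h s - V m k s)" by (simp add: algebra_simps)
    also have "\<bar>\<dots>\<bar> \<le> a1 * ((A * D + \<bar>l - m\<bar> * N) / \<beta> * exp (\<beta> * s))"
      unfolding abs_mult
      using abs_a_le[OF s] a1_pos by (intro mult_mono V_diff[OF h k s \<beta> A D N]) auto
    finally show "\<bar>a s * (1 + V l h s) - a s * (1 + V m k s)\<bar> \<le> a1 * ((A * D + \<bar>l - m\<bar> * N) / \<beta>) * exp (\<beta> * s)"
      by (simp add: mult.assoc)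
  qed
  finally show ?thesis by (simp add: power2_eq_square)
qed

text \<open>Bounded continuous functions on the whole line serve as the complete metric space; a
  function on [0, pi] enters it through extension by its end values.\<close>

definition clip :: "real \<Rightarrow> real" where "clip x = max 0 (min x pi)"

lemma clip_in: "clip x \<in> {0..pi}" by (auto simp: clip_def)

lemma clip_eq: "x \<in> {0..pi} \<Longrightarrow> clip x = x" by (auto simp: clip_def)

text \<open>The fixed point space stores e^(- \<beta> r) h(r), so its supremum norm is the
  exponentially weighted norm of \<open>h\<close>.\<close>

definition weighted :: "real \<Rightarrow> (real \<Rightarrow>\<^sub>C real) \<Rightarrow> real \<Rightarrow> real" where
  "weighted \<beta> f r = exp (\<beta> * r) * apply_bcontfun f r"

definition step :: "real \<Rightarrow> real \<Rightarrow> (real \<Rightarrow>\<^sub>C real) \<Rightarrow> (real \<Rightarrow>\<^sub>C real)" where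
  "step \<beta> l f = Bcontfun (\<lambda>x. exp (- (\<beta> * clip x)) * J l (weighted \<beta> f) (clip x))"

lemma weighted_continuous: "continuous_on S (weighted \<beta> f)"
  unfolding weighted_def by (intro continuous_intros continuous_on_apply_bcontfun)

lemma apply_step: "apply_bcontfun (step \<beta> l f) x = exp (- (\<beta> * clip x)) * J l (weighted \<beta> f) (clip x)"
proof -
  let ?g = "\<lambda>x. exp (- (\<beta> * x)) * J l (weighted \<beta> f) x"
  have c: "continuous_on {0..pi} ?g"
    by (intro continuous_intros lip_prim_continuous[OF J_lip_prim] weighted_continuous)
  obtain N where N: "\<And>x. x \<in> {0..pi} \<Longrightarrow> \<bar>?g x\<bar> \<le> N" using continuous_bounded_Icc[OF c] by metis
  have "(\<lambda>x. ?g (clip x)) \<in> bcontfun"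
  proof (rule bcontfun_normI)
    have "continuous_on UNIV clip" unfolding clip_def by (intro continuous_intros)
    then show "continuous_on UNIV (\<lambda>x. ?g (clip x))"
      by (rule continuous_on_compose2[OF c]) (use clip_in in auto)
    show "norm (?g (clip x)) \<le> N" for x using N[OF clip_in] by simp
  qed
  then show ?thesis by (simp add: step_def Bcontfun_inverse)
qed

lemma dist_step:
  assumes \<beta>: "0 < \<beta>" and A: "\<And>x. x \<in> {0..pi} \<Longrightarrow> \<bar>b x - l\<bar> \<le> A" and half: "a1 * A / \<beta>\<^sup>2 \<le> 1 / 2"
  shows "dist (step \<beta> l f) (step \<beta> m g) \<le> 1 / 2 * dist f g + a1 / \<beta>\<^sup>2 * \<bar>l - m\<bar> * norm g"
proof (rule dist_bound)
  fix x
  define y where "y = clip x"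
  have y: "y \<in> {0..pi}" unfolding y_def by (rule clip_in)
  have "\<bar>J l (weighted \<beta> f) y - J m (weighted \<beta> g) y\<bar> \<le>
      a1 * (A * dist f g + \<bar>l - m\<bar> * norm g) / \<beta>\<^sup>2 * exp (\<beta> * y)"
  proof (rule J_diff[OF weighted_continuous weighted_continuous y \<beta> A])
    fix r
    have "\<bar>weighted \<beta> f r - weighted \<beta> g r\<bar> = exp (\<beta> * r) * dist (f r) (g r)"
      by (simp add: weighted_def dist_real_def abs_mult right_diff_distrib[symmetric])
    also have "\<dots> \<le> exp (\<beta> * r) * dist f g" by (intro mult_left_mono dist_bounded) auto
    finally show "\<bar>weighted \<beta> f r - weighted \<beta> g r\<bar> \<le> dist f g * exp (\<beta> * r)" by (simp add: mult.commute)
    show "\<bar>weighted \<beta> g r\<bar> \<le> norm g * exp (\<beta> * r)"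
      using norm_bounded[of g r] by (simp add: weighted_def abs_mult mult.commute)
  qed
  then have "exp (- (\<beta> * y)) * \<bar>J l (weighted \<beta> f) y - J m (weighted \<beta> g) y\<bar> \<le>
      exp (- (\<beta> * y)) * (a1 * (A * dist f g + \<bar>l - m\<bar> * norm g) / \<beta>\<^sup>2 * exp (\<beta> * y))"
    by (intro mult_left_mono) auto
  also have "\<dots> = a1 * (A * dist f g + \<bar>l - m\<bar> * norm g) / \<beta>\<^sup>2"
    by (simp add: exp_minus)
  also have "\<dots> = a1 * A / \<beta>\<^sup>2 * dist f g + a1 / \<beta>\<^sup>2 * \<bar>l - m\<bar> * norm g"
    by (simp add: add_divide_distrib algebra_simps)
  also have "\<dots> \<le> 1 / 2 * dist f g + a1 / \<beta>\<^sup>2 * \<bar>l - m\<bar> * norm g"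
    by (intro add_right_mono mult_right_mono half) auto
  finally show "dist (step \<beta> l f x) (step \<beta> m g x) \<le> 1 / 2 * dist f g + a1 / \<beta>\<^sup>2 * \<bar>l - m\<bar> * norm g"
    by (simp add: apply_step dist_real_def y_def[symmetric] right_diff_distrib[symmetric] abs_mult)
qed

text \<open>Banach's theorem for each \<open>l\<close>. Comparing two fixed points gives half their
  distance plus a multiple of |l - m|; absorbing the half makes bound and Lipschitz constant uniform
  in \<open>l\<close>.\<close>

lemma solutions_exist:
  assumes "lo \<le> hi"
  shows "\<exists>\<Phi> W M L. 0 \<le> M \<and> 0 \<le> L \<and> (\<forall>l\<in>{lo..hi}.
    lip_prim 0 pi (\<Phi> l) (\<lambda>x. a x * W l x) \<and> lip_prim 0 pi (W l) (\<lambda>x. (b x - l) * \<Phi> l x) \<and>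
    \<Phi> l 0 = 0 \<and> W l 0 = 1 \<and> (\<forall>x\<in>{0..pi}. \<bar>\<Phi> l x\<bar> \<le> M) \<and>
    (\<forall>m\<in>{lo..hi}. \<forall>x\<in>{0..pi}. \<bar>\<Phi> l x - \<Phi> m x\<bar> \<le> L * \<bar>l - m\<bar>))"
proof -
  define A where "A = B + \<bar>lo\<bar> + \<bar>hi\<bar>"
  have A: "\<bar>b x - l\<bar> \<le> A" if "l \<in> {lo..hi}" "x \<in> {0..pi}" for l x
    using b_bound[OF that(2)] that(1) by (auto simp: A_def)
  have A0: "0 \<le> A" using B_nonneg by (simp add: A_def)
  \<comment> \<open>From \<beta> >= 1 and \<beta> >= 2 a1 A one gets \<beta>^2 >= 2 a1 A, which is
    the contraction factor 1/2.\<close>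
  define \<beta> where "\<beta> = 2 * a1 * A + 1"
  have \<beta>1: "1 \<le> \<beta>" using a1_pos A0 by (simp add: \<beta>_def)
  then have \<beta>: "0 < \<beta>" by simp
  have half: "a1 * A / \<beta>\<^sup>2 \<le> 1 / 2"
  proof -
    have "2 * (a1 * A) \<le> \<beta>" by (simp add: \<beta>_def)
    also have "\<beta> \<le> \<beta>\<^sup>2" using \<beta>1 by (simp add: self_le_power)
    finally show ?thesis using \<beta> by (simp add: field_simps)
  qed
  note ds = dist_step[OF \<beta> A half]
  define C where "C = a1 / \<beta>\<^sup>2"
  have C0: "0 \<le> C" using a1_pos by (simp add: C_def)
  have "\<exists>f. step \<beta> l f = f" if l: "l \<in> {lo..hi}" for l
  proof -
    have "dist (step \<beta> l f) (step \<beta> l g) \<le> 1 / 2 * dist f g" for f g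
      using ds[OF l, of f l g] by simp
    then have "\<exists>!f. step \<beta> l f = f" by (intro banach_fix_type[of "1 / 2"]) auto
    then show ?thesis by blast
  qed
  then obtain F where F: "\<And>l. l \<in> {lo..hi} \<Longrightarrow> step \<beta> l (F l) = F l" by metis
  define \<Phi> where "\<Phi> l = J l (weighted \<beta> (F l))" for l
  define W where "W l x = 1 + V l (weighted \<beta> (F l)) x" for l x
  have wt: "weighted \<beta> (F l) x = \<Phi> l x" if "l \<in> {lo..hi}" "x \<in> {0..pi}" for l x
  proof -
    have "F l x = exp (- (\<beta> * x)) * \<Phi> l x"
      using apply_step[of \<beta> l "F l" x] F[OF that(1)] clip_eq[OF that(2)] by (simp add: \<Phi>_def)
    then show ?thesis by (simp add: weighted_def exp_minus)
  qed
  define n0 where "n0 = norm (step \<beta> lo 0)"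
  \<comment> \<open>The parameter only multiplies the argument, so the image of zero is the same for
    all \<open>l\<close>.\<close>
  have z: "step \<beta> l 0 = step \<beta> lo 0" if "l \<in> {lo..hi}" for l
    using ds[OF that, of 0 lo 0] by simp
  have nF: "norm (F l) \<le> 2 * n0" if l: "l \<in> {lo..hi}" for l
  proof -
    have "norm (F l) \<le> dist (step \<beta> l (F l)) (step \<beta> l 0) + norm (step \<beta> l 0)"
      by (metis F[OF l] add.commute dist_0_norm dist_commute dist_triangle)
    also have "\<dots> \<le> 1 / 2 * norm (F l) + n0"
      using ds[OF l, of "F l" l 0] z[OF l] by (simp add: n0_def)
    finally show ?thesis by simp
  qed
  have n00: "0 \<le> n0" by (simp add: n0_def)
  have dF: "dist (F l) (F m) \<le> 4 * C * n0 * \<bar>l - m\<bar>" if lm: "l \<in> {lo..hi}" "m \<in> {lo..hi}" for l m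
  proof -
    have "dist (F l) (F m) \<le> 1 / 2 * dist (F l) (F m) + C * \<bar>l - m\<bar> * norm (F m)"
      using ds[OF lm(1), of "F l" m "F m"] F lm by (simp add: C_def)
    moreover have "C * \<bar>l - m\<bar> * norm (F m) \<le> C * \<bar>l - m\<bar> * (2 * n0)"
      using nF[OF lm(2)] C0 by (intro mult_left_mono) auto
    ultimately show ?thesis by (simp add: algebra_simps)
  qed
  define E where "E = exp (\<beta> * pi)"
  have E: "exp (\<beta> * x) \<le> E" "0 \<le> E" if "x \<in> {0..pi}" for x using that \<beta> by (auto simp: E_def)
  show ?thesis
  proof (intro exI conjI ballI)
    show "0 \<le> E * (2 * n0)" "0 \<le> E * (4 * C * n0)" using n00 C0 by (auto simp: E_def)
    fix l assume l: "l \<in> {lo..hi}"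
    note wc = weighted_continuous[of "{0..pi}" \<beta> "F l"]
    show "lip_prim 0 pi (\<Phi> l) (\<lambda>x. a x * W l x)"
      unfolding \<Phi>_def W_def by (rule J_lip_prim[OF wc])
    have "lip_prim 0 pi (W l) (\<lambda>x. 0 + (b x - l) * weighted \<beta> (F l) x)"
      unfolding W_def by (intro lip_prim_add lip_prim_const V_lip_prim wc)
    then have w: "lip_prim 0 pi (W l) (\<lambda>x. (b x - l) * weighted \<beta> (F l) x)" by simp
    show "lip_prim 0 pi (W l) (\<lambda>x. (b x - l) * \<Phi> l x)"
      unfolding lip_prim_def
    proof (intro conjI ballI)
      note eq = measurable_lebesgue_cong[of "{0..pi}" "\<lambda>x. (b x - l) * \<Phi> l x" "\<lambda>x. (b x - l) * weighted \<beta> (F l) x"]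
      show "(\<lambda>x. (b x - l) * \<Phi> l x) \<in> borel_measurable (lebesgue_on {0..pi})"
        using eq w wt[OF l] by (auto simp: lip_prim_def)
      show "\<exists>B. \<forall>x\<in>{0..pi}. \<bar>(b x - l) * \<Phi> l x\<bar> \<le> B"
        using w wt[OF l] by (auto simp: lip_prim_def)
      fix x y assume xy: "x \<in> {0..pi}" "y \<in> {x..pi}"
      then have "((\<lambda>x. (b x - l) * weighted \<beta> (F l) x) has_integral W l y - W l x) {x..y}"
        using w by (simp add: lip_prim_def)
      then show "((\<lambda>x. (b x - l) * \<Phi> l x) has_integral W l y - W l x) {x..y}"
        by (rule has_integral_eq[rotated]) (use wt[OF l] xy in auto)
    qed
    show "\<Phi> l 0 = 0" "W l 0 = 1" by (simp_all add: \<Phi>_def W_def J_def V_def)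
    fix x assume x: "x \<in> {0..pi}"
    have "\<bar>exp (\<beta> * x) * F l x\<bar> \<le> E * (2 * n0)"
      unfolding abs_mult using E[OF x] nF[OF l] norm_bounded[of "F l" x] n00 by (intro mult_mono) auto
    then show "\<bar>\<Phi> l x\<bar> \<le> E * (2 * n0)" using wt[OF l x] by (simp add: weighted_def)
  next
    fix l m x assume lm: "l \<in> {lo..hi}" "m \<in> {lo..hi}" and x: "x \<in> {0..pi}"
    have "\<Phi> l x - \<Phi> m x = exp (\<beta> * x) * (F l x - F m x)"
      using wt[OF lm(1) x] wt[OF lm(2) x] by (simp add: weighted_def right_diff_distrib)
    also have "\<bar>\<dots>\<bar> \<le> E * (4 * C * n0 * \<bar>l - m\<bar>)"
      unfolding abs_mult
      using E[OF x] dF[OF lm] dist_bounded[of "F l" x "F m"] by (intro mult_mono) (auto simp: dist_real_def)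
    finally show "\<bar>\<Phi> l x - \<Phi> m x\<bar> \<le> E * (4 * C * n0) * \<bar>l - m\<bar>" by (simp add: mult.assoc)
  qed
qed

text \<open>For l > B the flux decreases while \<Phi> is nonnegative. If it is still nonnegative at
  pi/2, then \<Phi> increases up to there: the flux lost on [pi/4, pi/2] bounds W(pi/4) below by a
  multiple of \<Phi>(pi/4), and integrating the flux from 0 to pi/4 gives a reverse bound. Together
  they limit l - B. If the flux is negative at pi/2, the mirrored argument works at 3 pi/4.\<close>

lemma no_positive_solution:
  assumes \<Phi>: "lip_prim 0 pi \<Phi> (\<lambda>x. a x * W x)" and W: "lip_prim 0 pi W (\<lambda>x. (b x - l) * \<Phi> x)"
    and z: "\<Phi> 0 = 0" and p: "\<And>x. 0 < x \<Longrightarrow> x \<le> pi \<Longrightarrow> 0 < \<Phi> x"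
    and l: "B < l"
  shows "(l - B) * a0 * (pi / 4)\<^sup>2 \<le> 1"
proof -
  define M where "M = l - B"
  have M: "0 < M" using l by (simp add: M_def)
  have dW: "(b x - l) * \<Phi> x \<le> - (M * c)" if "x \<in> {0..pi}" "0 \<le> c" "c \<le> \<Phi> x" for x c
  proof -
    have "M * c \<le> (l - b x) * \<Phi> x"
      using b_bound[OF that(1)] that M by (intro mult_mono) (auto simp: M_def)
    then show ?thesis by (simp add: algebra_simps)
  qed
  have p': "0 \<le> \<Phi> x" if "x \<in> {0..pi}" for x using p[of x] z that by (cases "x = 0") auto
  have Wdec: "W y \<le> W x" if "0 \<le> x" "x \<le> y" "y \<le> pi" for x y
    using lip_prim_upper[OF W that, of 0] dW[of _ 0] p' that by auto
  \<comment> \<open>Common end of both cases: \<open>P\<close> is the value of \<Phi> at the quarter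
    point, \<open>w\<close> the absolute value of the flux there.\<close>
  have key: "M * (pi / 4) * P \<le> w \<Longrightarrow> a0 * (pi / 4) * w \<le> P \<Longrightarrow> 0 < P \<Longrightarrow> M * a0 * (pi / 4)\<^sup>2 \<le> 1" for P w
  proof -
    assume a: "M * (pi / 4) * P \<le> w" "a0 * (pi / 4) * w \<le> P" "0 < P"
    have "(M * a0 * (pi / 4)\<^sup>2) * P = a0 * (pi / 4) * (M * (pi / 4) * P)" by (simp add: power2_eq_square algebra_simps)
    also have "\<dots> \<le> a0 * (pi / 4) * w" using a a0_pos by (intro mult_left_mono) auto
    also have "\<dots> \<le> 1 * P" using a by simp
    finally show ?thesis using a(3) by (rule mult_right_le_imp_le)
  qed
  show ?thesis
  proof (cases "0 \<le> W (pi / 2)")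
    case True
    have W0: "0 \<le> W s" if "s \<in> {0..pi / 2}" for s using Wdec[of s "pi / 2"] True that by auto
    have inc: "\<Phi> (pi / 4) \<le> \<Phi> s" if "s \<in> {pi / 4..pi / 2}" for s
    proof -
      have "0 \<le> a r * W r" if "r \<in> {pi / 4..s}" for r
        using that \<open>s \<in> _\<close> W0[of r] a_ge[of r] a0_pos by (intro mult_nonneg_nonneg) auto
      then show ?thesis using lip_prim_lower[OF \<Phi>, of "pi / 4" s 0] that by auto
    qed
    have "W (pi / 2) - W (pi / 4) \<le> - (M * \<Phi> (pi / 4)) * (pi / 2 - pi / 4)"
      by (rule lip_prim_upper[OF W]) (use inc p' in \<open>auto intro!: dW\<close>)
    then have 1: "M * (pi / 4) * \<Phi> (pi / 4) \<le> W (pi / 4)" using True by (simp add: algebra_simps)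
    have "(a0 * W (pi / 4)) * (pi / 4 - 0) \<le> \<Phi> (pi / 4) - \<Phi> 0"
      by (rule lip_prim_lower[OF \<Phi>]) (use W0 a_ge a_nonneg Wdec[of _ "pi / 4"] in \<open>auto intro!: mult_mono\<close>)
    then have 2: "a0 * (pi / 4) * W (pi / 4) \<le> \<Phi> (pi / 4)" using z by (simp add: algebra_simps)
    show ?thesis using key[OF 1 2] p[of "pi / 4"] by (simp add: M_def)
  next
    case False
    define q where "q = 3 * pi / 4"
    have q: "0 < q" "pi / 2 \<le> q" "q \<le> pi" by (auto simp: q_def)
    have W0: "W s \<le> 0" if "s \<in> {pi / 2..pi}" for s using Wdec[of "pi / 2" s] False that by auto
    have neg: "a s * W s \<le> a0 * c" if "s \<in> {pi / 2..pi}" "W s \<le> c" "c \<le> 0" for s c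
    proof -
      have "a0 * (- c) \<le> a s * (- W s)" using a_ge[of s] a0_pos that by (intro mult_mono) auto
      then show ?thesis by simp
    qed
    have dec: "\<Phi> q \<le> \<Phi> s" if "s \<in> {pi / 2..q}" for s
      using lip_prim_upper[OF \<Phi>, of s q 0] neg[of _ 0] W0 that q by auto
    have "W q - W (pi / 2) \<le> - (M * \<Phi> q) * (q - pi / 2)"
      by (rule lip_prim_upper[OF W]) (use dec p' q in \<open>auto intro!: dW\<close>)
    then have 1: "M * (pi / 4) * \<Phi> q \<le> - W q" using False by (simp add: q_def algebra_simps)
    have "\<Phi> pi - \<Phi> q \<le> (a0 * W q) * (pi - q)"
      by (rule lip_prim_upper[OF \<Phi>]) (use q W0 Wdec[of q] in \<open>auto intro!: neg\<close>)
    then have 2: "a0 * (pi / 4) * (- W q) \<le> \<Phi> q" using p[of pi] by (simp add: q_def algebra_simps)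
    show ?thesis using key[OF 1 2] p[of q] q by (simp add: M_def)
  qed
qed

text \<open>Both \<open>\<Phi>\<close> and its flux cannot vanish at the end point of an interval of positivity: near that
  point \<open>\<Phi>\<close> would be bounded by a small multiple of its own maximum.\<close>

lemma flux_nonzero_at_first_zero:
  assumes \<Phi>: "lip_prim 0 pi \<Phi> (\<lambda>x. a x * W x)" and W: "lip_prim 0 pi W (\<lambda>x. (b x - l) * \<Phi> x)"
    and t: "0 < t" "t \<le> pi" and p: "\<And>x. 0 < x \<Longrightarrow> x < t \<Longrightarrow> 0 < \<Phi> x"
    and z: "\<Phi> t = 0"
  shows "W t \<noteq> 0"
proof
  assume Wt: "W t = 0"
  define A where "A = B + \<bar>l\<bar>"
  have A: "\<bar>b x - l\<bar> \<le> A" if "x \<in> {0..pi}" for x using b_bound[OF that] by (auto simp: A_def)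
  have A0: "0 \<le> A" using B_nonneg by (simp add: A_def)
  \<comment> \<open>The bound t/2 keeps the window to the right of 0; the other two make a1 A
    \<eta>^2 < 1.\<close>
  define \<eta> where "\<eta> = min (t / 2) (min 1 (1 / (a1 * A + 1)))"
  have aA: "0 \<le> a1 * A" using a1_pos A0 by simp
  have \<eta>: "0 < \<eta>" "\<eta> < t" "\<eta> \<le> 1" "\<eta> \<le> 1 / (a1 * A + 1)"
    using t aA by (auto simp: \<eta>_def min_less_iff_disj intro: min.coboundedI1 min.coboundedI2)
  have small: "a1 * A * \<eta> * \<eta> < 1"
  proof -
    have "a1 * A * \<eta> * \<eta> \<le> a1 * A * \<eta> * 1" using \<eta> aA by (intro mult_left_mono) auto
    also have "\<dots> \<le> (a1 * A) * (1 / (a1 * A + 1))" using \<eta> aA by (simp only: mult_1_right) (intro mult_left_mono)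
    also have "\<dots> < 1" using aA by (simp add: field_simps)
    finally show ?thesis .
  qed
  let ?I = "{t - \<eta>..t}"
  have I: "?I \<subseteq> {0..pi}" using \<eta> t by auto
  have "continuous_on ?I \<Phi>" using lip_prim_continuous[OF \<Phi>] I by (rule continuous_on_subset)
  then obtain m where m: "m \<in> ?I" "\<And>x. x \<in> ?I \<Longrightarrow> \<Phi> x \<le> \<Phi> m"
    using continuous_attains_sup[of ?I \<Phi>] \<eta> by fastforce
  define P where "P = \<Phi> m"
  have "0 < \<Phi> (t - \<eta>)" using p \<eta> by auto
  then have P: "0 < P" using m(2)[of "t - \<eta>"] \<eta> by (auto simp: P_def)
  have pP: "\<bar>\<Phi> x\<bar> \<le> P" if "x \<in> ?I" for x
    using m(2)[OF that] p[of x] z that \<eta> by (cases "x = t") (auto simp: P_def)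
  have Wb: "\<bar>W s\<bar> \<le> A * P * \<eta>" if s: "s \<in> ?I" for s
  proof -
    have "\<bar>W t - W s\<bar> \<le> (A * P) * (t - s)"
      by (rule lip_prim_abs_le[OF W]) (use s t \<eta> A pP A0 in \<open>auto simp: abs_mult intro!: mult_mono\<close>)
    also have "\<dots> \<le> (A * P) * \<eta>" using s A0 P by (intro mult_left_mono) auto
    finally show ?thesis using Wt by simp
  qed
  have "\<bar>\<Phi> t - \<Phi> m\<bar> \<le> (a1 * (A * P * \<eta>)) * (t - m)"
    by (rule lip_prim_abs_le[OF \<Phi>])
      (use m I t \<eta> Wb abs_a_le a1_pos in \<open>auto simp: abs_mult intro!: mult_mono\<close>)
  also have "\<dots> \<le> (a1 * (A * P * \<eta>)) * \<eta>" using m A0 P a1_pos \<eta> by (intro mult_left_mono) auto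
  also have "\<dots> = (a1 * A * \<eta> * \<eta>) * P" by (simp add: algebra_simps)
  also have "\<dots> < 1 * P" using small P by (intro mult_strict_right_mono)
  finally show False using z P by (simp add: P_def)
qed

text \<open>Shooting in \<open>l\<close>. The minimum of \<Phi> over [\<delta>, pi] depends
  continuously on \<open>l\<close>, is nonnegative for l = - B and nonpositive for large
  \<open>l\<close>. Where it is zero, \<Phi> is nonnegative and touches zero; an interior contact
  would make the flux vanish too, so the contact is at pi.\<close>

lemma eigenfunction:
  obtains l \<Phi> W where "lip_prim 0 pi \<Phi> (\<lambda>x. a x * W x)" "lip_prim 0 pi W (\<lambda>x. (b x - l) * \<Phi> x)"
    "\<Phi> 0 = 0" "\<Phi> pi = 0" "W 0 = 1" "\<And>x. 0 < x \<Longrightarrow> x < pi \<Longrightarrow> 0 < \<Phi> x"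
proof -
  \<comment> \<open>At l = - B the coefficient b - l is nonnegative, so flux and solution
    grow.\<close>
  define lo where "lo = - B"
  \<comment> \<open>Chosen so that (hi - B) a0 (pi/4)^2 exceeds 1, the limit for a positive
    solution.\<close>
  define hi where "hi = B + (1 / (a0 * (pi / 4)\<^sup>2) + 1)"
  have hiB: "B < hi" using a0_pos by (simp add: hi_def add_pos_pos)
  then have lohi: "lo \<le> hi" using B_nonneg by (simp add: lo_def)
  obtain \<Phi> W M L where M: "0 \<le> M" and L: "0 \<le> L"
    and sol: "\<forall>l\<in>{lo..hi}.
      lip_prim 0 pi (\<Phi> l) (\<lambda>x. a x * W l x) \<and> lip_prim 0 pi (W l) (\<lambda>x. (b x - l) * \<Phi> l x) \<and>
      \<Phi> l 0 = 0 \<and> W l 0 = 1 \<and> (\<forall>x\<in>{0..pi}. \<bar>\<Phi> l x\<bar> \<le> M) \<and>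
      (\<forall>m\<in>{lo..hi}. \<forall>x\<in>{0..pi}. \<bar>\<Phi> l x - \<Phi> m x\<bar> \<le> L * \<bar>l - m\<bar>)"
    using solutions_exist[OF lohi] by blast
  have \<Phi>p: "lip_prim 0 pi (\<Phi> l) (\<lambda>x. a x * W l x)" and Wp: "lip_prim 0 pi (W l) (\<lambda>x. (b x - l) * \<Phi> l x)"
    and \<Phi>0: "\<Phi> l 0 = 0" and W0: "W l 0 = 1" if "l \<in> {lo..hi}" for l
    using sol that by auto
  have \<Phi>M: "\<bar>\<Phi> l x\<bar> \<le> M" if "l \<in> {lo..hi}" "x \<in> {0..pi}" for l x
    using sol that by auto
  have \<Phi>L: "\<bar>\<Phi> l x - \<Phi> m x\<bar> \<le> L * \<bar>l - m\<bar>" if "l \<in> {lo..hi}" "m \<in> {lo..hi}" "x \<in> {0..pi}" for l m x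
    using sol that by auto
  define K where "K = (B + \<bar>lo\<bar> + \<bar>hi\<bar>) * M"
  have K0: "0 \<le> K" using M B_nonneg by (simp add: K_def)
  \<comment> \<open>\<open>K\<close> bounds the derivative of every flux, so on [0, \<delta>] the
    flux stays above 1/2 and \<Phi> is positive on (0, \<delta>] for all \<open>l\<close> at once.
    The cut at \<delta> keeps the zero at the origin out of the minimum.\<close>
  define \<delta> where "\<delta> = min (pi / 2) (1 / (2 * (K + 1)))"
  have \<delta>: "0 < \<delta>" "\<delta> < pi" "\<delta> \<le> 1 / (2 * (K + 1))"
    using K0 pi_gt_zero by (auto simp: \<delta>_def min_less_iff_disj)
  have near0: "0 < \<Phi> l x" if l: "l \<in> {lo..hi}" and x: "0 < x" "x \<le> \<delta>" for l x
  proof -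
    have Wge: "1 / 2 \<le> W l s" if s: "0 \<le> s" "s \<le> x" for s
    proof -
      have "\<bar>W l s - W l 0\<bar> \<le> K * (s - 0)"
      proof (rule lip_prim_abs_le[OF Wp[OF l]])
        fix r assume "r \<in> {0..s}"
        then have r: "r \<in> {0..pi}" using s x \<delta> by auto
        show "\<bar>(b r - l) * \<Phi> l r\<bar> \<le> K"
          unfolding K_def abs_mult using b_bound[OF r] \<Phi>M[OF l r] l B_nonneg by (intro mult_mono) auto
      qed (use s x \<delta> in auto)
      also have "\<dots> \<le> K * (1 / (2 * (K + 1)))" using s x \<delta> K0 by (intro mult_left_mono) auto
      also have "\<dots> \<le> 1 / 2" using K0 by (simp add: field_simps)
      finally have "\<bar>W l s - 1\<bar> \<le> 1 / 2" using W0[OF l] by simp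
      from abs_le_D2[OF this] show ?thesis by simp
    qed
    have "(a0 * (1 / 2)) * (x - 0) \<le> \<Phi> l x - \<Phi> l 0"
    proof (rule lip_prim_lower[OF \<Phi>p[OF l]])
      fix s assume "s \<in> {0..x}"
      then have "s \<in> {0..pi}" "1 / 2 \<le> W l s" using x \<delta> Wge by auto
      then show "a0 * (1 / 2) \<le> a s * W l s" using a_ge a_nonneg by (intro mult_mono) auto
    qed (use x \<delta> in auto)
    moreover have "0 < (a0 * (1 / 2)) * (x - 0)" using a0_pos x by simp
    ultimately show ?thesis using \<Phi>0[OF l] by simp
  qed
  have \<Phi>c: "continuous_on {\<delta>..pi} (\<Phi> l)" if "l \<in> {lo..hi}" for l
    using lip_prim_continuous[OF \<Phi>p[OF that]] by (rule continuous_on_subset) (use \<delta> in auto)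
  have "\<exists>x\<in>{\<delta>..pi}. \<forall>y\<in>{\<delta>..pi}. \<Phi> l x \<le> \<Phi> l y" if "l \<in> {lo..hi}" for l
    by (rule continuous_attains_inf[OF _ _ \<Phi>c[OF that]]) (use \<delta> in auto)
  then obtain xm where xm: "\<And>l. l \<in> {lo..hi} \<Longrightarrow> xm l \<in> {\<delta>..pi}"
    "\<And>l y. l \<in> {lo..hi} \<Longrightarrow> y \<in> {\<delta>..pi} \<Longrightarrow> \<Phi> l (xm l) \<le> \<Phi> l y" by metis
  define m where "m l = \<Phi> l (xm l)" for l
  \<comment> \<open>Evaluating both functions at the minimizer for \<open>k\<close>: a minimum of
    uniformly Lipschitz families is Lipschitz in the parameter.\<close>
  have m1: "m l - m k \<le> L * \<bar>l - k\<bar>" if "l \<in> {lo..hi}" "k \<in> {lo..hi}" for l k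
  proof -
    have "m l \<le> \<Phi> l (xm k)" unfolding m_def using xm that by auto
    moreover have "\<bar>\<Phi> l (xm k) - \<Phi> k (xm k)\<bar> \<le> L * \<bar>l - k\<bar>"
      using \<Phi>L[OF that, of "xm k"] xm(1)[OF that(2)] \<delta> by auto
    ultimately show ?thesis by (simp add: m_def)
  qed
  have "L-lipschitz_on {lo..hi} m"
  proof (rule lipschitz_onI)
    fix l k assume "l \<in> {lo..hi}" "k \<in> {lo..hi}"
    then show "dist (m l) (m k) \<le> L * dist l k"
      using m1[of l k] m1[of k l] by (simp add: dist_real_def abs_le_iff abs_minus_commute)
  qed (rule L)
  then have mc: "continuous_on {lo..hi} m" by (rule lipschitz_on_continuous_on)
  have first_zero: "\<exists>t. \<delta> < t \<and> t \<le> pi \<and> \<Phi> l t = 0 \<and> (\<forall>x. 0 < x \<and> x < t \<longrightarrow> 0 < \<Phi> l x)"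
    if l: "l \<in> {lo..hi}" and "m l \<le> 0" for l
  proof -
    have "\<exists>x. \<delta> \<le> x \<and> x \<le> xm l \<and> \<Phi> l x = 0"
    proof (rule IVT2')
      show "\<Phi> l (xm l) \<le> 0" using that by (simp add: m_def)
      show "0 \<le> \<Phi> l \<delta>" using near0[OF l, of \<delta>] \<delta> by simp
      show "\<delta> \<le> xm l" using xm(1)[OF l] by simp
      show "continuous_on {\<delta>..xm l} (\<Phi> l)" using \<Phi>c[OF l] by (rule continuous_on_subset) (use xm(1)[OF l] in auto)
    qed
    then obtain x0 where x0: "x0 \<in> {\<delta>..pi}" "\<Phi> l x0 = 0" using xm(1)[OF l] by force
    define Z where "Z = {x \<in> {\<delta>..pi}. \<Phi> l x = 0}"
    have "closed Z" unfolding Z_def by (rule continuous_closed_preimage_constant[OF \<Phi>c[OF l]]) simp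
    moreover have "bounded Z" unfolding Z_def by (rule bounded_subset[OF bounded_closed_interval]) auto
    ultimately have "compact Z" by (simp add: compact_eq_bounded_closed)
    moreover have "Z \<noteq> {}" using x0 by (auto simp: Z_def)
    ultimately obtain t where t: "t \<in> Z" "\<And>x. x \<in> Z \<Longrightarrow> t \<le> x" using compact_attains_inf[of Z] by metis
    have t': "\<delta> \<le> t" "t \<le> pi" "\<Phi> l t = 0" using t(1) by (auto simp: Z_def)
    have "t \<noteq> \<delta>" using near0[OF l, of \<delta>] \<delta> t' by auto
    moreover have "0 < \<Phi> l x" if x: "0 < x" "x < t" for x
    proof (cases "x \<le> \<delta>")
      case False
      show ?thesis
      proof (rule ccontr)
        assume "\<not> 0 < \<Phi> l x"
        then have "\<exists>z. \<delta> \<le> z \<and> z \<le> x \<and> \<Phi> l z = 0"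
          using near0[OF l, of \<delta>] \<delta> False x t'
          by (intro IVT2' continuous_on_subset[OF \<Phi>c[OF l]]) auto
        then show False using t(2) x t' by (force simp: Z_def)
      qed
    qed (use near0[OF l] x in auto)
    ultimately show ?thesis using t' by (intro exI[of _ t]) auto
  qed
  have lo_in: "lo \<in> {lo..hi}" and hi_in: "hi \<in> {lo..hi}" using lohi by auto
  have "0 \<le> m lo"
  proof (rule ccontr)
    assume "\<not> 0 \<le> m lo"
    then obtain t where t: "\<delta> < t" "t \<le> pi" "\<Phi> lo t = 0" "\<And>x. 0 < x \<Longrightarrow> x < t \<Longrightarrow> 0 < \<Phi> lo x"
      using first_zero[OF lo_in] by force
    have nn: "0 \<le> \<Phi> lo x" if "0 \<le> x" "x \<le> t" for x
      using t(3) t(4)[of x] \<Phi>0[OF lo_in] that by (cases "x = 0 \<or> x = t") auto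
    have W1: "1 \<le> W lo x" if x: "0 \<le> x" "x \<le> t" for x
    proof -
      have "0 * (x - 0) \<le> W lo x - W lo 0"
      proof (rule lip_prim_lower[OF Wp[OF lo_in]])
        fix s assume "s \<in> {0..x}"
        then show "0 \<le> (b s - lo) * \<Phi> lo s"
          using b_bound[of s] x t nn[of s] by (intro mult_nonneg_nonneg) (auto simp: lo_def)
      qed (use x t in auto)
      then show ?thesis using W0[OF lo_in] by simp
    qed
    have "a0 * (t - 0) \<le> \<Phi> lo t - \<Phi> lo 0"
    proof (rule lip_prim_lower[OF \<Phi>p[OF lo_in]])
      fix s assume s: "s \<in> {0..t}"
      have "a0 * 1 \<le> a s * W lo s" using s t W1[of s] a_ge[of s] a_nonneg[of s] by (intro mult_mono) auto
      then show "a0 \<le> a s * W lo s" by simp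
    qed (use t \<delta> in auto)
    moreover have "0 < a0 * (t - 0)" using a0_pos t \<delta> by simp
    ultimately show False using t \<Phi>0[OF lo_in] by simp
  qed
  moreover have "m hi \<le> 0"
  proof (rule ccontr)
    assume neg: "\<not> m hi \<le> 0"
    have "(hi - B) * a0 * (pi / 4)\<^sup>2 \<le> 1"
    proof (rule no_positive_solution[OF \<Phi>p[OF hi_in] Wp[OF hi_in] \<Phi>0[OF hi_in] _ hiB])
      fix x assume x: "0 < x" "x \<le> pi"
      show "0 < \<Phi> hi x"
      proof (cases "x \<le> \<delta>")
        case False
        then show ?thesis using xm(2)[OF hi_in, of x] neg x by (auto simp: m_def)
      qed (use near0[OF hi_in] x in auto)
    qed
    moreover have "(hi - B) * a0 * (pi / 4)\<^sup>2 = 1 + a0 * (pi / 4)\<^sup>2"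
      using a0_pos by (simp add: hi_def distrib_right)
    ultimately show False using a0_pos by (simp add: mult_le_0_iff)
  qed
  ultimately obtain l where l: "lo \<le> l" "l \<le> hi" "m l = 0" using IVT2'[of m hi 0 lo] lohi mc by auto
  then have lin: "l \<in> {lo..hi}" by simp
  obtain t where t: "\<delta> < t" "t \<le> pi" "\<Phi> l t = 0" "\<And>x. 0 < x \<Longrightarrow> x < t \<Longrightarrow> 0 < \<Phi> l x"
    using first_zero[OF lin] l(3) by force
  have nn: "0 \<le> \<Phi> l x" if "0 \<le> x" "x \<le> pi" for x
  proof (cases "x = 0 \<or> x \<le> \<delta>")
    case True
    then show ?thesis using \<Phi>0[OF lin] near0[OF lin, of x] that by (cases "x = 0") auto
  next
    case False
    then show ?thesis using xm(2)[OF lin, of x] l(3) that by (auto simp: m_def)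
  qed
  \<comment> \<open>At an interior first zero the flux is nonzero, so \<Phi> would cross zero with
    nonzero slope and be negative on one side, against its nonnegativity.\<close>
  have "t = pi"
  proof (rule ccontr)
    assume "t \<noteq> pi"
    then have tpi: "0 < t" "t < pi" using t \<delta> by auto
    have Wt: "W l t \<noteq> 0"
      by (rule flux_nonzero_at_first_zero[OF \<Phi>p[OF lin] Wp[OF lin] _ t(2,4,3)]) (use tpi in auto)
    have "continuous_on {0..pi} (W l)" by (rule lip_prim_continuous[OF Wp[OF lin]])
    then have "\<exists>d>0. \<forall>x\<in>{0..pi}. dist x t < d \<longrightarrow> dist (W l x) (W l t) < \<bar>W l t\<bar> / 2"
      by (simp only: continuous_on_iff) (elim ballE[of _ _ t] allE[of _ "\<bar>W l t\<bar> / 2"], insert Wt tpi, auto)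
    then obtain d where d: "0 < d" "\<And>x. x \<in> {0..pi} \<Longrightarrow> dist x t < d \<Longrightarrow> dist (W l x) (W l t) < \<bar>W l t\<bar> / 2"
      by blast
    \<comment> \<open>Within this radius the flux keeps its sign and at least half its size, and t -
      e, t + e stay in [0, pi].\<close>
    define e where "e = min (d / 2) (min t (pi - t))"
    have e: "0 < e" "e < d" "0 \<le> t - e" "t + e \<le> pi" using d tpi by (auto simp: e_def min_def)
    have cl: "W l t - \<bar>W l t\<bar> / 2 < W l x" "W l x < W l t + \<bar>W l t\<bar> / 2" if x: "x \<in> {t - e..t + e}" for x
    proof -
      have "dist x t < d" using x e by (auto simp: dist_real_def abs_less_iff)
      then have "\<bar>W l x - W l t\<bar> < \<bar>W l t\<bar> / 2"
        using d(2)[of x] e x by (auto simp: dist_real_def)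
      then show "W l t - \<bar>W l t\<bar> / 2 < W l x" "W l x < W l t + \<bar>W l t\<bar> / 2"
        by (simp_all only: abs_diff_less_iff)
    qed
    have ae: "0 < a0 * \<bar>W l t\<bar> / 2 * e" using a0_pos Wt e by simp
    show False
    proof (cases "0 < W l t")
      case True
      have "(a0 * \<bar>W l t\<bar> / 2) * (t - (t - e)) \<le> \<Phi> l t - \<Phi> l (t - e)"
      proof (rule lip_prim_lower[OF \<Phi>p[OF lin]])
        fix s assume s: "s \<in> {t - e..t}"
        then have "\<bar>W l t\<bar> / 2 \<le> W l s" using cl[of s] True e by auto
        moreover have "s \<in> {0..pi}" using s e tpi by auto
        ultimately have "a0 * (\<bar>W l t\<bar> / 2) \<le> a s * W l s" using a_ge a_nonneg by (intro mult_mono) auto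
        then show "a0 * \<bar>W l t\<bar> / 2 \<le> a s * W l s" by simp
      qed (use e tpi in auto)
      then show False using ae t(3) nn[of "t - e"] e tpi by simp
    next
      case False
      have "\<Phi> l (t + e) - \<Phi> l t \<le> (- (a0 * \<bar>W l t\<bar> / 2)) * (t + e - t)"
      proof (rule lip_prim_upper[OF \<Phi>p[OF lin]])
        fix s assume s: "s \<in> {t..t + e}"
        then have "\<bar>W l t\<bar> / 2 \<le> - W l s" using cl[of s] False e by auto
        moreover have "s \<in> {0..pi}" using s e tpi by auto
        ultimately have "a0 * (\<bar>W l t\<bar> / 2) \<le> a s * (- W l s)" using a_ge a_nonneg by (intro mult_mono) auto
        then show "a s * W l s \<le> - (a0 * \<bar>W l t\<bar> / 2)" by simp
      qed (use e tpi in auto)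
      then show False using ae t(3) nn[of "t + e"] e tpi by simp
    qed
  qed
  with t show ?thesis
    by (intro that[OF \<Phi>p[OF lin] Wp[OF lin] \<Phi>0[OF lin] _ W0[OF lin]]) auto
qed

end

section \<open>The conserved functional\<close>

lemma L2_norm_triangle:
  assumes f: "f \<in> L2 M" and g: "g \<in> L2 M"
  shows "L2_norm M f \<le> L2_norm M (\<lambda>x. f x - g x) + L2_norm M g"
proof -
  let ?h = "\<lambda>x. f x - g x"
  have h: "?h \<in> L2 M" by (rule L2_diff[OF f g])
  have sq: "(L2_norm M u)\<^sup>2 = (LINT x|M. (u x)\<^sup>2)" for u by (simp add: L2_norm_def)
  have nn: "0 \<le> L2_norm M u" for u by (simp add: L2_norm_def)
  have "(LINT x|M. (f x)\<^sup>2) = (LINT x|M. (?h x)\<^sup>2 + 2 * (?h x * g x) + (g x)\<^sup>2)"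
    by (rule Bochner_Integration.integral_cong) (auto simp: power2_eq_square algebra_simps)
  also have "\<dots> = (L2_norm M ?h)\<^sup>2 + 2 * (LINT x|M. ?h x * g x) + (L2_norm M g)\<^sup>2"
    using L2_times_integrable[OF h g] h g by (simp add: sq L2_def)
  also have "\<dots> \<le> (L2_norm M ?h)\<^sup>2 + 2 * (L2_norm M ?h * L2_norm M g) + (L2_norm M g)\<^sup>2"
    using Cauchy_Schwarz_L2[OF h g] by (simp add: abs_le_iff)
  also have "\<dots> = (L2_norm M ?h + L2_norm M g)\<^sup>2" by (simp add: power2_sum)
  finally have "(L2_norm M f)\<^sup>2 \<le> (L2_norm M ?h + L2_norm M g)\<^sup>2" by (simp only: sq)
  then show ?thesis by (rule power2_le_imp_le) (simp add: nn)
qed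

lemma L2_norm_minus_commute: "L2_norm M (\<lambda>x. f x - g x) = L2_norm M (\<lambda>x. g x - f x)"
  by (simp add: L2_norm_def power2_commute)

section \<open>Pairings of continuous curves in L2 with a fixed function\<close>

lemma L2_continuous_curve_bounded:
  assumes y: "L2_continuous_curve T y"
  obtains N where "\<And>s. s \<in> {0..T} \<Longrightarrow> L2_norm itv_measure (y s) \<le> N"
proof -
  let ?n = "L2_norm itv_measure"
  have L: "y s \<in> L2 itv_measure" if "s \<in> {0..T}" for s
    using y that by (auto simp: L2_continuous_curve_def)
  have "continuous_on {0..T} (\<lambda>s. ?n (y s))"
    unfolding continuous_on_def
  proof
    fix t assume t: "t \<in> {0..T}"
    have "((\<lambda>s. ?n (y s) - ?n (y t)) \<longlongrightarrow> 0) (at t within {0..T})"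
    proof (rule Lim_null_comparison)
      show "((\<lambda>s. ?n (\<lambda>x. y s x - y t x)) \<longlongrightarrow> 0) (at t within {0..T})"
        using y t by (auto simp: L2_continuous_curve_def)
      show "\<forall>\<^sub>F s in at t within {0..T}. norm (?n (y s) - ?n (y t)) \<le> ?n (\<lambda>x. y s x - y t x)"
        unfolding eventually_at_filter
      proof (intro always_eventually allI impI)
        fix s assume s: "s \<in> {0..T}"
        show "norm (?n (y s) - ?n (y t)) \<le> ?n (\<lambda>x. y s x - y t x)"
          using L2_norm_triangle[OF L[OF s] L[OF t]] L2_norm_triangle[OF L[OF t] L[OF s]]
          by (simp add: L2_norm_minus_commute[of _ "y t" "y s"] abs_le_iff)
      qed
    qed
    then show "((\<lambda>s. ?n (y s)) \<longlongrightarrow> ?n (y t)) (at t within {0..T})" by (simp only: LIM_zero_iff)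
  qed
  then obtain N where "\<And>s. s \<in> {0..T} \<Longrightarrow> \<bar>?n (y s)\<bar> \<le> N" using continuous_bounded_Icc by metis
  then show ?thesis by (intro that[of N]) (meson abs_le_D1)
qed

lemma L2_continuous_curve_pairing_continuous:
  assumes y: "L2_continuous_curve T y" and f: "f \<in> L2 itv_measure"
  shows "continuous_on {0..T} (\<lambda>s. LINT x|itv_measure. y s x * f x)"
  unfolding continuous_on_def
proof
  fix t assume t: "t \<in> {0..T}"
  have L: "y s \<in> L2 itv_measure" if "s \<in> {0..T}" for s
    using y that by (auto simp: L2_continuous_curve_def)
  let ?c = "\<lambda>s. LINT x|itv_measure. y s x * f x"
  have "((\<lambda>s. ?c s - ?c t) \<longlongrightarrow> 0) (at t within {0..T})"
  proof (rule Lim_null_comparison)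
    have "((\<lambda>s. L2_norm itv_measure (\<lambda>x. y s x - y t x)) \<longlongrightarrow> 0) (at t within {0..T})"
      using y t by (auto simp: L2_continuous_curve_def)
    then show "((\<lambda>s. L2_norm itv_measure (\<lambda>x. y s x - y t x) * L2_norm itv_measure f) \<longlongrightarrow> 0) (at t within {0..T})"
      by (rule tendsto_mult_left_zero)
    show "\<forall>\<^sub>F s in at t within {0..T}. norm (?c s - ?c t) \<le>
        L2_norm itv_measure (\<lambda>x. y s x - y t x) * L2_norm itv_measure f"
      unfolding eventually_at_filter
    proof (intro always_eventually allI impI)
      fix s assume s: "s \<in> {0..T}"
      have "?c s - ?c t = (LINT x|itv_measure. (y s x - y t x) * f x)"
        using L2_times_integrable[OF L[OF s] f] L2_times_integrable[OF L[OF t] f] by (simp add: left_diff_distrib)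
      then show "norm (?c s - ?c t) \<le> L2_norm itv_measure (\<lambda>x. y s x - y t x) * L2_norm itv_measure f"
        using Cauchy_Schwarz_L2[OF L2_diff[OF L[OF s] L[OF t]] f] by simp
    qed
  qed
  then show "(?c \<longlongrightarrow> ?c t) (at t within {0..T})" by (simp only: LIM_zero_iff)
qed

lemma L2_abs: "f \<in> L2 M \<Longrightarrow> (\<lambda>x. \<bar>f x\<bar>) \<in> L2 M"
  by (auto simp: L2_def)

lemma L2_norm_abs: "L2_norm M (\<lambda>x. \<bar>f x\<bar>) = L2_norm M f"
  by (simp add: L2_norm_def)

text \<open>Fubini on the cylinder; the uniform bound on the norms of the curve together with
  Cauchy-Schwarz supplies integrability.\<close>

lemma integral_time_integral:
  assumes y: "L2_continuous_curve T y" and f: "f \<in> L2 itv_measure" and t: "t \<in> {0..T}"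
  shows "(LINT x|itv_measure. time_integral y t x * f x) =
    integral {0..t} (\<lambda>s. LINT x|itv_measure. y s x * f x)"
proof -
  let ?T = "lebesgue_on {0<..<T}"
  interpret T: finite_measure ?T by (rule finite_measure_Ioo)
  interpret pair_sigma_finite ?T itv_measure
    by (simp add: pair_sigma_finite_def itv.sigma_finite_measure_axioms T.sigma_finite_measure_axioms)
  have L: "y s \<in> L2 itv_measure" if "s \<in> {0..T}" for s
    using y that by (auto simp: L2_continuous_curve_def)
  obtain N where N: "\<And>s. s \<in> {0..T} \<Longrightarrow> L2_norm itv_measure (y s) \<le> N"
    using L2_continuous_curve_bounded[OF y] by metis
  define c where "c s = (LINT x|itv_measure. y s x * f x)" for s
  \<comment> \<open>The cut-off at \<open>t\<close> is put into the integrand, so that all times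
    share one product measure.\<close>
  define h where "h s x = indicator {0<..<t} s * y s x * f x" for s x
  have [measurable]: "(\<lambda>s. s) \<in> ?T \<rightarrow>\<^sub>M borel"
    using id_borel_measurable_lebesgue_on[of "{0<..<T}"] by (simp add: id_def)
  have [measurable]: "(\<lambda>(s, x). y s x) \<in> borel_measurable (cyl_measure T)"
    using y by (simp add: L2_continuous_curve_def)
  have [measurable]: "f \<in> borel_measurable itv_measure" using f by (simp add: L2_def)
  have hm[measurable]: "case_prod h \<in> borel_measurable (cyl_measure T)"
  proof -
    have "(\<lambda>z. indicator {0<..<t} (fst z) * (case z of (s, x) \<Rightarrow> y s x) * f (snd z)) \<in> borel_measurable (cyl_measure T)"
      by measurable
    then show ?thesis by (simp add: h_def case_prod_beta')
  qed
  have H: "integrable (cyl_measure T) (case_prod h)"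
  proof (rule Fubini_integrable[OF hm])
    show "integrable ?T (\<lambda>s. LINT x|itv_measure. norm (case_prod h (s, x)))"
    proof (rule T.integrable_const_bound[where B = "N * L2_norm itv_measure f"])
      show "(\<lambda>s. LINT x|itv_measure. norm (case_prod h (s, x))) \<in> borel_measurable ?T" by measurable
      show "AE s in ?T. norm (LINT x|itv_measure. norm (case_prod h (s, x))) \<le> N * L2_norm itv_measure f"
      proof (rule AE_I2)
        fix s assume "s \<in> space ?T"
        then have s: "s \<in> {0..T}" by auto
        have "norm (LINT x|itv_measure. norm (case_prod h (s, x))) = (LINT x|itv_measure. norm (case_prod h (s, x)))"
          by simp
        also have "\<dots> \<le> (LINT x|itv_measure. \<bar>y s x\<bar> * \<bar>f x\<bar>)"
          by (rule integral_mono_AE')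
            (use L2_times_integrable[OF L2_abs[OF L[OF s]] L2_abs[OF f]] in
              \<open>auto simp: h_def abs_mult split: split_indicator\<close>)
        also have "\<dots> \<le> L2_norm itv_measure (y s) * L2_norm itv_measure f"
          using Cauchy_Schwarz_L2[OF L2_abs[OF L[OF s]] L2_abs[OF f]] by (simp add: L2_norm_abs)
        also have "\<dots> \<le> N * L2_norm itv_measure f"
          using N[OF s] by (intro mult_right_mono) (auto simp: L2_norm_def)
        finally show "norm (LINT x|itv_measure. norm (case_prod h (s, x))) \<le> N * L2_norm itv_measure f" .
      qed
    qed
    show "AE s in ?T. integrable itv_measure (\<lambda>x. case_prod h (s, x))"
    proof (rule AE_I2)
      fix s assume "s \<in> space ?T"
      then have s: "s \<in> {0..T}" by auto
      show "integrable itv_measure (\<lambda>x. case_prod h (s, x))"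
        using L2_times_integrable[OF L[OF s] f] by (simp add: h_def mult.assoc)
    qed
  qed
  have 1: "(LINT s|?T. h s x) = time_integral y t x * f x" for x
  proof -
    have "(LINT s|?T. indicator {0<..<t} s * y s x) = time_integral y t x"
      unfolding time_integral_def using t
      by (subst (1 2) integral_restrict_space)
        (auto intro!: Bochner_Integration.integral_cong split: split_indicator)
    then show ?thesis by (simp add: h_def)
  qed
  have cc: "continuous_on {0..t} c"
    unfolding c_def by (rule continuous_on_subset[OF L2_continuous_curve_pairing_continuous[OF y f]]) (use t in auto)
  have 2: "(LINT s|?T. (LINT x|itv_measure. h s x)) = integral {0..t} c"
  proof -
    have "(LINT x|itv_measure. h s x) = indicator {0<..<t} s * c s" for s
      by (simp add: h_def c_def mult.assoc)
    then have "(LINT s|?T. (LINT x|itv_measure. h s x)) = (LINT s|lebesgue_on {0<..<t}. c s)"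
      using t by (simp, subst (1 2) integral_restrict_space)
        (auto intro!: Bochner_Integration.integral_cong split: split_indicator)
    also have "\<dots> = integral {0<..<t} c"
    proof (rule lebesgue_integral_eq_integral)
      have "set_integrable lebesgue {0..t} c" by (rule absolutely_integrable_continuous_real[OF cc])
      then have "set_integrable lebesgue {0<..<t} c" by (rule set_integrable_subset) auto
      then show "integrable (lebesgue_on {0<..<t}) c"
        by (simp add: integrable_restrict_space set_integrable_def)
    qed simp
    also have "\<dots> = integral {0..t} c" using integral_open_interval[of 0 t c] by simp
    finally show ?thesis .
  qed
  have "(LINT x|itv_measure. (LINT s|?T. h s x)) = (LINT s|?T. (LINT x|itv_measure. h s x))"
    by (rule Fubini_integral[OF H])
  then show ?thesis unfolding 1 2 by (simp add: c_def[abs_def])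
qed

text \<open>The integral \<open>A\<close> of \<open>a\<close> is differentiable and satisfies A' = -
  l A, so e^(l t) A is constant and zero.\<close>

lemma linear_Volterra_trivial:
  fixes a :: "real \<Rightarrow> real"
  assumes a: "continuous_on {0..T} a" and T: "0 \<le> T"
    and eq: "\<And>t. t \<in> {0..T} \<Longrightarrow> a t = - l * integral {0..t} a"
  shows "a T = 0"
proof -
  define A where "A t = integral {0..t} a" for t
  have D: "((\<lambda>t. A t * exp (l * t)) has_real_derivative 0) (at t within {0..T})" if t: "t \<in> {0..T}" for t
  proof -
    have "(A has_real_derivative a t) (at t within {0..T})"
      unfolding A_def[abs_def] by (rule integral_has_real_derivative[OF a t])
    moreover have "((\<lambda>t. exp (l * t)) has_real_derivative (exp (l * t) * l)) (at t within {0..T})"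
      by (auto intro!: derivative_eq_intros)
    ultimately have "((\<lambda>t. A t * exp (l * t)) has_real_derivative
        a t * exp (l * t) + (exp (l * t) * l) * A t) (at t within {0..T})"
      by (rule DERIV_mult)
    then show ?thesis using eq[OF t] by (simp add: A_def algebra_simps)
  qed
  obtain c where c: "\<And>t. t \<in> {0..T} \<Longrightarrow> A t * exp (l * t) = c"
    using has_field_derivative_zero_constant[of "{0..T}" "\<lambda>t. A t * exp (l * t)"] D by auto
  have "A T * exp (l * T) = A 0 * exp (l * 0)" using c[of T] c[of 0] T by simp
  then have "A T = 0" by (simp add: A_def)
  then show ?thesis using eq[of T] T by (simp add: A_def)
qed

text \<open>The adjoint eigenvector \<open>(g, f)\<close> is invisible to a control acting on \<open>\<omega>\<close>, where \<open>g\<close> vanishes.\<close>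

lemma conserved_functional:
  assumes T: "0 < T" and sol: "is_solution T \<gamma> \<gamma>0 p \<omega> v (\<lambda>_. 0) (\<lambda>_. 0) y1 y2"
    and f: "f \<in> L_infty itv_measure" and g: "g \<in> L_infty itv_measure" and p: "p \<in> L_infty itv_measure"
    and g0: "\<And>x. x \<in> \<omega> \<Longrightarrow> g x = 0"
    and dual: "\<And>u1 u2. u1 \<in> Lop_domain \<gamma> \<gamma>0 \<Longrightarrow> u2 \<in> Lop_domain \<gamma> \<gamma>0 \<Longrightarrow>
      (LINT x|itv_measure. Lop \<gamma> \<gamma>0 u2 x * f x) + (LINT x|itv_measure. Lop \<gamma> \<gamma>0 u1 x * g x) +
      (LINT x|itv_measure. p x * weak_deriv u1 x * f x) =
      l * ((LINT x|itv_measure. u2 x * f x) + (LINT x|itv_measure. u1 x * g x))"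
  shows "(LINT x|itv_measure. y2 T x * f x) + (LINT x|itv_measure. y1 T x * g x) = 0"
proof -
  define a where "a t = (LINT x|itv_measure. y2 t x * f x) + (LINT x|itv_measure. y1 t x * g x)" for t
  note fL = L_infty_L2_itv[OF f] and gL = L_infty_L2_itv[OF g]
  have y: "L2_continuous_curve T y1" "L2_continuous_curve T y2"
    using sol by (auto simp: is_solution_def)
  note c = L2_continuous_curve_pairing_continuous[OF y(2) fL] L2_continuous_curve_pairing_continuous[OF y(1) gL]
  have "a T = 0"
  proof (rule linear_Volterra_trivial[where a = a and T = T and l = l])
    show "continuous_on {0..T} a" unfolding a_def by (intro continuous_on_add c)
    fix t assume t: "t \<in> {0..T}"
    define Y1 Y2 where "Y1 = time_integral y1 t" and "Y2 = time_integral y2 t"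
    have D: "Y1 \<in> Lop_domain \<gamma> \<gamma>0" "Y2 \<in> Lop_domain \<gamma> \<gamma>0"
      and e1: "AE x in itv_measure. y1 t x + Lop \<gamma> \<gamma>0 Y1 x = indicator \<omega> x * time_integral v t x"
      and e2: "AE x in itv_measure. y2 t x + Lop \<gamma> \<gamma>0 Y2 x = - p x * weak_deriv Y1 x"
      using sol t by (auto simp: is_solution_def Y1_def Y2_def)
    have L: "y1 t \<in> L2 itv_measure" "y2 t \<in> L2 itv_measure" using y t by (auto simp: L2_continuous_curve_def)
    have LL: "Lop \<gamma> \<gamma>0 Y1 \<in> L2 itv_measure" "Lop \<gamma> \<gamma>0 Y2 \<in> L2 itv_measure"
      and W: "weak_deriv Y1 \<in> L2 itv_measure"
      using D by (auto simp: Lop_domain_def H10_def H1_def)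
    note pW = L_infty_times_L2[OF p W]
    note i = L2_times_integrable[OF L(1) gL] L2_times_integrable[OF L(2) fL]
      L2_times_integrable[OF LL(1) gL] L2_times_integrable[OF LL(2) fL] L2_times_integrable[OF pW fL]
    \<comment> \<open>On \<omega> the factor \<open>g\<close> vanishes and off \<omega> the
      indicator does, so the control drops out of the tested equation.\<close>
    have "(LINT x|itv_measure. y1 t x * g x + Lop \<gamma> \<gamma>0 Y1 x * g x) = 0"
    proof (rule integral_eq_zero_AE)
      show "AE x in itv_measure. y1 t x * g x + Lop \<gamma> \<gamma>0 Y1 x * g x = 0"
        using e1
      proof eventually_elim
        case (elim x)
        have "y1 t x * g x + Lop \<gamma> \<gamma>0 Y1 x * g x = (y1 t x + Lop \<gamma> \<gamma>0 Y1 x) * g x" by (simp add: distrib_right)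
        then show ?case using g0[of x] unfolding elim by (cases "x \<in> \<omega>") auto
      qed
    qed
    moreover have "(LINT x|itv_measure. y2 t x * f x + Lop \<gamma> \<gamma>0 Y2 x * f x + p x * weak_deriv Y1 x * f x) = 0"
    proof (rule integral_eq_zero_AE)
      show "AE x in itv_measure. y2 t x * f x + Lop \<gamma> \<gamma>0 Y2 x * f x + p x * weak_deriv Y1 x * f x = 0"
        using e2
      proof eventually_elim
        case (elim x)
        have "y2 t x * f x + Lop \<gamma> \<gamma>0 Y2 x * f x = (y2 t x + Lop \<gamma> \<gamma>0 Y2 x) * f x" by (simp add: distrib_right)
        then show ?case unfolding elim by simp
      qed
    qed
    ultimately have "a t + ((LINT x|itv_measure. Lop \<gamma> \<gamma>0 Y2 x * f x) + (LINT x|itv_measure. Lop \<gamma> \<gamma>0 Y1 x * g x) +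
        (LINT x|itv_measure. p x * weak_deriv Y1 x * f x)) = 0"
      using i by (simp add: a_def)
    then have "a t = - l * ((LINT x|itv_measure. Y2 x * f x) + (LINT x|itv_measure. Y1 x * g x))"
      unfolding dual[OF D] by simp
    \<comment> \<open>Pairing with the time-integrated state equals the time integral of the
      pairing, which closes the equation for \<open>a\<close>.\<close>
    also have "(LINT x|itv_measure. Y2 x * f x) + (LINT x|itv_measure. Y1 x * g x) = integral {0..t} a"
    proof -
      have "integral {0..t} a = integral {0..t} (\<lambda>s. LINT x|itv_measure. y2 s x * f x) +
          integral {0..t} (\<lambda>s. LINT x|itv_measure. y1 s x * g x)"
        unfolding a_def
        by (intro Henstock_Kurzweil_Integration.integral_add integrable_continuous_real)
          (rule continuous_on_subset[OF c(1)] continuous_on_subset[OF c(2)], use t in auto)+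
      then show ?thesis
        using integral_time_integral[OF y(2) fL t] integral_time_integral[OF y(1) gL t] by (simp add: Y1_def Y2_def)
    qed
    finally show "a t = - l * integral {0..t} a" .
  qed (use T in auto)
  then show ?thesis by (simp add: a_def)
qed

text \<open>From initial state zero, every reachable state is orthogonal to (g, f). The target (0,
  f) pairs with it to the integral of f^2, hence it has positive distance from the reachable
  states.\<close>

lemma not_approx_controllable_if_adjoint_eigenvector:
  assumes T: "0 < T"
    and f: "f \<in> L_infty itv_measure" and g: "g \<in> L_infty itv_measure" and p: "p \<in> L_infty itv_measure"
    and g0: "\<And>x. x \<in> \<omega> \<Longrightarrow> g x = 0" and f0: "0 < (LINT x|itv_measure. (f x)\<^sup>2)"
    and dual: "\<And>u1 u2. u1 \<in> Lop_domain \<gamma> \<gamma>0 \<Longrightarrow> u2 \<in> Lop_domain \<gamma> \<gamma>0 \<Longrightarrow>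
      (LINT x|itv_measure. Lop \<gamma> \<gamma>0 u2 x * f x) + (LINT x|itv_measure. Lop \<gamma> \<gamma>0 u1 x * g x) +
      (LINT x|itv_measure. p x * weak_deriv u1 x * f x) =
      l * ((LINT x|itv_measure. u2 x * f x) + (LINT x|itv_measure. u1 x * g x))"
  shows "\<not> approx_controllable T \<gamma> \<gamma>0 p \<omega>"
proof
  assume ac: "approx_controllable T \<gamma> \<gamma>0 p \<omega>"
  let ?n = "L2_norm itv_measure"
  note fL = L_infty_L2_itv[OF f] and gL = L_infty_L2_itv[OF g]
  have z: "(\<lambda>_. 0) \<in> L2 itv_measure" by (simp add: L2_def)
  define Q where "Q = (LINT x|itv_measure. (f x)\<^sup>2)"
  have nn: "0 \<le> ?n u" for u by (simp add: L2_norm_def)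
  \<comment> \<open>Cauchy-Schwarz bounds the pairing defect by \<epsilon> times the sum of both
    norms, here at most Q/2; the summand 1 keeps the denominator positive.\<close>
  define \<epsilon> where "\<epsilon> = Q / (2 * (?n f + ?n g + 1))"
  have \<epsilon>: "0 < \<epsilon>" using f0 nn[of f] nn[of g] by (simp add: \<epsilon>_def Q_def)
  obtain v y1 y2 where sol: "is_solution T \<gamma> \<gamma>0 p \<omega> v (\<lambda>_. 0) (\<lambda>_. 0) y1 y2"
    and close: "sqrt ((?n (\<lambda>x. y1 T x - 0))\<^sup>2 + (?n (\<lambda>x. y2 T x - f x))\<^sup>2) \<le> \<epsilon>"
    using ac[unfolded approx_controllable_def, rule_format, OF \<epsilon> z z z fL] by blast
  have L: "y1 T \<in> L2 itv_measure" "y2 T \<in> L2 itv_measure"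
    using sol T by (auto simp: is_solution_def L2_continuous_curve_def)
  have close': "sqrt ((?n (y1 T))\<^sup>2 + (?n (\<lambda>x. y2 T x - f x))\<^sup>2) \<le> \<epsilon>"
    using close by simp
  note n1 = order_trans[OF real_sqrt_sum_squares_ge1 close'] and n2 = order_trans[OF real_sqrt_sum_squares_ge2 close']
  have "(LINT x|itv_measure. y2 T x * f x) + (LINT x|itv_measure. y1 T x * g x) = 0"
    by (rule conserved_functional[OF T sol f g p g0 dual])
  moreover have "(LINT x|itv_measure. (y2 T x - f x) * f x) = (LINT x|itv_measure. y2 T x * f x) - Q"
    using L2_times_integrable[OF L(2) fL] L2_times_integrable[OF fL fL]
    by (simp add: left_diff_distrib Q_def power2_eq_square)
  ultimately have "Q \<le> \<bar>LINT x|itv_measure. (y2 T x - f x) * f x\<bar> + \<bar>LINT x|itv_measure. y1 T x * g x\<bar>"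
    by linarith
  also have "\<dots> \<le> \<epsilon> * ?n f + \<epsilon> * ?n g"
    using Cauchy_Schwarz_L2[OF L2_diff[OF L(2) fL] fL] Cauchy_Schwarz_L2[OF L(1) gL]
      mult_right_mono[OF n2 nn[of f]] mult_right_mono[OF n1 nn[of g]] by linarith
  also have "\<dots> \<le> \<epsilon> * (?n f + ?n g + 1)" using \<epsilon> by (simp add: distrib_left)
  also have "\<dots> = Q / 2" using nn[of f] nn[of g] by (simp add: \<epsilon>_def add_nonneg_eq_0_iff field_simps)
  finally show False using f0 by (simp add: Q_def)
qed

section \<open>The multiplier\<close>

lemma lip_prim_const_on:
  assumes "lip_prim 0 pi f g" "\<And>s. s \<in> {x..y} \<Longrightarrow> g s = 0" "0 \<le> x" "x \<le> y" "y \<le> pi"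
  shows "f y = f x"
  using lip_prim_abs_le[OF assms(1,3-5), of 0] assms(2) by auto

context sturm_liouville
begin

text \<open>With a h of integral 1, \<eta> climbs from 0 to 1 across the bump and \<open>M\<close>
  from 0 to \<mu>, the mean of \<open>W\<close> for the density a h.\<close>

definition unit_bump where
  "unit_bump W \<alpha> \<beta> h h' \<eta> M \<mu> \<longleftrightarrow> lip_prim 0 pi h h' \<and> lip_prim 0 pi \<eta> (\<lambda>x. a x * h x) \<and>
    lip_prim 0 pi M (\<lambda>x. a x * W x * h x) \<and> (\<forall>x. x \<notin> {\<alpha><..<\<beta>} \<longrightarrow> h x = 0) \<and>
    (\<forall>x. 0 \<le> x \<longrightarrow> x \<le> \<alpha> \<longrightarrow> \<eta> x = 0 \<and> M x = 0) \<and> (\<forall>x. \<beta> \<le> x \<longrightarrow> x \<le> pi \<longrightarrow> \<eta> x = 1 \<and> M x = \<mu>)"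

text \<open>A smooth bump is divided by its integral against \<open>a\<close>. As \<mu> is then a
  mean of \<open>W\<close> over the support of the bump, it obeys the bounds that \<open>W\<close>
  has there.\<close>

lemma unit_bump_exists:
  assumes \<alpha>\<beta>: "0 < \<alpha>" "\<alpha> < \<beta>" "\<beta> < pi" and W: "continuous_on {0..pi} W"
    and c: "\<And>x. x \<in> {\<alpha><..<\<beta>} \<Longrightarrow> c1 \<le> W x" "\<And>x. x \<in> {\<alpha><..<\<beta>} \<Longrightarrow> W x \<le> c2"
  shows "\<exists>h h' \<eta> M \<mu>. unit_bump W \<alpha> \<beta> h h' \<eta> M \<mu> \<and> c1 \<le> \<mu> \<and> \<mu> \<le> c2"
proof -
  define h0 where "h0 = bump 1 \<alpha> \<beta>"
  have t: "h0 \<in> test_functions" unfolding h0_def using \<alpha>\<beta> by (intro bump_test_function) auto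
  have h0: "lip_prim 0 pi h0 (deriv h0)"
    by (rule lip_prim_C1[OF test_function_DERIV[OF t] test_function_continuous[OF deriv_test_function[OF t]]])
  have h00: "h0 x = 0" if "x \<notin> {\<alpha><..<\<beta>}" for x using that by (simp add: h0_def bump_eq_0)
  have h0n: "0 \<le> h0 x" "h0 x \<le> 1" for x by (auto simp: h0_def bump_nonneg bump_le_1)
  have h0m: "h0 \<in> borel_measurable (lebesgue_on {0..pi})"
    by (rule continuous_measurable_Icc[OF test_function_continuous[OF t]])
  define E where "E x = 0 + integral {0..x} (\<lambda>s. a s * h0 s)" for x
  have E: "lip_prim 0 pi E (\<lambda>s. a s * h0 s)"
    unfolding E_def
  proof (rule lip_primI)
    show "(\<lambda>s. a s * h0 s) \<in> borel_measurable (lebesgue_on {0..pi})" using a_measurable h0m by simp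
    show "\<bar>a s * h0 s\<bar> \<le> a1 * 1" if "s \<in> {0..pi}" for s
      unfolding abs_mult using abs_a_le[OF that] h0n[of s] a1_pos by (intro mult_mono) auto
  qed simp
  define I where "I = E pi"
  \<comment> \<open>On the middle third of the interval the bump has a positive minimum and
    \<open>a\<close> is at least \<open>a0\<close>.\<close>
  have "0 < I"
  proof -
    define \<alpha>' \<beta>' where "\<alpha>' = (2 * \<alpha> + \<beta>) / 3" and "\<beta>' = (\<alpha> + 2 * \<beta>) / 3"
    have o: "\<alpha> < \<alpha>'" "\<alpha>' < \<beta>'" "\<beta>' < \<beta>" using \<alpha>\<beta> by (auto simp: \<alpha>'_def \<beta>'_def)
    have inc: "E x \<le> E y" if "0 \<le> x" "x \<le> y" "y \<le> pi" for x y
      using lip_prim_lower[OF E that, of 0] a_nonneg h0n that by auto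
    obtain m where m: "m \<in> {\<alpha>'..\<beta>'}" "\<And>x. x \<in> {\<alpha>'..\<beta>'} \<Longrightarrow> h0 m \<le> h0 x"
      using continuous_attains_inf[of "{\<alpha>'..\<beta>'}" h0] test_function_continuous[OF t] o by auto
    have hm: "0 < h0 m" unfolding h0_def by (rule bump_pos) (use m o in auto)
    have "(a0 * h0 m) * (\<beta>' - \<alpha>') \<le> E \<beta>' - E \<alpha>'"
    proof (rule lip_prim_lower[OF E])
      fix s assume "s \<in> {\<alpha>'..\<beta>'}"
      then show "a0 * h0 m \<le> a s * h0 s"
        using m(2)[of s] hm a_ge[of s] a_nonneg[of s] o \<alpha>\<beta> by (intro mult_mono) auto
    qed (use o \<alpha>\<beta> in auto)
    moreover have "0 < (a0 * h0 m) * (\<beta>' - \<alpha>')" using a0_pos hm o by simp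
    moreover have "E 0 \<le> E \<alpha>'" "E \<beta>' \<le> E pi" using o \<alpha>\<beta> by (auto intro!: inc)
    moreover have "E 0 = 0" by (simp add: E_def)
    ultimately show ?thesis by (simp add: I_def)
  qed
  define h where "h x = (1 / I) * h0 x" for x
  define \<eta> where "\<eta> x = (1 / I) * E x" for x
  have h: "lip_prim 0 pi h (\<lambda>x. (1 / I) * deriv h0 x)" unfolding h_def by (rule lip_prim_cmult[OF h0])
  have \<eta>: "lip_prim 0 pi \<eta> (\<lambda>x. a x * h x)"
    using lip_prim_cmult[OF E, of "1 / I"] by (simp add: h_def \<eta>_def[abs_def] mult.left_commute)
  have hz: "h x = 0" if "x \<notin> {\<alpha><..<\<beta>}" for x using h00[OF that] by (simp add: h_def)
  have hn: "0 \<le> h x" for x using h0n \<open>0 < I\<close> by (simp add: h_def)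
  define M where "M x = 0 + integral {0..x} (\<lambda>s. a s * W s * h s)" for x
  obtain N where N: "0 \<le> N" "\<And>x. x \<in> {0..pi} \<Longrightarrow> \<bar>W x\<bar> \<le> N" using continuous_bounded_Icc[OF W] by metis
  obtain K where K: "0 \<le> K" "\<And>x. x \<in> {0..pi} \<Longrightarrow> \<bar>h x\<bar> \<le> K"
    using continuous_bounded_Icc[OF lip_prim_continuous[OF h]] by metis
  have M: "lip_prim 0 pi M (\<lambda>s. a s * W s * h s)"
    unfolding M_def
  proof (rule lip_primI)
    show "(\<lambda>s. a s * W s * h s) \<in> borel_measurable (lebesgue_on {0..pi})"
      using a_measurable continuous_measurable_Icc[OF W] continuous_measurable_Icc[OF lip_prim_continuous[OF h]] by simp
    show "\<bar>a s * W s * h s\<bar> \<le> a1 * N * K" if "s \<in> {0..pi}" for s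
      unfolding abs_mult using abs_a_le[OF that] N(1) N(2)[OF that] K(1) K(2)[OF that] a1_pos by (intro mult_mono) auto
  qed simp
  have z: "\<eta> 0 = 0" "M 0 = 0" by (simp_all add: \<eta>_def E_def M_def)
  have ep: "\<eta> pi = 1" using \<open>0 < I\<close> by (simp add: \<eta>_def I_def)
  have i1: "((\<lambda>x. k * (a x * h x)) has_integral k) {0..pi}" for k
    using has_integral_mult_right[OF lip_prim_has_integral_from_0[OF \<eta> z(1), of pi], of k] ep by simp
  have i2: "((\<lambda>s. a s * W s * h s) has_integral M pi) {0..pi}"
    using lip_prim_has_integral_from_0[OF M z(2), of pi] by simp
  have "unit_bump W \<alpha> \<beta> h (\<lambda>x. (1 / I) * deriv h0 x) \<eta> M (M pi)"
    unfolding unit_bump_def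
  proof (intro conjI allI impI h \<eta> M hz)
    fix x assume x: "0 \<le> x" "x \<le> \<alpha>"
    show "\<eta> x = 0" using lip_prim_const_on[OF \<eta>, of 0 x] x \<alpha>\<beta> hz z by auto
    show "M x = 0" using lip_prim_const_on[OF M, of 0 x] x \<alpha>\<beta> hz z by auto
  next
    fix x assume x: "\<beta> \<le> x" "x \<le> pi"
    show "\<eta> x = 1" using lip_prim_const_on[OF \<eta>, of x pi] x \<alpha>\<beta> hz ep by auto
    show "M x = M pi" using lip_prim_const_on[OF M, of x pi] x \<alpha>\<beta> hz by auto
  qed
  moreover have "c1 \<le> M pi"
  proof (rule has_integral_le[OF i1 i2])
    fix x assume x: "x \<in> {0..pi}"
    show "c1 * (a x * h x) \<le> a x * W x * h x"
    proof (cases "x \<in> {\<alpha><..<\<beta>}")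
      case True
      have "c1 * (a x * h x) \<le> W x * (a x * h x)"
        using c(1)[OF True] a_nonneg[OF x] hn[of x] by (intro mult_right_mono) auto
      then show ?thesis by (simp add: ac_simps)
    qed (simp add: hz)
  qed
  moreover have "M pi \<le> c2"
  proof (rule has_integral_le[OF i2 i1])
    fix x assume x: "x \<in> {0..pi}"
    show "a x * W x * h x \<le> c2 * (a x * h x)"
    proof (cases "x \<in> {\<alpha><..<\<beta>}")
      case True
      have "W x * (a x * h x) \<le> c2 * (a x * h x)"
        using c(2)[OF True] a_nonneg[OF x] hn[of x] by (intro mult_right_mono) auto
      then show ?thesis by (simp add: ac_simps)
    qed (simp add: hz)
  qed
  ultimately show ?thesis by blast
qed

text \<open>On either side of \<open>(p, q)\<close>, \<open>\<zeta>\<close> is a difference of two bumps, normalized by \<open>\<integral>a h = 1\<close> and placed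
  where \<open>W\<close> takes different values.\<close>

lemma multiplier_exists:
  assumes \<Phi>: "lip_prim 0 pi \<Phi> (\<lambda>x. a x * W x)" and W: "continuous_on {0..pi} W"
    and z: "\<Phi> 0 = 0" "\<Phi> pi = 0" "W 0 = 1"
  obtains \<zeta> \<zeta>' \<eta> M r s p q \<mu> where
    "lip_prim 0 pi \<zeta> \<zeta>'" "lip_prim 0 pi \<eta> (\<lambda>x. a x * \<zeta> x)" "lip_prim 0 pi M (\<lambda>x. a x * W x * \<zeta> x)"
    "0 < r" "r < p" "p < q" "q < s" "s < pi" "\<mu> \<noteq> 0"
    "\<And>x. 0 \<le> x \<Longrightarrow> x \<le> r \<Longrightarrow> \<zeta> x = 0 \<and> \<eta> x = 0 \<and> M x = 0"
    "\<And>x. p \<le> x \<Longrightarrow> x \<le> q \<Longrightarrow> \<zeta> x = 0 \<and> \<eta> x = 0 \<and> M x = \<mu>"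
    "\<And>x. s \<le> x \<Longrightarrow> x \<le> pi \<Longrightarrow> \<zeta> x = 0 \<and> \<eta> x = 0 \<and> M x = 0"
proof -
  \<comment> \<open>A flux positive throughout would force \<Phi>(pi) > \<Phi>(0), against the
    Dirichlet conditions. As W(0) = 1, the flux takes all values between 0 and 1 before
    \<open>d\<close>.\<close>
  have "\<exists>d\<in>{0..pi}. W d \<le> 0"
  proof (rule ccontr)
    assume n: "\<not> (\<exists>d\<in>{0..pi}. W d \<le> 0)"
    obtain m where m: "m \<in> {0..pi}" "\<And>x. x \<in> {0..pi} \<Longrightarrow> W m \<le> W x"
      using continuous_attains_inf[of "{0..pi}" W] W by auto
    have Wm: "0 < W m" using n m(1) by force
    have "(a0 * W m) * (pi - 0) \<le> \<Phi> pi - \<Phi> 0"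
    proof (rule lip_prim_lower[OF \<Phi>])
      fix s assume "s \<in> {0..pi}"
      then show "a0 * W m \<le> a s * W s" using m(2)[of s] Wm a_ge[of s] a_nonneg[of s] by (intro mult_mono) auto
    qed auto
    moreover have "0 < (a0 * W m) * (pi - 0)" using a0_pos Wm by simp
    ultimately show False using z by simp
  qed
  then obtain d where d: "0 \<le> d" "d \<le> pi" "W d \<le> 0" by auto
  have ivt: "\<exists>x. u < x \<and> x < d \<and> W x = w" if "0 \<le> u" "u \<le> d" "w < W u" "0 < w" for u w
  proof -
    have "\<exists>x\<ge>u. x \<le> d \<and> W x = w"
      by (rule IVT2') (use that d in \<open>auto intro: continuous_on_subset[OF W]\<close>)
    then obtain x where x: "u \<le> x" "x \<le> d" "W x = w" by blast
    then have "x \<noteq> u" "x \<noteq> d" using that d by auto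
    then show ?thesis using x by force
  qed
  \<comment> \<open>The levels within each pair (5/6, 4/6) and (2/6, 1/6) differ by 1/6, more than
    twice the tolerance 1/24 for the variation of \<open>W\<close> on a bump; hence the two means of
    each pair differ.\<close>
  obtain x1 where x1: "0 < x1" "x1 < d" "W x1 = 5 / 6" using ivt[of 0 "5 / 6"] d z by auto
  obtain x2 where x2: "x1 < x2" "x2 < d" "W x2 = 4 / 6" using ivt[of x1 "4 / 6"] x1 by auto
  obtain x3 where x3: "x2 < x3" "x3 < d" "W x3 = 2 / 6" using ivt[of x2 "2 / 6"] x1 x2 by auto
  obtain x4 where x4: "x3 < x4" "x4 < d" "W x4 = 1 / 6" using ivt[of x3 "1 / 6"] x1 x2 x3 by auto
  have "uniformly_continuous_on {0..pi} W" by (rule compact_uniformly_continuous[OF W]) simp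
  then obtain e where e: "0 < e"
    "\<And>x y. x \<in> {0..pi} \<Longrightarrow> y \<in> {0..pi} \<Longrightarrow> dist y x < e \<Longrightarrow> dist (W y) (W x) < 1 / 24"
    unfolding uniformly_continuous_on_def by (metis zero_less_divide_1_iff zero_less_numeral)
  \<comment> \<open>Radius of the bumps: small enough for the tolerance, and the thirds leave gaps
    between the bumps and at both ends.\<close>
  define \<rho> where "\<rho> = Min {e, x1 / 3, (x2 - x1) / 3, (x3 - x2) / 3, (x4 - x3) / 3, (pi - x4) / 3}"
  have "0 < \<rho>" unfolding \<rho>_def using e(1) x1 x2 x3 x4 d by (subst Min_gr_iff) auto
  have "\<rho> \<le> t" if "t \<in> {e, x1 / 3, (x2 - x1) / 3, (x3 - x2) / 3, (x4 - x3) / 3, (pi - x4) / 3}" for t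
    unfolding \<rho>_def by (rule Min_le) (use that in auto)
  from this[of e] this[of "x1 / 3"] this[of "(x2 - x1) / 3"] this[of "(x3 - x2) / 3"]
    this[of "(x4 - x3) / 3"] this[of "(pi - x4) / 3"]
  have \<rho>: "\<rho> \<le> e" "3 * \<rho> \<le> x1" "3 * \<rho> \<le> x2 - x1" "3 * \<rho> \<le> x3 - x2" "3 * \<rho> \<le> x4 - x3" "3 * \<rho> \<le> pi - x4"
    by simp_all
  have bump: "\<exists>h h' \<eta> M \<mu>. unit_bump W (x - \<rho>) (x + \<rho>) h h' \<eta> M \<mu> \<and> W x - 1 / 24 \<le> \<mu> \<and> \<mu> \<le> W x + 1 / 24"
    if x: "0 < x - \<rho>" "x + \<rho> < pi" for x
  proof (rule unit_bump_exists[OF x(1) _ x(2) W])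
    fix y assume "y \<in> {x - \<rho><..<x + \<rho>}"
    then have "dist y x < e" "x \<in> {0..pi}" "y \<in> {0..pi}"
      using x \<rho>(1) \<open>0 < \<rho>\<close> by (auto simp: dist_real_def abs_less_iff)
    then have "\<bar>W y - W x\<bar> < 1 / 24" using e(2)[of x y] by (simp add: dist_real_def)
    then show "W x - 1 / 24 \<le> W y" "W y \<le> W x + 1 / 24" unfolding abs_diff_less_iff by linarith+
  qed (use \<open>0 < \<rho>\<close> in auto)
  obtain h1 h1' \<eta>1 M1 \<mu>1 where "unit_bump W (x1 - \<rho>) (x1 + \<rho>) h1 h1' \<eta>1 M1 \<mu>1"
    and m1: "W x1 - 1 / 24 \<le> \<mu>1" "\<mu>1 \<le> W x1 + 1 / 24"
    using bump[of x1] \<open>0 < \<rho>\<close> \<rho> x1 x2 x3 x4 by auto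
  note B1 = this(1)[unfolded unit_bump_def]
  obtain h2 h2' \<eta>2 M2 \<mu>2 where "unit_bump W (x2 - \<rho>) (x2 + \<rho>) h2 h2' \<eta>2 M2 \<mu>2"
    and m2: "W x2 - 1 / 24 \<le> \<mu>2" "\<mu>2 \<le> W x2 + 1 / 24"
    using bump[of x2] \<open>0 < \<rho>\<close> \<rho> x1 x2 x3 x4 by auto
  note B2 = this(1)[unfolded unit_bump_def]
  obtain h3 h3' \<eta>3 M3 \<mu>3 where "unit_bump W (x3 - \<rho>) (x3 + \<rho>) h3 h3' \<eta>3 M3 \<mu>3"
    and m3: "W x3 - 1 / 24 \<le> \<mu>3" "\<mu>3 \<le> W x3 + 1 / 24"
    using bump[of x3] \<open>0 < \<rho>\<close> \<rho> x1 x2 x3 x4 by auto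
  note B3 = this(1)[unfolded unit_bump_def]
  obtain h4 h4' \<eta>4 M4 \<mu>4 where "unit_bump W (x4 - \<rho>) (x4 + \<rho>) h4 h4' \<eta>4 M4 \<mu>4"
    and m4: "W x4 - 1 / 24 \<le> \<mu>4" "\<mu>4 \<le> W x4 + 1 / 24"
    using bump[of x4] \<open>0 < \<rho>\<close> \<rho> x1 x2 x3 x4 by auto
  note B4 = this(1)[unfolded unit_bump_def]
  have d12: "\<mu>1 - \<mu>2 \<noteq> 0" and d34: "\<mu>3 - \<mu>4 \<noteq> 0"
    using m1 m2 m3 m4 x1(3) x2(3) x3(3) x4(3) by auto
  \<comment> \<open>Chosen so that the second pair takes back the amount of \<open>M\<close> gained
    over the first pair.\<close>
  define k where "k = - (\<mu>1 - \<mu>2) / (\<mu>3 - \<mu>4)"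
  have k: "\<mu>1 - \<mu>2 + k * (\<mu>3 - \<mu>4) = 0" using d34 by (simp add: k_def)
  define comb where "comb f1 f2 f3 f4 = (\<lambda>x::real. (f1 x + - f2 x) + k * (f3 x + - f4 x :: real))" for f1 f2 f3 f4
  have comb: "lip_prim 0 pi (comb f1 f2 f3 f4) (comb g1 g2 g3 g4)"
    if "lip_prim 0 pi f1 g1" "lip_prim 0 pi f2 g2" "lip_prim 0 pi f3 g3" "lip_prim 0 pi f4 g4" for f1 f2 f3 f4 g1 g2 g3 g4
    unfolding comb_def by (intro lip_prim_add lip_prim_cmult lip_prim_minus that)
  have eq: "comb (\<lambda>x. w x * h1 x) (\<lambda>x. w x * h2 x) (\<lambda>x. w x * h3 x) (\<lambda>x. w x * h4 x) =
      (\<lambda>x. w x * comb h1 h2 h3 h4 x)" for w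
    by (auto simp: comb_def algebra_simps)
  show ?thesis
  proof (rule that)
    show "lip_prim 0 pi (comb h1 h2 h3 h4) (comb h1' h2' h3' h4')" using B1 B2 B3 B4 by (intro comb) auto
    show "lip_prim 0 pi (comb \<eta>1 \<eta>2 \<eta>3 \<eta>4) (\<lambda>x. a x * comb h1 h2 h3 h4 x)"
      using B1 B2 B3 B4 unfolding eq[symmetric] by (intro comb) auto
    show "lip_prim 0 pi (comb M1 M2 M3 M4) (\<lambda>x. a x * W x * comb h1 h2 h3 h4 x)"
      using B1 B2 B3 B4 unfolding eq[symmetric] by (intro comb) auto
    show "0 < x1 - \<rho>" "x1 - \<rho> < x2 + \<rho>" "x2 + \<rho> < x3 - \<rho>" "x3 - \<rho> < x4 + \<rho>" "x4 + \<rho> < pi"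
      using \<open>0 < \<rho>\<close> \<rho> x1 x2 x3 x4 by linarith+
    show "\<mu>1 - \<mu>2 \<noteq> 0" by (rule d12)
  next
    fix x assume x: "0 \<le> x" "x \<le> x1 - \<rho>"
    then have "x \<le> x2 - \<rho>" "x \<le> x3 - \<rho>" "x \<le> x4 - \<rho>" using x2 x3 x4 by auto
    then show "comb h1 h2 h3 h4 x = 0 \<and> comb \<eta>1 \<eta>2 \<eta>3 \<eta>4 x = 0 \<and> comb M1 M2 M3 M4 x = 0"
      using x by (simp add: comb_def B1 B2 B3 B4)
  next
    \<comment> \<open>The plateau: over the first pair \<eta> has gained 1 - 1 = 0, whereas
      \<open>M\<close> has gained the difference of the means.\<close>
    fix x assume x: "x2 + \<rho> \<le> x" "x \<le> x3 - \<rho>"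
    then have "x \<le> x4 - \<rho>" "x1 + \<rho> \<le> x" "0 \<le> x" "x \<le> pi" using \<open>0 < \<rho>\<close> \<rho> x1 x2 x3 x4 by linarith+
    then show "comb h1 h2 h3 h4 x = 0 \<and> comb \<eta>1 \<eta>2 \<eta>3 \<eta>4 x = 0 \<and> comb M1 M2 M3 M4 x = \<mu>1 - \<mu>2"
      using x by (simp add: comb_def B1 B2 B3 B4)
  next
    fix x assume x: "x4 + \<rho> \<le> x" "x \<le> pi"
    then have "x1 + \<rho> \<le> x" "x2 + \<rho> \<le> x" "x3 + \<rho> \<le> x" using \<open>0 < \<rho>\<close> x1 x2 x3 x4 by linarith+
    then show "comb h1 h2 h3 h4 x = 0 \<and> comb \<eta>1 \<eta>2 \<eta>3 \<eta>4 x = 0 \<and> comb M1 M2 M3 M4 x = 0"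
      using x k by (simp add: comb_def B1 B2 B3 B4)
  qed
qed

end

section \<open>The adjoint eigenvector\<close>

lemma flat_exp_continuous: "continuous_on S (flat_exp P)"
  by (rule DERIV_continuous_on) (rule has_field_derivative_at_within[OF flat_exp_has_field_derivative])

text \<open>\<Phi> vanishes at both ends, so 1/\<Phi> is unbounded. Adding flat exponentials that
  live to the left of \<open>r\<close> and to the right of \<open>s\<close> gives a positive lower
  bound and leaves \<Phi> unchanged on [r, s], which will contain the support of
  \<open>M\<close>.\<close>

lemma positive_extension:
  assumes \<Phi>: "lip_prim 0 pi \<Phi> g" and rs: "0 < r" "s < pi"
    and n: "\<And>x. x \<in> {0..pi} \<Longrightarrow> 0 \<le> \<Phi> x" and p: "\<And>x. 0 < x \<Longrightarrow> x < pi \<Longrightarrow> 0 < \<Phi> x"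
  obtains \<Psi> g' c where "lip_prim 0 pi \<Psi> g'" "0 < c" "\<And>x. x \<in> {0..pi} \<Longrightarrow> c \<le> \<Psi> x"
    "\<And>x. r \<le> x \<Longrightarrow> x \<le> s \<Longrightarrow> \<Psi> x = \<Phi> x"
proof -
  let ?Q = "(1 - pderiv 1) * [:0, 0, 1:] :: real poly"
  have 1: "lip_prim 0 pi (\<lambda>x. flat_exp 1 (r - x)) (\<lambda>x. flat_exp ?Q (r - x) * (- 1))"
  proof (rule lip_prim_C1)
    show "((\<lambda>x. flat_exp 1 (r - x)) has_real_derivative flat_exp ?Q (r - x) * (- 1)) (at x)" for x
      by (rule DERIV_chain2[OF flat_exp_has_field_derivative]) (auto intro!: derivative_eq_intros)
    show "continuous_on {0..pi} (\<lambda>x. flat_exp ?Q (r - x) * (- 1))"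
      by (intro continuous_intros continuous_on_compose2[OF flat_exp_continuous[of UNIV]]) auto
  qed
  have 2: "lip_prim 0 pi (\<lambda>x. flat_exp 1 (x - s)) (\<lambda>x. flat_exp ?Q (x - s) * 1)"
  proof (rule lip_prim_C1)
    show "((\<lambda>x. flat_exp 1 (x - s)) has_real_derivative flat_exp ?Q (x - s) * 1) (at x)" for x
      by (rule DERIV_chain2[OF flat_exp_has_field_derivative]) (auto intro!: derivative_eq_intros)
    show "continuous_on {0..pi} (\<lambda>x. flat_exp ?Q (x - s) * 1)"
      by (intro continuous_intros continuous_on_compose2[OF flat_exp_continuous[of UNIV]]) auto
  qed
  define \<Psi> where "\<Psi> x = \<Phi> x + (flat_exp 1 (r - x) + flat_exp 1 (x - s))" for x
  have \<Psi>: "lip_prim 0 pi \<Psi> (\<lambda>x. g x + (flat_exp ?Q (r - x) * (- 1) + flat_exp ?Q (x - s) * 1))"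
    unfolding \<Psi>_def by (intro lip_prim_add \<Phi> 1 2)
  have f1: "0 \<le> flat_exp 1 x" "0 < x \<Longrightarrow> 0 < flat_exp 1 x" for x by (auto simp: flat_exp_def)
  have pos: "0 < \<Psi> x" if x: "x \<in> {0..pi}" for x
  proof (cases "0 < x \<and> x < pi")
    case True
    then show ?thesis using p[of x] f1(1)[of "r - x"] f1(1)[of "x - s"] by (simp add: \<Psi>_def)
  next
    case False
    then have "0 < r - x \<or> 0 < x - s" using x rs by auto
    then show ?thesis
      using n[OF x] f1(1)[of "r - x"] f1(1)[of "x - s"] f1(2)[of "r - x"] f1(2)[of "x - s"]
      by (auto simp: \<Psi>_def)
  qed
  obtain m where m: "m \<in> {0..pi}" "\<And>x. x \<in> {0..pi} \<Longrightarrow> \<Psi> m \<le> \<Psi> x"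
    using continuous_attains_inf[of "{0..pi}" \<Psi>] lip_prim_continuous[OF \<Psi>] by auto
  show ?thesis
    by (rule that[OF \<Psi> pos[OF m(1)] m(2)]) (auto simp: \<Psi>_def flat_exp_def)
qed

lemma measurable_extend_itv:
  fixes f :: "real \<Rightarrow> real"
  assumes "f \<in> borel_measurable itv_measure"
  shows "(\<lambda>x. if x \<in> itv then f x else k) \<in> borel_measurable (lebesgue_on {0..pi})"
proof -
  have "(\<lambda>x. if x \<in> itv then f x - k else 0) \<in> borel_measurable lebesgue"
    by (rule borel_measurable_if_I) (use assms in auto)
  then have "(\<lambda>x. (if x \<in> itv then f x - k else 0) + k) \<in> borel_measurable lebesgue" by simp
  then have "(\<lambda>x. if x \<in> itv then f x else k) \<in> borel_measurable lebesgue"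
    by (rule measurable_cong[THEN iffD1, rotated]) auto
  then show ?thesis by (rule measurable_restrict_space1)
qed

context sturm_liouville
begin

text \<open>Weak form of both adjoint equations: Green's identity for \<Phi> with flux
  \<open>W\<close>, Green's identity for \<Phi> \<eta> with flux W \<eta> + \<Phi> \<zeta>, and
  integration by parts in the coupling term.\<close>

lemma adjoint_identity:
  assumes \<gamma>: "\<gamma> \<in> L_infty itv_measure" and \<gamma>0: "\<gamma>0 \<in> L_infty itv_measure"
    and \<gamma>a: "AE x in itv_measure. \<gamma> x * a x = 1" and \<gamma>b: "AE x in itv_measure. \<gamma>0 x = b x"
    and \<Phi>: "lip_prim 0 pi \<Phi> (\<lambda>x. a x * W x)" and W: "lip_prim 0 pi W (\<lambda>x. (b x - l) * \<Phi> x)"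
    and \<Phi>z: "\<Phi> 0 = 0" "\<Phi> pi = 0"
    and \<zeta>: "lip_prim 0 pi \<zeta> \<zeta>'" and \<eta>: "lip_prim 0 pi \<eta> (\<lambda>x. a x * \<zeta> x)"
    and M: "lip_prim 0 pi M (\<lambda>x. a x * W x * \<zeta> x)" and Mz: "M 0 = 0" "M pi = 0"
    and p: "p \<in> L_infty itv_measure" "\<And>x. x \<in> itv \<Longrightarrow> p x * \<Phi> x = - (\<zeta> x * \<Phi> x + M x)"
    and u: "u1 \<in> Lop_domain \<gamma> \<gamma>0" "u2 \<in> Lop_domain \<gamma> \<gamma>0"
  shows "(LINT x|itv_measure. Lop \<gamma> \<gamma>0 u2 x * \<Phi> x) + (LINT x|itv_measure. Lop \<gamma> \<gamma>0 u1 x * (\<Phi> x * \<eta> x)) +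
      (LINT x|itv_measure. p x * weak_deriv u1 x * \<Phi> x) =
      l * ((LINT x|itv_measure. u2 x * \<Phi> x) + (LINT x|itv_measure. u1 x * (\<Phi> x * \<eta> x)))"
proof -
  define k where "k x = (b x - l) * \<Phi> x" for x
  have L2: "f \<in> L2 itv_measure" "g \<in> L2 itv_measure" if "lip_prim 0 pi f g" for f g
    using lip_prim_L_infty[OF that] by (auto intro: L_infty_L2_itv)
  have uL: "u1 \<in> L2 itv_measure" "u2 \<in> L2 itv_measure" and u1: "u1 \<in> H1"
    using u by (auto simp: Lop_domain_def H10_def H1_def)
  have meas: "f \<in> borel_measurable itv_measure" if "f \<in> L2 itv_measure" for f
    using that by (simp add: L2_def)
  note i_infty = lip_prim_L_infty
  have 1: "(LINT x|itv_measure. Lop \<gamma> \<gamma>0 u2 x * \<Phi> x) = l * (LINT x|itv_measure. u2 x * \<Phi> x)"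
  proof -
    have "(LINT x|itv_measure. Lop \<gamma> \<gamma>0 u2 x * \<Phi> x) = (LINT x|itv_measure. u2 x * (\<gamma>0 x * \<Phi> x - k x))"
    proof (rule Lop_symmetric[OF \<gamma> \<gamma>0 u(2), where g = "\<lambda>x. a x * W x" and W = W])
      show "(LINT x|itv_measure. a x * W x) = 0" using lip_prim_integral[OF \<Phi>] \<Phi>z by simp
      show "\<Phi> x = prim (\<lambda>x. a x * W x) x" if "x \<in> itv" for x
        using lip_prim_eq_prim[OF \<Phi>, of x] \<Phi>z that by simp
      show "AE x in itv_measure. \<gamma> x * (a x * W x) = W x"
        using \<gamma>a by eventually_elim (simp add: mult.assoc[symmetric])
      show "has_weak_deriv W k" "k \<in> L_infty itv_measure"
        using lip_prim_has_weak_deriv[OF W] i_infty(2)[OF W] by (auto simp: k_def[abs_def])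
    qed (use i_infty[OF \<Phi>] L2[OF W] in auto)
    also have "\<dots> = (LINT x|itv_measure. l * (u2 x * \<Phi> x))"
    proof (rule integral_cong_AE)
      show "AE x in itv_measure. u2 x * (\<gamma>0 x * \<Phi> x - k x) = l * (u2 x * \<Phi> x)"
        using \<gamma>b by eventually_elim (simp add: k_def algebra_simps)
      show "(\<lambda>x. u2 x * (\<gamma>0 x * \<Phi> x - k x)) \<in> borel_measurable itv_measure"
        using meas[OF uL(2)] meas[OF L_infty_L2_itv[OF \<gamma>0]] meas[OF L2(1)[OF \<Phi>]] meas[OF L2(2)[OF W]]
        by (simp add: k_def[abs_def])
      show "(\<lambda>x. l * (u2 x * \<Phi> x)) \<in> borel_measurable itv_measure"
        using meas[OF uL(2)] meas[OF L2(1)[OF \<Phi>]] by simp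
    qed
    finally show ?thesis by simp
  qed
  \<comment> \<open>\<open>k1\<close> is the derivative of the flux of \<Phi> \<eta> and
    \<open>n\<close> that of p \<Phi>. In k1 + n everything cancels except (b - l) \<Phi> \<eta>,
    which leaves the eigenvalue term.\<close>
  define k1 where "k1 x = (W x * (a x * \<zeta> x) + k x * \<eta> x) + (\<Phi> x * \<zeta>' x + a x * W x * \<zeta> x)" for x
  define n where "n x = - ((\<zeta> x * (a x * W x) + \<zeta>' x * \<Phi> x) + a x * W x * \<zeta> x)" for x
  have f1: "lip_prim 0 pi (\<lambda>x. \<Phi> x * \<eta> x) (\<lambda>x. \<Phi> x * (a x * \<zeta> x) + a x * W x * \<eta> x)"
    by (rule lip_prim_mult[OF \<Phi> \<eta>])
  have W1: "lip_prim 0 pi (\<lambda>x. W x * \<eta> x + \<Phi> x * \<zeta> x) k1"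
    unfolding k1_def k_def by (intro lip_prim_add lip_prim_mult W \<eta> \<Phi> \<zeta>)
  have N: "lip_prim 0 pi (\<lambda>x. - (\<zeta> x * \<Phi> x + M x)) n"
    unfolding n_def by (intro lip_prim_minus lip_prim_add lip_prim_mult \<Phi> \<zeta> M)
  have 2: "(LINT x|itv_measure. Lop \<gamma> \<gamma>0 u1 x * (\<Phi> x * \<eta> x)) =
      (LINT x|itv_measure. u1 x * (\<gamma>0 x * (\<Phi> x * \<eta> x) - k1 x))"
  proof (rule Lop_symmetric[OF \<gamma> \<gamma>0 u(1), where g = "\<lambda>x. \<Phi> x * (a x * \<zeta> x) + a x * W x * \<eta> x"
        and W = "\<lambda>x. W x * \<eta> x + \<Phi> x * \<zeta> x"])
    show "(LINT x|itv_measure. \<Phi> x * (a x * \<zeta> x) + a x * W x * \<eta> x) = 0"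
      using lip_prim_integral[OF f1] \<Phi>z by simp
    show "\<Phi> x * \<eta> x = prim (\<lambda>x. \<Phi> x * (a x * \<zeta> x) + a x * W x * \<eta> x) x" if "x \<in> itv" for x
      using lip_prim_eq_prim[OF f1, of x] \<Phi>z that by simp
    show "AE x in itv_measure. \<gamma> x * (\<Phi> x * (a x * \<zeta> x) + a x * W x * \<eta> x) = W x * \<eta> x + \<Phi> x * \<zeta> x"
      using \<gamma>a
    proof eventually_elim
      case (elim x)
      have "\<gamma> x * (\<Phi> x * (a x * \<zeta> x) + a x * W x * \<eta> x) = (\<gamma> x * a x) * (W x * \<eta> x + \<Phi> x * \<zeta> x)"
        by (simp add: algebra_simps)
      then show ?case by (simp add: elim)
    qed
  qed (use i_infty[OF f1] i_infty[OF W1] L2[OF W1] lip_prim_has_weak_deriv[OF W1] in auto)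
  have n0: "(LINT x|itv_measure. n x) = 0" using lip_prim_integral[OF N] \<Phi>z Mz by simp
  have "(LINT x|itv_measure. p x * weak_deriv u1 x * \<Phi> x) = (LINT x|itv_measure. prim n x * weak_deriv u1 x)"
  proof (rule Bochner_Integration.integral_cong)
    fix x assume "x \<in> space itv_measure"
    then have x: "x \<in> itv" by simp
    have "p x * weak_deriv u1 x * \<Phi> x = (p x * \<Phi> x) * weak_deriv u1 x" by simp
    also have "p x * \<Phi> x = prim n x"
      using p(2)[OF x] lip_prim_eq_prim[OF N, of x] x \<Phi>z Mz by simp
    finally show "p x * weak_deriv u1 x * \<Phi> x = prim n x * weak_deriv u1 x" .
  qed simp
  also have "\<dots> = - (LINT x|itv_measure. u1 x * n x)" by (rule H1_parts[OF u1 i_infty(2)[OF N] n0])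
  finally have "(LINT x|itv_measure. Lop \<gamma> \<gamma>0 u1 x * (\<Phi> x * \<eta> x)) + (LINT x|itv_measure. p x * weak_deriv u1 x * \<Phi> x) =
      (LINT x|itv_measure. u1 x * (\<gamma>0 x * (\<Phi> x * \<eta> x) - k1 x)) - (LINT x|itv_measure. u1 x * n x)"
    using 2 by simp
  also have "\<dots> = (LINT x|itv_measure. u1 x * (\<gamma>0 x * (\<Phi> x * \<eta> x) - k1 x) - u1 x * n x)"
    by (rule Bochner_Integration.integral_diff[symmetric])
      (intro L2_times_integrable uL L2_diff L_infty_times_L2[OF \<gamma>0] L2(1)[OF f1] L2(2)[OF W1] L2(2)[OF N])+
  also have "\<dots> = (LINT x|itv_measure. l * (u1 x * (\<Phi> x * \<eta> x)))"
  proof (rule integral_cong_AE)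
    show "AE x in itv_measure. u1 x * (\<gamma>0 x * (\<Phi> x * \<eta> x) - k1 x) - u1 x * n x = l * (u1 x * (\<Phi> x * \<eta> x))"
      using \<gamma>b by eventually_elim (simp add: k_def k1_def n_def algebra_simps)
    show "(\<lambda>x. u1 x * (\<gamma>0 x * (\<Phi> x * \<eta> x) - k1 x) - u1 x * n x) \<in> borel_measurable itv_measure"
      using meas[OF uL(1)] meas[OF L_infty_L2_itv[OF \<gamma>0]] meas[OF L2(1)[OF f1]] meas[OF L2(2)[OF W1]] meas[OF L2(2)[OF N]]
      by simp
    show "(\<lambda>x. l * (u1 x * (\<Phi> x * \<eta> x))) \<in> borel_measurable itv_measure"
      using meas[OF uL(1)] meas[OF L2(1)[OF f1]] by simp
  qed
  finally show ?thesis using 1 by (simp add: distrib_left)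
qed

lemma counterexample_exists:
  assumes T: "0 < T" and \<gamma>: "\<gamma> \<in> L_infty itv_measure" and \<gamma>0: "\<gamma>0 \<in> L_infty itv_measure"
    and \<gamma>a: "AE x in itv_measure. \<gamma> x * a x = 1" and \<gamma>b: "AE x in itv_measure. \<gamma>0 x = b x"
  shows "\<exists>p \<omega>. p \<in> W1_infty \<and> open \<omega> \<and> \<omega> \<noteq> {} \<and> \<omega> \<subseteq> itv \<and>
           ess_support p \<inter> \<omega> \<noteq> {} \<and> \<not> approx_controllable T \<gamma> \<gamma>0 p \<omega>"
proof -
  obtain l \<Phi> W where \<Phi>: "lip_prim 0 pi \<Phi> (\<lambda>x. a x * W x)" and W: "lip_prim 0 pi W (\<lambda>x. (b x - l) * \<Phi> x)"
    and z: "\<Phi> 0 = 0" "\<Phi> pi = 0" "W 0 = 1" and pos: "\<And>x. 0 < x \<Longrightarrow> x < pi \<Longrightarrow> 0 < \<Phi> x"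
    by (rule eigenfunction) (rule that)
  obtain \<zeta> \<zeta>' \<eta> M r s \<alpha> \<beta> \<mu> where
    \<zeta>: "lip_prim 0 pi \<zeta> \<zeta>'" and \<eta>: "lip_prim 0 pi \<eta> (\<lambda>x. a x * \<zeta> x)"
    and M: "lip_prim 0 pi M (\<lambda>x. a x * W x * \<zeta> x)"
    and o: "0 < r" "r < \<alpha>" "\<alpha> < \<beta>" "\<beta> < s" "s < pi" and \<mu>: "\<mu> \<noteq> 0"
    and left: "\<And>x. 0 \<le> x \<Longrightarrow> x \<le> r \<Longrightarrow> \<zeta> x = 0 \<and> \<eta> x = 0 \<and> M x = 0"
    and mid: "\<And>x. \<alpha> \<le> x \<Longrightarrow> x \<le> \<beta> \<Longrightarrow> \<zeta> x = 0 \<and> \<eta> x = 0 \<and> M x = \<mu>"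
    and right: "\<And>x. s \<le> x \<Longrightarrow> x \<le> pi \<Longrightarrow> \<zeta> x = 0 \<and> \<eta> x = 0 \<and> M x = 0"
    by (rule multiplier_exists[OF \<Phi> lip_prim_continuous[OF W] z]) (rule that)
  have \<Phi>n: "0 \<le> \<Phi> x" if "x \<in> {0..pi}" for x
    using pos[of x] z that by (cases "x = 0 \<or> x = pi") auto
  obtain \<Psi> g c where \<Psi>: "lip_prim 0 pi \<Psi> g" and c: "0 < c" "\<And>x. x \<in> {0..pi} \<Longrightarrow> c \<le> \<Psi> x"
    and \<Psi>\<Phi>: "\<And>x. r \<le> x \<Longrightarrow> x \<le> s \<Longrightarrow> \<Psi> x = \<Phi> x"
    by (rule positive_extension[OF \<Phi> o(1,5)]) (rule \<Phi>n pos that; assumption)+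
  \<comment> \<open>\<open>M\<close> vanishes outside [r, s] and \<Psi> = \<Phi> inside, so this is
    - \<zeta> - M/\<Phi> in (0, pi), written so that the quotient rule applies up to the
    ends.\<close>
  define p where "p x = - (\<zeta> x + M x * (1 / \<Psi> x))" for x
  have p: "lip_prim 0 pi p (\<lambda>x. - (\<zeta>' x + (M x * (- g x / (\<Psi> x)\<^sup>2) + a x * W x * \<zeta> x * (1 / \<Psi> x))))"
    unfolding p_def by (intro lip_prim_minus lip_prim_add \<zeta> lip_prim_mult M lip_prim_inverse[OF \<Psi> c])
  have p\<Phi>: "p x * \<Phi> x = - (\<zeta> x * \<Phi> x + M x)" if x: "x \<in> itv" for x
  proof (cases "r \<le> x \<and> x \<le> s")
    case True
    then have "\<Psi> x = \<Phi> x" "\<Phi> x \<noteq> 0" using \<Psi>\<Phi> pos[of x] x by auto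
    then show ?thesis by (simp add: p_def algebra_simps)
  next
    case False
    then have "M x = 0" using left[of x] right[of x] x by auto
    then show ?thesis by (simp add: p_def)
  qed
  define \<omega> where "\<omega> = {\<alpha><..<\<beta>}"
  have p\<omega>: "p x \<noteq> 0" if "x \<in> \<omega>" for x
    using mid[of x] c(1) c(2)[of x] that o \<mu> by (auto simp: p_def \<omega>_def)
  define x0 where "x0 = (\<alpha> + \<beta>) / 2"
  have x0: "x0 \<in> \<omega>" "x0 \<in> itv" using o by (auto simp: x0_def \<omega>_def)
  have "x0 \<in> ess_support p"
    unfolding ess_support_def
  \<comment> \<open>On \<omega> the chosen representative of \<open>p\<close> has no zero at all, so
    no neighbourhood of \<open>x0\<close> can carry p = 0 almost everywhere.\<close>
  proof (intro CollectI conjI allI impI x0 notI)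
    fix U assume U: "open U" "x0 \<in> U" and ae: "AE z in itv_measure. z \<in> U \<longrightarrow> p z = 0"
    have "open (U \<inter> \<omega>)" using U by (auto simp: \<omega>_def)
    then obtain e where e: "0 < e" "\<And>y. \<bar>y - x0\<bar> < e \<Longrightarrow> y \<in> U \<inter> \<omega>"
      using x0 U unfolding open_real by blast
    define f where "f = min e (min x0 (pi - x0))"
    have f: "0 < f" "f \<le> e" "0 \<le> x0 - f" "x0 + f \<le> pi" using e x0 by (auto simp: f_def)
    have "AE z in itv_measure. z \<notin> {x0 - f<..<x0 + f}"
      using ae
    proof eventually_elim
      case (elim z)
      show ?case
      proof
        assume "z \<in> {x0 - f<..<x0 + f}"
        then have "z \<in> U \<inter> \<omega>" using e(2)[of z] f by (auto simp: abs_less_iff)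
        then show False using elim p\<omega> by auto
      qed
    qed
    then show False using not_AE_notin_Ioo[of "x0 - f" "x0 + f"] f by auto
  qed
  moreover have "\<not> approx_controllable T \<gamma> \<gamma>0 p \<omega>"
  proof (rule not_approx_controllable_if_adjoint_eigenvector[OF T lip_prim_L_infty(1)[OF \<Phi>]
        lip_prim_L_infty(1)[OF lip_prim_mult[OF \<Phi> \<eta>]] lip_prim_L_infty(1)[OF p]])
    show "\<Phi> x * \<eta> x = 0" if "x \<in> \<omega>" for x using mid[of x] that by (simp add: \<omega>_def)
    have sq: "integrable itv_measure (\<lambda>x. (\<Phi> x)\<^sup>2)"
      using L_infty_L2_itv[OF lip_prim_L_infty(1)[OF \<Phi>]] by (simp add: L2_def)
    have "(LINT x|itv_measure. (\<Phi> x)\<^sup>2) \<noteq> 0"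
    proof
      assume "(LINT x|itv_measure. (\<Phi> x)\<^sup>2) = 0"
      then have "AE x in itv_measure. (\<Phi> x)\<^sup>2 = 0"
        using sq by (subst (asm) integral_nonneg_eq_0_iff_AE) auto
      then have "AE x in itv_measure. x \<notin> {0<..<pi}"
        by eventually_elim (use pos in force)
      then show False using not_AE_notin_Ioo[of 0 pi] by simp
    qed
    moreover have "0 \<le> (LINT x|itv_measure. (\<Phi> x)\<^sup>2)" by simp
    ultimately show "0 < (LINT x|itv_measure. (\<Phi> x)\<^sup>2)" by linarith
    show "(LINT x|itv_measure. Lop \<gamma> \<gamma>0 u2 x * \<Phi> x) + (LINT x|itv_measure. Lop \<gamma> \<gamma>0 u1 x * (\<Phi> x * \<eta> x)) +
        (LINT x|itv_measure. p x * weak_deriv u1 x * \<Phi> x) =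
        l * ((LINT x|itv_measure. u2 x * \<Phi> x) + (LINT x|itv_measure. u1 x * (\<Phi> x * \<eta> x)))"
      if "u1 \<in> Lop_domain \<gamma> \<gamma>0" "u2 \<in> Lop_domain \<gamma> \<gamma>0" for u1 u2
      by (rule adjoint_identity[OF \<gamma> \<gamma>0 \<gamma>a \<gamma>b \<Phi> W z(1,2) \<zeta> \<eta> M _ _ lip_prim_L_infty(1)[OF p] p\<Phi> that])
        (use left[of 0] right[of pi] o in auto)
  qed
  moreover have "open \<omega>" "\<omega> \<noteq> {}" "\<omega> \<subseteq> itv" using o x0 by (auto simp: \<omega>_def)
  ultimately show ?thesis using lip_prim_W1_infty[OF p] x0 by blast
qed

end

theorem corollary3p1:
  fixes T :: real and \<gamma> \<gamma>0 :: "real \<Rightarrow> real"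
  assumes "T > 0"
    and "\<gamma> \<in> L_infty itv_measure" and "\<gamma>0 \<in> L_infty itv_measure"
    and "\<exists>c>0. AE x in itv_measure. c \<le> \<gamma> x"
  shows "\<exists>p \<omega>. p \<in> W1_infty \<and> open \<omega> \<and> \<omega> \<noteq> {} \<and> \<omega> \<subseteq> itv \<and>
           ess_support p \<inter> \<omega> \<noteq> {} \<and> \<not> approx_controllable T \<gamma> \<gamma>0 p \<omega>"
proof -
  obtain c where c: "0 < c" "AE x in itv_measure. c \<le> \<gamma> x" using assms(4) by blast
  obtain C where "AE x in itv_measure. \<bar>\<gamma> x\<bar> \<le> C" using assms(2) by (auto simp: L_infty_def)
  \<comment> \<open>The maximum with \<open>c\<close> puts the two truncation levels in order and
    makes the upper one positive.\<close>
  then have C: "AE x in itv_measure. \<gamma> x \<le> max C c" by eventually_elim auto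
  obtain B where B: "AE x in itv_measure. \<bar>\<gamma>0 x\<bar> \<le> B" using assms(3) by (auto simp: L_infty_def)
  have m[measurable]: "\<gamma> \<in> borel_measurable itv_measure" "\<gamma>0 \<in> borel_measurable itv_measure"
    using assms(2,3) by (auto simp: L_infty_def)
  \<comment> \<open>Truncation turns the essential bounds into bounds at every point, and the values
    at 0 and pi are filled in. Inside the interval \<open>a\<close> agrees with 1/\<gamma> and
    \<open>b\<close> with \<gamma>0 up to a null set.\<close>
  define a where "a x = (if x \<in> itv then 1 / max c (min (\<gamma> x) (max C c)) else 1 / c)" for x
  define b where "b x = (if x \<in> itv then max (- \<bar>B\<bar>) (min (\<gamma>0 x) \<bar>B\<bar>) else 0)" for x
  interpret sturm_liouville a b "1 / max C c" "1 / c" "\<bar>B\<bar>"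
  proof
    show "a \<in> borel_measurable (lebesgue_on {0..pi})"
      unfolding a_def by (rule measurable_extend_itv) measurable
    show "b \<in> borel_measurable (lebesgue_on {0..pi})"
      unfolding b_def by (rule measurable_extend_itv) measurable
    show "0 < 1 / max C c" using c by (simp add: less_max_iff_disj)
    have "c \<le> max c (min (\<gamma> x) (max C c))" "max c (min (\<gamma> x) (max C c)) \<le> max C c" for x by auto
    then show "1 / max C c \<le> a x" "a x \<le> 1 / c" for x
      using c by (auto simp: a_def intro!: divide_left_mono mult_pos_pos)
    show "\<bar>b x\<bar> \<le> \<bar>B\<bar>" for x by (auto simp: b_def abs_le_iff)
  qed
  have in_itv: "AE x in itv_measure. x \<in> itv" by (rule AE_I2) simp
  show ?thesis
  proof (rule counterexample_exists[OF assms(1-3)])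
    show "AE x in itv_measure. \<gamma> x * a x = 1"
      using c(2) C in_itv by eventually_elim (use c(1) in \<open>auto simp: a_def\<close>)
    show "AE x in itv_measure. \<gamma>0 x = b x"
      using B in_itv by eventually_elim (auto simp: b_def)
  qed
qed

end
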